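(* Assume that $\mu\in\mathrm{Prob}(\mathbb{T}^d)$ satisfies a mixing Diophantine condition with parameters $\gamma,\tau>0$ and let $\alpha\in(0,1]$ with $\alpha>2\tau$. Given any observable $\varphi\in\mathscr{H}_\alpha(X\times\mathbb{T}^d)$ with zero mean, $\int\varphi\,d(\mu^{\mathbb{Z}}\times m)=0$, if $\varphi$ is not a coboundary then there exists $\sigma=\sigma(\varphi)>0$ such that, with respect to $\mu^{\mathbb{Z}}\times m$, $$\frac{S_n\varphi}{\sigma\sqrt n}\stackrel{d}{\longrightarrow}\mathcal{N}(0,1).$$
   Context: $\mathbb{T}^d=\mathbb{R}^d/\mathbb{Z}^d$, $m$ is its Haar (Lebesgue) probability measure, $\mathrm{Prob}(\mathbb{T}^d)$ is the set of Borel probability measures on $\mathbb{T}^d$. The Fourier coefficients of $\mu$ are $\hat\mu(k)=\int_{\mathbb{T}^d}e^{2\pi i\langle k,\theta\rangle}\,d\mu(\theta)$, $k\in\mathbb{Z}^d$. $\mu$ satisfies a mixing Diophantine condition with parameters $\gamma,\tau>0$ if $|\hat\mu(k)|\le1-\frac{\gamma}{|k|^\tau}$ for all $k\in\mathbb{Z}^d\setminus\{0\}$, where $|\cdot|$ is a fixed norm on $\mathbb{Z}^d$ (e.g. the max norm). $\Sigma=\mathbb{T}^d$, $X=\Sigma^{\mathbb{Z}}$ with product measure $\mu^{\mathbb{Z}}$, $\sigma\colon X\to X$ is the shift $(\sigma\omega)_n=\omega_{n+1}$, and $f\colon X\times\mathbb{T}^d\to X\times\mathbb{T}^d$, $f(\omega,\theta)=(\sigma\omega,\theta+\omega_0)$,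 which preserves $\mu^{\mathbb{Z}}\times m$. $S_n\varphi=\varphi+\varphi\circ f+\cdots+\varphi\circ f^{n-1}$. On $X$ put $d(\omega,\omega')=2^{-\min\{|j|\colon\omega_j\ne\omega'_j\}}$ for $\omega\neq\omega'$ and $d(\omega,\omega)=0$. For $\alpha\in(0,1]$, $\mathscr{H}_\alpha(X\times\mathbb{T}^d)$ is the space of observables (bounded functions, Borel measurable for the product topology) $\varphi\colon X\times\mathbb{T}^d\to\mathbb{R}$ with $v_\alpha(\varphi)=v_\alpha^X(\varphi)+v_\alpha^{\mathbb{T}^d}(\varphi)<\infty$, where $$v_\alpha^X(\varphi)=\sup_{\theta}\sup_{\omega\ne\omega'}\frac{|\varphi(\omega,\theta)-\varphi(\omega',\theta)|}{d(\omega,\omega')^\alpha},\qquad v_\alpha^{\mathbb{T}^d}(\varphi)=\sup_{\omega}\sup_{\theta\ne\theta'}\frac{|\varphi(\omega,\theta)-\varphi(\omega,\theta')|}{|\theta-\theta'|^\alpha}.$$ $\varphi$ is a coboundary if there exists a (Borel measurable) function $\eta\colon X\times\mathbb{T}^d\to\mathbb{R}$, continuous with respect to the metric $d$ on $X$ and the standard metric on $\mathbb{T}^d$ (i.e. for the product metric), such that $\varphi=\eta-\eta\circ f$ holds $\mu^{\mathbb{Z}}\times m$-almost everywhere. $\stackrel{d}{\longrightarrow}$ denotes convergence in distribution. *)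

theory Defs
  imports "HOL-Analysis.Analysis" "HOL-Probability.Probability"
begin

section \<open>The torus\<close>

definition int_lattice :: "(real^'d) set" where
  "int_lattice = {x. \<forall>i. x $ i \<in> \<int>}"

lemma int_lattice_0 [simp]: "0 \<in> int_lattice"
  by (simp add: int_lattice_def)

lemma int_lattice_add: "x \<in> int_lattice \<Longrightarrow> y \<in> int_lattice \<Longrightarrow> x + y \<in> int_lattice"
  by (simp add: int_lattice_def)

lemma int_lattice_minus: "x \<in> int_lattice \<Longrightarrow> - x \<in> int_lattice"
  by (simp add: int_lattice_def)

lemma int_lattice_diff: "x \<in> int_lattice \<Longrightarrow> y \<in> int_lattice \<Longrightarrow> x - y \<in> int_lattice"
  by (simp add: int_lattice_def)

lemma closed_int_lattice: "closed (int_lattice :: (real^'d) set)"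
proof -
  have "int_lattice = (\<Inter>i. (\<lambda>x::real^'d. x $ i) -` \<int>)"
    by (auto simp: int_lattice_def)
  moreover have "closed (\<Inter>i. (\<lambda>x::real^'d. x $ i) -` \<int>)"
    by (intro closed_INT ballI closed_vimage closed_Ints continuous_intros)
  ultimately show ?thesis by simp
qed

quotient_type 'd torus = "real^'d" / "\<lambda>x y. x - y \<in> int_lattice"
  morphisms rep_torus torus_of
proof (rule equivpI)
  show "reflp (\<lambda>x y::real^'d. x - y \<in> int_lattice)"
    by (simp add: reflp_def)
  show "symp (\<lambda>x y::real^'d. x - y \<in> int_lattice)"
  proof (rule sympI)
    fix x y :: "real^'d" assume "x - y \<in> int_lattice"
    from int_lattice_minus[OF this] show "y - x \<in> int_lattice" by simp
  qed
  show "transp (\<lambda>x y::real^'d. x - y \<in> int_lattice)"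
  proof (rule transpI)
    fix x y z :: "real^'d" assume "x - y \<in> int_lattice" "y - z \<in> int_lattice"
    from int_lattice_add[OF this] show "x - z \<in> int_lattice" by simp
  qed
qed

instantiation torus :: (finite) ab_group_add
begin

lift_definition zero_torus :: "'a torus" is 0 .

lift_definition plus_torus :: "'a torus \<Rightarrow> 'a torus \<Rightarrow> 'a torus" is "(+)"
proof -
  fix x x' y y' :: "real^'a"
  assume "x - x' \<in> int_lattice" "y - y' \<in> int_lattice"
  from int_lattice_add[OF this] show "(x + y) - (x' + y') \<in> int_lattice"
    by (simp add: algebra_simps)
qed

lift_definition uminus_torus :: "'a torus \<Rightarrow> 'a torus" is uminus
proof -
  fix x x' :: "real^'a"
  assume "x - x' \<in> int_lattice"
  from int_lattice_minus[OF this] show "- x - (- x') \<in> int_lattice"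
    by (simp add: algebra_simps)
qed

lift_definition minus_torus :: "'a torus \<Rightarrow> 'a torus \<Rightarrow> 'a torus" is "(-)"
proof -
  fix x x' y y' :: "real^'a"
  assume "x - x' \<in> int_lattice" "y - y' \<in> int_lattice"
  from int_lattice_diff[OF this] show "(x - y) - (x' - y') \<in> int_lattice"
    by (simp add: algebra_simps)
qed

instance
  by standard (transfer; simp add: algebra_simps)+

end

lemma infdist_int_lattice_cong:
  fixes x y :: "real^'d"
  assumes "x - y \<in> int_lattice"
  shows "infdist x int_lattice = infdist y int_lattice"
proof -
  have *: "infdist u int_lattice \<le> infdist v int_lattice" if uv: "u - v \<in> int_lattice" for u v :: "real^'d"
  proof -
    have ne: "(int_lattice :: (real^'d) set) \<noteq> {}" using int_lattice_0 by blast
    obtain k where k: "k \<in> int_lattice" "infdist v int_lattice = dist v k"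
      using infdist_attains_inf[OF closed_int_lattice ne] by metis
    have "k + (u - v) \<in> int_lattice" using k(1) uv by (rule int_lattice_add)
    then have "infdist u int_lattice \<le> dist u (k + (u - v))" by (rule infdist_le)
    also have "dist u (k + (u - v)) = dist v k" by (simp add: dist_norm)
    finally show ?thesis using k(2) by simp
  qed
  have "y - x \<in> int_lattice" using int_lattice_minus[OF assms] by simp
  then show ?thesis using *[OF assms] *[of y x] by simp
qed

instantiation torus :: (finite) metric_space
begin

lift_definition dist_torus :: "'a torus \<Rightarrow> 'a torus \<Rightarrow> real"
  is "\<lambda>x y. infdist (x - y) int_lattice"
proof -
  fix x x' y y' :: "real^'a"
  assume "x - x' \<in> int_lattice" "y - y' \<in> int_lattice"
  then have "(x - x') - (y - y') \<in> int_lattice" by (rule int_lattice_diff)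
  then have "(x - y) - (x' - y') \<in> int_lattice" by (simp add: algebra_simps)
  then show "infdist (x - y) int_lattice = infdist (x' - y') int_lattice"
    by (rule infdist_int_lattice_cong)
qed

definition uniformity_torus :: "('a torus \<times> 'a torus) filter" where
  "uniformity_torus = (INF e\<in>{0<..}. principal {(x, y). dist x y < e})"

definition open_torus :: "'a torus set \<Rightarrow> bool" where
  "open_torus U \<longleftrightarrow> (\<forall>x\<in>U. eventually (\<lambda>(x', y). x' = x \<longrightarrow> y \<in> U) uniformity)"

instance
proof
  show "uniformity = (INF e\<in>{0<..}. principal {(x, y). dist x (y::'a torus) < e})"
    by (rule uniformity_torus_def)
  show "open U \<longleftrightarrow> (\<forall>x\<in>U. eventually (\<lambda>(x', y). x' = x \<longrightarrow> y \<in> U) uniformity)" for U :: "'a torus set"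
    by (rule open_torus_def)
  show "dist x y = 0 \<longleftrightarrow> x = y" for x y :: "'a torus"
  proof transfer
    fix x y :: "real^'a"
    have "(int_lattice :: (real^'a) set) \<noteq> {}" using int_lattice_0 by blast
    then show "infdist (x - y) int_lattice = 0 \<longleftrightarrow> x - y \<in> int_lattice"
      using in_closed_iff_infdist_zero[OF closed_int_lattice] by blast
  qed
  show "dist x y \<le> dist x z + dist y z" for x y z :: "'a torus"
  proof transfer
    fix x y z :: "real^'a"
    have ne: "(int_lattice :: (real^'a) set) \<noteq> {}" using int_lattice_0 by blast
    obtain a where a: "a \<in> int_lattice" "infdist (x - z) int_lattice = dist (x - z) a"
      using infdist_attains_inf[OF closed_int_lattice ne] by metis
    obtain b where b: "b \<in> int_lattice" "infdist (y - z) int_lattice = dist (y - z) b"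
      using infdist_attains_inf[OF closed_int_lattice ne] by metis
    have "infdist (x - y) int_lattice \<le> dist (x - y) (a - b)"
      using a(1) b(1) by (intro infdist_le int_lattice_diff)
    also have "\<dots> = norm ((x - z - a) - (y - z - b))"
      by (simp add: dist_norm algebra_simps)
    also have "\<dots> \<le> dist (x - z) a + dist (y - z) b"
      unfolding dist_norm by (rule norm_triangle_ineq4)
    finally show "infdist (x - y) int_lattice \<le> infdist (x - z) int_lattice + infdist (y - z) int_lattice"
      using a b by simp
  qed
qed

end

lemma dist_torus_of_le: "dist (torus_of x) (torus_of y) \<le> dist x y"
  using infdist_le[OF int_lattice_0, of "x - y"] by (simp add: dist_torus.abs_eq dist_norm)

lemma continuous_torus_of: "continuous_on S torus_of"
  unfolding continuous_on_iff using dist_torus_of_le by (meson le_less_trans)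

lemma torus_of_measurable [measurable]: "torus_of \<in> borel_measurable borel"
  by (intro borel_measurable_continuous_onI continuous_torus_of)

lemma open_torus_of_image:
  assumes "open U"
  shows "open (torus_of ` U)"
  unfolding open_dist
proof clarify
  fix x assume "x \<in> U"
  then obtain e where e: "e > 0" "\<And>y. dist y x < e \<Longrightarrow> y \<in> U"
    using assms unfolding open_dist by blast
  have "t \<in> torus_of ` U" if "dist t (torus_of x) < e" for t
  proof -
    obtain y where t: "t = torus_of y" using Quotient_abs_rep[OF Quotient_torus, of t] by metis
    have ne: "(int_lattice :: (real^'a) set) \<noteq> {}" using int_lattice_0 by blast
    obtain k where k: "k \<in> int_lattice" "infdist (y - x) int_lattice = dist (y - x) k"
      using infdist_attains_inf[OF closed_int_lattice ne] by metis
    have "dist (y - k) x < e"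
      using that k(2) by (simp add: t dist_torus.abs_eq dist_norm algebra_simps)
    then have "y - k \<in> U" by (rule e(2))
    moreover have "torus_of (y - k) = t"
      using int_lattice_minus[OF k(1)] by (simp add: t torus.abs_eq_iff)
    ultimately show ?thesis by blast
  qed
  then show "\<exists>e>0. \<forall>y. dist y (torus_of x) < e \<longrightarrow> y \<in> torus_of ` U"
    using e(1) by blast
qed

instance torus :: (finite) second_countable_topology
proof
  obtain B :: "(real^'a) set set" where B: "countable B" "topological_basis B"
    using ex_countable_basis by blast
  have "topological_basis ((`) torus_of ` B)"
  proof (rule topological_basisI)
    show "open W" if "W \<in> (`) torus_of ` B" for W
      using that topological_basis_open[OF B(2)] open_torus_of_image by auto
    fix W :: "'a torus set" and t
    assume W: "open W" "t \<in> W"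
    obtain y where t: "t = torus_of y" using Quotient_abs_rep[OF Quotient_torus, of t] by metis
    have "open (torus_of -` W)"
      using W(1) continuous_torus_of by (rule open_vimage)
    then obtain V where V: "V \<in> B" "y \<in> V" "V \<subseteq> torus_of -` W"
      using topological_basisE[OF B(2), of "torus_of -` W" y] W(2) t by auto
    then have "t \<in> torus_of ` V \<and> torus_of ` V \<subseteq> W"
      by (simp add: t image_subset_iff_subset_vimage)
    then show "\<exists>B'\<in>(`) torus_of ` B. t \<in> B' \<and> B' \<subseteq> W"
      by (rule bexI) (rule imageI[OF V(1)])
  qed
  then have "open = generate_topology ((`) torus_of ` B)"
    by (rule topological_basis_imp_subbasis)
  moreover have "countable ((`) torus_of ` B)" using B(1) by (rule countable_image)
  ultimately show "\<exists>B::'a torus set set. countable B \<and> open = generate_topology B"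
    by (intro exI[of _ "(`) torus_of ` B"]) (rule conjI)
qed

text \<open>Restricting to the closed cube is harmless, as its boundary is a null set.\<close>

definition haar_torus :: "'d::finite torus measure" where
  "haar_torus = distr (uniform_measure lborel (cbox 0 1)) borel torus_of"

lemma prob_space_haar_torus: "prob_space (haar_torus :: 'd::finite torus measure)"
proof -
  have one: "(1 :: real^'d) \<bullet> b = 1" if "b \<in> Basis" for b
    using that by (auto simp: Basis_vec_def inner_axis)
  have "emeasure lborel (cbox 0 (1 :: real^'d)) = 1"
    by (subst emeasure_lborel_cbox) (simp_all add: one)
  then have "prob_space (uniform_measure lborel (cbox 0 (1 :: real^'d)))"
    by (intro prob_space_uniform_measure) auto
  then show ?thesis
    unfolding haar_torus_def by (rule prob_space.prob_space_distr) simp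
qed

section \<open>Fourier coefficients and the mixing Diophantine condition\<close>

lift_definition torus_character :: "int^'d \<Rightarrow> 'd torus \<Rightarrow> complex"
  is "\<lambda>k x. exp (2 * complex_of_real pi * \<i> * complex_of_real (\<Sum>i\<in>UNIV. real_of_int (k $ i) * x $ i))"
proof -
  fix k :: "int^'d" and x y :: "real^'d"
  assume "x - y \<in> int_lattice"
  then have "(\<Sum>i\<in>UNIV. real_of_int (k $ i) * (x - y) $ i) \<in> \<int>"
    by (intro Ints_sum) (simp add: int_lattice_def)
  then obtain n where n: "(\<Sum>i\<in>UNIV. real_of_int (k $ i) * (x - y) $ i) = real_of_int n"
    by (auto elim: Ints_cases)
  have "(\<Sum>i\<in>UNIV. real_of_int (k $ i) * x $ i) = (\<Sum>i\<in>UNIV. real_of_int (k $ i) * y $ i) + real_of_int n"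
    unfolding n[symmetric] by (simp add: sum.distrib[symmetric] algebra_simps)
  then show "exp (2 * complex_of_real pi * \<i> * complex_of_real (\<Sum>i\<in>UNIV. real_of_int (k $ i) * x $ i)) =
      exp (2 * complex_of_real pi * \<i> * complex_of_real (\<Sum>i\<in>UNIV. real_of_int (k $ i) * y $ i))"
    by (subst exp_eq, intro exI[of _ n]) (simp add: algebra_simps)
qed

definition fourier_coeff :: "'d::finite torus measure \<Rightarrow> int^'d \<Rightarrow> complex" where
  "fourier_coeff \<mu> k = (LINT \<theta>|\<mu>. torus_character k \<theta>)"

definition is_norm :: "(real^'d \<Rightarrow> real) \<Rightarrow> bool" where
  "is_norm N \<longleftrightarrow> (\<forall>x. N x = 0 \<longleftrightarrow> x = 0) \<and> (\<forall>c x. N (c *\<^sub>R x) = \<bar>c\<bar> * N x) \<and>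
     (\<forall>x y. N (x + y) \<le> N x + N y)"

definition mixing_diophantine ::
  "(real^'d \<Rightarrow> real) \<Rightarrow> real \<Rightarrow> real \<Rightarrow> 'd::finite torus measure \<Rightarrow> bool" where
  "mixing_diophantine N \<gamma> \<tau> \<mu> \<longleftrightarrow>
     (\<forall>k. k \<noteq> 0 \<longrightarrow> cmod (fourier_coeff \<mu> k) \<le> 1 - \<gamma> / N (\<chi> i. real_of_int (k $ i)) powr \<tau>)"

section \<open>The skew product\<close>

text \<open>
  The library topology on \<^typ>\<open>int \<Rightarrow> 'd torus\<close> is the product topology, so \<^const>\<open>borel\<close> on
  \<^typ>\<open>(int \<Rightarrow> 'd torus) \<times> 'd torus\<close> is the Borel sigma-algebra of the product topology.
\<close>

definition skew_measure :: "'d::finite torus measure \<Rightarrow> ((int \<Rightarrow> 'd torus) \<times> 'd torus) measure" where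
  "skew_measure \<mu> = (\<Pi>\<^sub>M j\<in>UNIV. \<mu>) \<Otimes>\<^sub>M haar_torus"

lemma sets_skew_measure:
  fixes \<mu> :: "'d::finite torus measure"
  assumes "sets \<mu> = sets borel"
  shows "sets (skew_measure \<mu>) = sets borel"
proof -
  have "sets (\<Pi>\<^sub>M j\<in>(UNIV::int set). \<mu>) = sets (\<Pi>\<^sub>M j\<in>(UNIV::int set). (borel :: 'd torus measure))"
    by (rule sets_PiM_cong) (simp_all add: assms)
  also have "\<dots> = sets (borel :: (int \<Rightarrow> 'd torus) measure)"
    by (rule sets_PiM_equal_borel)
  finally have "sets (skew_measure \<mu>) =
      sets (borel \<Otimes>\<^sub>M borel :: ((int \<Rightarrow> 'd torus) \<times> 'd torus) measure)"
    unfolding skew_measure_def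
    by (rule sets_pair_measure_cong) (simp add: haar_torus_def)
  then show ?thesis by (simp only: borel_prod)
qed

definition skew_product ::
  "(int \<Rightarrow> 'd::finite torus) \<times> 'd torus \<Rightarrow> (int \<Rightarrow> 'd torus) \<times> 'd torus" where
  "skew_product = (\<lambda>(\<omega>, \<theta>). ((\<lambda>n. \<omega> (n + 1)), \<theta> + \<omega> 0))"

definition birkhoff_sum :: "('a \<Rightarrow> 'a) \<Rightarrow> nat \<Rightarrow> ('a \<Rightarrow> real) \<Rightarrow> 'a \<Rightarrow> real" where
  "birkhoff_sum T n \<phi> x = (\<Sum>i<n. \<phi> ((T ^^ i) x))"

section \<open>Hoelder observables and coboundaries\<close>

definition seq_dist :: "(int \<Rightarrow> 'a) \<Rightarrow> (int \<Rightarrow> 'a) \<Rightarrow> real" where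
  "seq_dist \<omega> \<omega>' =
     (if \<omega> = \<omega>' then 0 else (1 / 2) ^ (LEAST n. \<exists>j. nat \<bar>j\<bar> = n \<and> \<omega> j \<noteq> \<omega>' j))"

lemma seq_dist_less_iff:
  "seq_dist \<omega> \<omega>' < (1 / 2) ^ n \<longleftrightarrow> (\<forall>j. nat \<bar>j\<bar> \<le> n \<longrightarrow> \<omega> j = \<omega>' j)"
proof (cases "\<omega> = \<omega>'")
  case False
  define P where "P = (\<lambda>n. \<exists>j. nat \<bar>j\<bar> = n \<and> \<omega> j \<noteq> \<omega>' j)"
  have "\<exists>m. P m" using False by (auto simp: P_def)
  then have 1: "P (Least P)" by (rule LeastI_ex)
  have 2: "\<And>m. m < Least P \<Longrightarrow> \<not> P m" by (rule not_less_Least)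
  have "seq_dist \<omega> \<omega>' = (1 / 2) ^ Least P" using False by (simp add: seq_dist_def P_def)
  then have "seq_dist \<omega> \<omega>' < (1 / 2) ^ n \<longleftrightarrow> n < Least P"
    by (simp add: power_strict_decreasing_iff)
  also have "\<dots> \<longleftrightarrow> (\<forall>m\<le>n. \<not> P m)"
    using 1 2 by (meson le_less_trans not_le)
  finally show ?thesis by (auto simp: P_def)
qed (simp add: seq_dist_def)

lemma Metric_space_seq_dist: "Metric_space UNIV seq_dist"
proof
  show "0 \<le> seq_dist x y" for x y :: "int \<Rightarrow> 'a" by (simp add: seq_dist_def)
  show comm: "seq_dist x y = seq_dist y x" for x y :: "int \<Rightarrow> 'a"
    unfolding seq_dist_def by (simp only: eq_commute[of y] eq_commute[of "y j" for j])
  show "(seq_dist x y = 0) = (x = y)" for x y :: "int \<Rightarrow> 'a" by (simp add: seq_dist_def)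
  fix x y z :: "int \<Rightarrow> 'a"
  have "seq_dist x z \<le> max (seq_dist x y) (seq_dist y z)"
  proof (cases "x = z")
    case False
    then obtain n where n: "seq_dist x z = (1 / 2) ^ n" by (auto simp: seq_dist_def)
    have "\<not> seq_dist x z < (1 / 2) ^ n" using n by simp
    then have "\<not> (seq_dist x y < (1 / 2) ^ n \<and> seq_dist y z < (1 / 2) ^ n)"
      unfolding seq_dist_less_iff by metis
    then show ?thesis using n by (auto simp: le_max_iff_disj)
  qed (simp add: seq_dist_def le_max_iff_disj)
  moreover have "0 \<le> seq_dist x y" "0 \<le> seq_dist y z" by (simp_all add: seq_dist_def)
  ultimately show "seq_dist x z \<le> seq_dist x y + seq_dist y z" by linarith
qed

definition holder_base :: "real \<Rightarrow> ((int \<Rightarrow> 'd::finite torus) \<times> 'd torus \<Rightarrow> real) \<Rightarrow> ennreal" where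
  "holder_base \<alpha> \<phi> = (SUP \<theta>. SUP (\<omega>, \<omega>')\<in>{(\<omega>, \<omega>'). \<omega> \<noteq> \<omega>'}.
     ennreal (\<bar>\<phi> (\<omega>, \<theta>) - \<phi> (\<omega>', \<theta>)\<bar> / seq_dist \<omega> \<omega>' powr \<alpha>))"

definition holder_fibre :: "real \<Rightarrow> ((int \<Rightarrow> 'd::finite torus) \<times> 'd torus \<Rightarrow> real) \<Rightarrow> ennreal" where
  "holder_fibre \<alpha> \<phi> = (SUP \<omega>. SUP (\<theta>, \<theta>')\<in>{(\<theta>, \<theta>'). \<theta> \<noteq> \<theta>'}.
     ennreal (\<bar>\<phi> (\<omega>, \<theta>) - \<phi> (\<omega>, \<theta>')\<bar> / dist \<theta> \<theta>' powr \<alpha>))"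

definition holder_space :: "real \<Rightarrow> ((int \<Rightarrow> 'd::finite torus) \<times> 'd torus \<Rightarrow> real) set" where
  "holder_space \<alpha> = {\<phi>. bounded (range \<phi>) \<and> \<phi> \<in> borel_measurable borel \<and>
     holder_base \<alpha> \<phi> + holder_fibre \<alpha> \<phi> < \<infinity>}"

text \<open>
  The metric topology of \<^const>\<open>seq_dist\<close> is strictly finer than the product topology, so
  measurability of the transfer function (for the product topology) is a separate requirement.
\<close>

definition is_coboundary ::
  "'d::finite torus measure \<Rightarrow> ((int \<Rightarrow> 'd torus) \<times> 'd torus \<Rightarrow> real) \<Rightarrow> bool" where
  "is_coboundary \<mu> \<phi> \<longleftrightarrow> (\<exists>\<eta>. \<eta> \<in> borel_measurable borel \<and>
     continuous_map (Metric_space.mtopology UNIV (prod_dist seq_dist dist)) euclideanreal \<eta> \<and>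
     (AE x in skew_measure \<mu>. \<phi> x = \<eta> x - \<eta> (skew_product x)))"

end

theory Submission
  imports Defs "HOL-Real_Asymp.Real_Asymp"
begin

text \<open>
  Write \<open>f\<close> for the skew product, \<open>g\<close> for its inverse and \<open>E\<close> for the conditional expectation
  given \<open>\<theta>\<close> and the coordinates \<open>\<omega> j\<close> with \<open>j < 0\<close>. The proof is Gordin's martingale method, carried out
  in the supremum norm.

  Under \<open>f\<close> the fibre coordinate performs a random walk with step distribution \<open>\<mu>\<close>. On characters of
  frequency at most \<open>R\<close>, other than the constant, one step of the walk is a contraction by
  \<open>1 - c / R powr \<tau>\<close>, by the Diophantine condition. A function on the torus that is \<open>\<alpha>\<close>-Hoelder is within
  \<open>O(R powr (- \<alpha> / 2))\<close> of a trigonometric polynomial of degree \<open>O(R)\<close>, obtained by averaging against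
  a power of \<open>cos\<^sup>2\<close>. With \<open>R = n powr q\<close>, the polynomial part has decayed after \<open>n\<close> steps if
  \<open>q * \<tau> < 1\<close>, and the approximation error is summable in \<open>n\<close> if \<open>q * \<alpha> > 2\<close>; both can be achieved
  precisely because \<open>\<alpha> > 2 * \<tau>\<close>. Hence \<open>E (\<phi> \<circ> f ^^ n)\<close> is summable in the supremum norm
  (\<open>conv_pow_equidistribution\<close>, \<open>past_exp_decay\<close>, \<open>holder_mixing_rate\<close>). In the other direction of time,
  \<open>\<phi> \<circ> g ^^ n\<close> depends only up to an exponentially small error on the coordinates with negative index, so
  \<open>\<phi> \<circ> g ^^ n - E (\<phi> \<circ> g ^^ n)\<close> is summable as well (\<open>holder_past_approx\<close>).

  These two series add up to a bounded function \<open>h\<close> such that \<open>m = \<phi> - h + h \<circ> f\<close> depends only on \<open>\<theta>\<close>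
  and the \<open>\<omega> j\<close> with \<open>j \<le> 0\<close> and satisfies \<open>E m = 0\<close>; in other words, \<open>m \<circ> f ^^ n\<close> is a stationary sequence
  of martingale differences (\<open>martingale_coboundary_decomposition\<close>). As the series converge uniformly, \<open>h\<close>
  and \<open>m\<close> inherit uniform continuity. If \<open>\<sigma>\<^sup>2 = \<integral> m\<^sup>2\<close> vanishes, then \<open>\<phi> = h - h \<circ> f\<close> almost everywhere with
  \<open>h\<close> continuous, that is, \<open>\<phi>\<close> is a coboundary.

  Otherwise the Birkhoff sums of \<open>\<phi>\<close> differ from those of \<open>m\<close> by a bounded amount, and it remains to prove
  the central limit theorem for \<open>m\<close> (\<open>central_limit\<close>). Since \<open>m\<^sup>2\<close> is uniformly continuous,
  \<open>E (m\<^sup>2 \<circ> f ^^ n)\<close> tends to \<open>\<sigma>\<^sup>2\<close> uniformly (\<open>ucb_mixing\<close>). So a block of \<open>k\<close> consecutive terms has, given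
  the past, mean zero and variance close to \<open>k * \<sigma>\<^sup>2\<close>, whatever the past is, and adding such a block to the sum
  multiplies its characteristic function at \<open>s\<close> by \<open>exp (- s\<^sup>2 * k * \<sigma>\<^sup>2 / 2)\<close> up to a small error
  (\<open>char_N_step\<close>). Multiplying over the blocks and applying Levy's continuity theorem gives the claim.
\<close>

section \<open>Translation invariance and characters on the torus\<close>

lemma torus_of_add: "torus_of x + torus_of y = torus_of (x + y)"
  by (rule plus_torus.abs_eq)

lemma torus_of_surj: obtains x where "t = torus_of x"
  using Quotient_abs_rep[OF Quotient_torus, of t] by metis

lemma dist_torus_add_right: "dist (x + z) (y + z) = dist x (y :: 'd::finite torus)"
  by transfer (simp add: algebra_simps)

lemma dist_torus_add_left: "dist (z + x) (z + y) = dist x (y :: 'd::finite torus)"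
  using dist_torus_add_right[of x z y] by (simp add: add.commute)

text \<open>
  Because the distance is translation invariant, addition is Lipschitz. The instance gives
  access to the measurability rules for sums.
\<close>

instance torus :: (finite) topological_ab_group_add
proof
  fix a b :: "'a torus"
  have "((\<lambda>x. dist (fst x) a + dist (snd x) b) \<longlongrightarrow> dist a a + dist b b) (nhds a \<times>\<^sub>F nhds b)"
    unfolding nhds_prod[symmetric] by (intro tendsto_intros filterlim_ident[THEN tendsto_fst[of _ "(a,b)" "nhds (a,b)", simplified]] filterlim_ident[THEN tendsto_snd[of _ "(a,b)" "nhds (a,b)", simplified]])
  then have lim: "((\<lambda>x. dist (fst x) a + dist (snd x) b) \<longlongrightarrow> 0) (nhds a \<times>\<^sub>F nhds b)" by simp
  have le: "dist (fst x + snd x) (a + b) \<le> dist (fst x) a + dist (snd x) b" for x :: "'a torus \<times> 'a torus"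
    using dist_triangle[of "fst x + snd x" "a + b" "a + snd x"]
    by (simp add: dist_torus_add_right dist_torus_add_left)
  show "LIM x (nhds a \<times>\<^sub>F nhds b). fst x + snd x :> nhds (a + b)"
    by (rule metric_tendsto_imp_tendsto[OF lim]) (use le in \<open>auto intro!: always_eventually\<close>)
  have neg: "dist (- x) (- y) = dist x y" for x y :: "'a torus"
    using dist_torus_add_right[of "-x" "x + y" "-y"] by (simp add: dist_commute)
  have "((\<lambda>x. dist x a) \<longlongrightarrow> dist a a) (nhds a)" by (intro tendsto_intros filterlim_ident)
  then show "(uminus \<longlongrightarrow> - a) (nhds a)"
    by (rule metric_tendsto_imp_tendsto) (auto simp: neg)
qed

lemma borel_measurable_torus_minus [measurable (raw)]:
  fixes f g :: "'a \<Rightarrow> 'd::finite torus"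
  assumes "f \<in> borel_measurable M" "g \<in> borel_measurable M"
  shows "(\<lambda>x. f x - g x) \<in> borel_measurable M"
  by (rule borel_measurable_continuous_Pair[OF assms]) (intro continuous_intros)

lemma sets_haar_torus [simp, measurable_cong]: "sets (haar_torus :: 'd::finite torus measure) = sets borel"
  by (simp add: haar_torus_def)

lemma space_haar_torus [simp]: "space (haar_torus :: 'd::finite torus measure) = UNIV"
  by (simp add: haar_torus_def)

text \<open>
  Half-open, so that the translates by the integer lattice partition the space.
\<close>

definition unit_cell :: "(real^'d) set" where
  "unit_cell = {x. \<forall>i. 0 \<le> x $ i \<and> x $ i < 1}"

lemma unit_cell_borel [measurable]: "(unit_cell :: (real^'d::finite) set) \<in> sets borel"
  unfolding unit_cell_def by measurable

lemma cbox01: "cbox 0 (1 :: real^'d::finite) = {x. \<forall>i. 0 \<le> x $ i \<and> x $ i \<le> 1}"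
  by (auto simp: mem_box_cart)

definition int_vec :: "('d \<Rightarrow> int) \<Rightarrow> real^'d" where
  "int_vec k = (\<chi> i. real_of_int (k i))"

text \<open>
  The closed cube in the definition of Haar measure and the fundamental domain \<^const>\<open>unit_cell\<close> differ
  only by faces, which are Lebesgue null sets.
\<close>

lemma emeasure_haar_unit_cell:
  assumes [measurable]: "B \<in> sets borel"
  shows "emeasure (haar_torus :: 'd::finite torus measure) B = emeasure lborel (unit_cell \<inter> torus_of -` B)"
proof -
  have one: "(1 :: real^'d) \<bullet> b = 1" if "b \<in> Basis" for b
    using that by (auto simp: Basis_vec_def inner_axis)
  have e1: "emeasure lborel (cbox 0 (1 :: real^'d)) = 1"
    by (subst emeasure_lborel_cbox) (simp_all add: one)
  have "emeasure (haar_torus :: 'd torus measure) B = emeasure lborel (cbox 0 (1 :: real^'d) \<inter> torus_of -` B)"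
    unfolding haar_torus_def
    by (simp add: emeasure_distr emeasure_uniform_measure e1 divide_ennreal_def measurable_sets_borel[OF torus_of_measurable])
  also have "\<dots> = emeasure lborel (unit_cell \<inter> torus_of -` B)"
  proof (rule emeasure_eq_AE)
    have null: "AE x in lborel. (x::real^'d) $ i \<noteq> 1" for i
    proof -
      have "emeasure lborel {x :: real^'d. x $ i = 1} = 0"
      proof -
        have "negligible {x::real^'d. x \<bullet> axis i 1 = 1}"
          by (rule negligible_standard_hyperplane) (simp add: axis_in_Basis_iff)
        then have "negligible {x::real^'d. x $ i = 1}" by (simp add: inner_axis)
        then have "{x::real^'d. x $ i = 1} \<in> null_sets lebesgue" by (simp add: negligible_iff_null_sets)
        then have "emeasure lebesgue {x::real^'d. x $ i = 1} = 0" by auto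
        moreover have "{x::real^'d. x $ i = 1} \<in> sets lborel" by measurable
        ultimately show ?thesis by simp
      qed
      then show ?thesis by (intro AE_I[where N="{x. x $ i = 1}"]) auto
    qed
    have "AE x in lborel. \<forall>i\<in>UNIV. (x::real^'d) $ i \<noteq> 1"
      by (subst AE_finite_all) (auto intro: null)
    then show "AE x in lborel. (x \<in> cbox 0 1 \<inter> torus_of -` B) = (x \<in> unit_cell \<inter> torus_of -` (B :: 'd torus set))"
      by eventually_elim (auto simp: cbox01 unit_cell_def less_le)
    show "cbox 0 1 \<inter> torus_of -` B \<in> sets lborel" "unit_cell \<inter> torus_of -` B \<in> sets lborel"
      using measurable_sets_borel[OF torus_of_measurable assms]
      by (auto simp: unit_cell_borel)
  qed
  finally show ?thesis .
qed

lemma torus_of_int_vec: "torus_of (x + int_vec k) = torus_of x"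
  by (simp add: torus.abs_eq_iff int_lattice_def int_vec_def)

lemma ex1_int_vec_unit_cell: "\<exists>!k. x - int_vec k \<in> unit_cell"
proof
  show "x - int_vec (\<lambda>i. \<lfloor>x $ i\<rfloor>) \<in> unit_cell"
    by (simp add: unit_cell_def int_vec_def) linarith
  show "k = (\<lambda>i. \<lfloor>x $ i\<rfloor>)" if "x - int_vec k \<in> unit_cell" for k
  proof
    fix i
    have "of_int (k i) \<le> x $ i" "x $ i < of_int (k i) + 1"
      using that by (simp_all add: unit_cell_def int_vec_def) (metis add.commute diff_less_eq)
    then show "k i = \<lfloor>x $ i\<rfloor>" by (simp add: floor_unique)
  qed
qed

lemma emeasure_lborel_translate:
  fixes t :: "'a::euclidean_space"
  assumes [measurable]: "A \<in> sets borel"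
  shows "emeasure lborel ((\<lambda>x. x + t) -` A) = emeasure lborel A"
proof -
  have "emeasure lborel A = emeasure (distr lborel borel ((+) t)) A"
    by (simp add: lborel_distr_plus)
  also have "\<dots> = emeasure lborel ((+) t -` A)"
    by (subst emeasure_distr) auto
  also have "(+) t = (\<lambda>x. x + t)" by (simp add: fun_eq_iff add.commute)
  finally show ?thesis by simp
qed

text \<open>
  Two fundamental domains of the lattice see the same portion of a periodic set: cutting each of them along the
  lattice translates of the other produces the same pieces up to lattice translations, and Lebesgue measure does
  not change under these.
\<close>

lemma emeasure_periodic_unit_cell_translate:
  fixes P :: "(real^'d::finite) set"
  assumes P[measurable]: "P \<in> sets borel" and per: "\<And>x k. x + int_vec k \<in> P \<longleftrightarrow> x \<in> P"
  shows "emeasure lborel ((\<lambda>x. x + t) -` unit_cell \<inter> P) = emeasure lborel (unit_cell \<inter> P)"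
proof -
  let ?U = "(\<lambda>x. x + t) -` (unit_cell :: (real^'d) set)"
  let ?tr = "\<lambda>k S. (\<lambda>x. x + int_vec k) -` (S :: (real^'d) set)"
  have tr_meas: "(\<lambda>x. x + s) -` S \<in> sets borel" if "S \<in> sets borel" for S and s :: "real^'d"
    using that by (rule measurable_sets_borel[rotated]) simp
  have U[measurable]: "?U \<in> sets borel" by (rule tr_meas) simp
  have split1: "emeasure lborel (V \<inter> P) = (\<integral>\<^sup>+k. emeasure lborel (?tr k W \<inter> V \<inter> P) \<partial>count_space UNIV)"
    if V: "V \<in> sets borel" and W: "W \<in> sets borel" and W1: "\<And>x. \<exists>!k. x + int_vec k \<in> W" for V W :: "(real^'d) set"
  proof -
    have "V \<inter> P = (\<Union>k. ?tr k W \<inter> V \<inter> P)"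
      using ex1_implies_ex[OF W1] by auto
    also have "emeasure lborel \<dots> = (\<integral>\<^sup>+k. emeasure lborel (?tr k W \<inter> V \<inter> P) \<partial>count_space UNIV)"
    proof (rule emeasure_UN_countable)
      show "disjoint_family (\<lambda>k. ?tr k W \<inter> V \<inter> P)"
        unfolding disjoint_family_on_def
      proof (intro ballI impI equals0I)
        fix k l x assume "k \<noteq> l" "x \<in> (?tr k W \<inter> V \<inter> P) \<inter> (?tr l W \<inter> V \<inter> P)"
        then show False using W1[of x] by (simp add: Ex1_def) metis
      qed
    qed (use V W P in \<open>auto intro!: sets.Int tr_meas\<close>)
    finally show ?thesis .
  qed
  have neg: "int_vec (\<lambda>i. - k i) = - int_vec k" for k :: "'d \<Rightarrow> int"
    by (simp add: int_vec_def vec_eq_iff)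
  have bij: "bij (\<lambda>k i. - k i :: int)"
    by (rule o_bij[of "\<lambda>k i. - k i"]) (auto simp: fun_eq_iff)
  have one_pos: "\<exists>!k. x + int_vec k \<in> (unit_cell :: (real^'d) set)" for x
  proof -
    obtain k where k: "x - int_vec k \<in> unit_cell" "\<And>k'. x - int_vec k' \<in> unit_cell \<Longrightarrow> k' = k"
      using ex1_int_vec_unit_cell[of x] by (auto simp: Ex1_def)
    show ?thesis
    proof
      show "x + int_vec (\<lambda>i. - k i) \<in> unit_cell" using k(1) by (simp add: neg)
      show "k' = (\<lambda>i. - k i)" if "x + int_vec k' \<in> unit_cell" for k'
        using k(2)[of "\<lambda>i. - k' i"] that by (auto simp: neg)
    qed
  qed
  have oneU: "\<exists>!k. x + int_vec k \<in> ?U" for x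
    using one_pos[of "x + t"] by (simp add: algebra_simps)
  have "emeasure lborel (?U \<inter> P) = (\<integral>\<^sup>+k. emeasure lborel (?tr k unit_cell \<inter> ?U \<inter> P) \<partial>count_space UNIV)"
    by (rule split1) (auto simp: one_pos)
  also have "\<dots> = (\<integral>\<^sup>+k. emeasure lborel (?tr (\<lambda>i. - k i) (?tr k unit_cell \<inter> ?U \<inter> P)) \<partial>count_space UNIV)"
    by (subst emeasure_lborel_translate) (auto intro!: sets.Int tr_meas)
  also have "\<dots> = (\<integral>\<^sup>+k. emeasure lborel (?tr (\<lambda>i. - k i) ?U \<inter> unit_cell \<inter> P) \<partial>count_space UNIV)"
  proof (intro nn_integral_cong arg_cong[where f="emeasure lborel"] set_eqI)
    fix k x
    have "x - int_vec k \<in> P \<longleftrightarrow> x \<in> P" using per[of x "\<lambda>i. - k i"] by (simp add: neg)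
    then show "x \<in> ?tr (\<lambda>i. - k i) (?tr k unit_cell \<inter> ?U \<inter> P) \<longleftrightarrow> x \<in> ?tr (\<lambda>i. - k i) ?U \<inter> unit_cell \<inter> P"
      by (auto simp: neg)
  qed
  also have "\<dots> = (\<integral>\<^sup>+k. emeasure lborel (?tr k ?U \<inter> unit_cell \<inter> P) \<partial>count_space UNIV)"
    using nn_integral_bij_count_space[OF bij, of "\<lambda>k. emeasure lborel (?tr k ?U \<inter> unit_cell \<inter> P)"] by simp
  also have "\<dots> = emeasure lborel (unit_cell \<inter> P)"
    by (rule split1[symmetric, OF unit_cell_borel U oneU])
  finally show ?thesis .
qed

lemma distr_haar_torus_translate:
  "distr haar_torus borel (\<lambda>x. x + t) = (haar_torus :: 'd::finite torus measure)"
proof (rule measure_eqI)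
  fix B assume "B \<in> sets (distr (haar_torus :: 'd torus measure) borel (\<lambda>x. x + t))"
  then have B[measurable]: "B \<in> sets borel" by simp
  obtain s where t: "t = torus_of s" using torus_of_surj by blast
  define Q where "Q = (torus_of :: real^'d \<Rightarrow> _) -` B"
  have Q[measurable]: "Q \<in> sets borel" unfolding Q_def by (rule measurable_sets_borel[OF torus_of_measurable B])
  have per: "x + int_vec k \<in> Q \<longleftrightarrow> x \<in> Q" for x k by (simp add: Q_def torus_of_int_vec)
  have B': "(\<lambda>x. x + t) -` B \<in> sets borel" by (rule measurable_sets_borel[OF _ B]) simp
  have "emeasure (distr (haar_torus :: 'd torus measure) borel (\<lambda>x. x + t)) B = emeasure haar_torus ((\<lambda>x. x + t) -` B)"
    by (simp add: emeasure_distr)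
  also have "\<dots> = emeasure lborel (unit_cell \<inter> (\<lambda>x. x + s) -` Q)"
    by (subst emeasure_haar_unit_cell[OF B'])
       (auto simp: Q_def t torus_of_add intro!: arg_cong[where f="emeasure lborel"])
  also have "\<dots> = emeasure lborel ((\<lambda>x. x + s) -` ((\<lambda>x. x + - s) -` unit_cell \<inter> Q))"
    by (intro arg_cong[where f="emeasure lborel"]) auto
  also have "\<dots> = emeasure lborel ((\<lambda>x. x + - s) -` unit_cell \<inter> Q)"
    by (rule emeasure_lborel_translate) (auto intro!: sets.Int measurable_sets_borel[OF _ unit_cell_borel])
  also have "\<dots> = emeasure lborel (unit_cell \<inter> Q)"
    by (rule emeasure_periodic_unit_cell_translate[OF Q per])
  also have "\<dots> = emeasure haar_torus B"
    by (simp add: emeasure_haar_unit_cell Q_def)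
  finally show "emeasure (distr haar_torus borel (\<lambda>x. x + t)) B = emeasure haar_torus B" .
qed simp

lemma integral_haar_torus_translate:
  fixes F :: "'d::finite torus \<Rightarrow> 'b::{banach, second_countable_topology}"
  assumes [measurable]: "F \<in> borel_measurable borel"
  shows "(LINT x|haar_torus. F (x + t)) = (LINT x|haar_torus. F x)"
  by (subst (2) distr_haar_torus_translate[of t, symmetric], subst integral_distr) auto

lemma torus_character_of:
  "torus_character k (torus_of x) = cis (2 * pi * (\<Sum>i\<in>UNIV. real_of_int (k $ i) * x $ i))"
  by (simp add: torus_character.abs_eq cis_conv_exp algebra_simps)

lemma norm_torus_character [simp]: "cmod (torus_character k x) = 1"
  by (rule torus_of_surj[of x]) (simp add: torus_character_of)

lemma torus_character_0 [simp]: "torus_character 0 x = 1"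
  by (rule torus_of_surj[of x]) (simp add: torus_character_of)

lemma torus_character_add: "torus_character k (x + y) = torus_character k x * torus_character k y"
  by (rule torus_of_surj[of x], rule torus_of_surj[of y])
     (simp add: torus_of_add torus_character_of cis_mult algebra_simps sum.distrib)

lemma torus_character_mult: "torus_character k x * torus_character l x = torus_character (k + l) x"
  by (rule torus_of_surj[of x])
     (simp add: torus_character_of cis_mult algebra_simps sum.distrib)

lemma torus_character_minus: "torus_character (- k) x = cnj (torus_character k x)"
  by (rule torus_of_surj[of x])
     (simp add: torus_character_of cis_cnj sum_negf)

lemma continuous_torus_character: "continuous_on UNIV (torus_character k)"
proof (rule continuous_on_open_vimage[THEN iffD2, rule_format])
  fix U :: "complex set" assume "open U"
  have "(torus_character k \<circ> torus_of) = (\<lambda>x. cis (2 * pi * (\<Sum>i\<in>UNIV. real_of_int (k $ i) * x $ i)))"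
    by (auto simp: torus_character_of)
  moreover have "continuous_on UNIV (\<lambda>x. cis (2 * pi * (\<Sum>i\<in>UNIV. real_of_int (k $ i) * x $ i)))"
    by (intro continuous_intros)
  ultimately have "open ((torus_character k \<circ> torus_of) -` U)"
    using \<open>open U\<close> by (simp add: open_vimage)
  then have "open (torus_of ` ((torus_character k \<circ> torus_of) -` U))" by (rule open_torus_of_image)
  also have "torus_of ` ((torus_character k \<circ> torus_of) -` U) = torus_character k -` U"
  proof (intro set_eqI iffI)
    fix t assume t: "t \<in> torus_character k -` U"
    obtain x where "t = torus_of x" by (rule torus_of_surj)
    then show "t \<in> torus_of ` ((torus_character k \<circ> torus_of) -` U)" using t by auto
  qed auto
  finally show "open (torus_character k -` U \<inter> UNIV)" by simp
qed simp

lemma measurable_torus_character [measurable]: "torus_character k \<in> borel_measurable borel"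
  by (rule borel_measurable_continuous_onI[OF continuous_torus_character])

text \<open>
  A translation by a point where the character has the value \<open>-1\<close> changes the sign of the integral.
\<close>

lemma integral_haar_torus_character:
  assumes "k \<noteq> 0"
  shows "(LINT x|haar_torus. torus_character k x) = 0"
proof -
  obtain i where i: "k $ i \<noteq> 0" using assms by (auto simp: vec_eq_iff)
  define t where "t = torus_of (axis i (1 / (2 * real_of_int (k $ i))))"
  have "(\<Sum>j\<in>UNIV. real_of_int (k $ j) * axis i (1 / (2 * real_of_int (k $ i))) $ j) = 1/2"
    using i by (simp add: axis_def if_distrib[of "\<lambda>z. _ * z"] sum.delta' cong: if_cong)
  then have t: "torus_character k t = -1"
    by (simp only: t_def torus_character_of) simp
  have "(LINT x|haar_torus. torus_character k x) = (LINT x|haar_torus. torus_character k (x + t))"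
    by (rule integral_haar_torus_translate[symmetric]) simp
  also have "\<dots> = - (LINT x|haar_torus. torus_character k x)"
    by (simp add: torus_character_add t)
  finally show ?thesis by simp
qed

section \<open>Random translations of the torus\<close>

text \<open>
  One step of the random walk on the torus with step distribution \<open>\<mu>\<close>, acting on functions (the convolution
  with the image of \<open>\<mu>\<close> under negation).
\<close>

definition conv :: "'d::finite torus measure \<Rightarrow> ('d torus \<Rightarrow> 'b) \<Rightarrow> 'd torus \<Rightarrow> 'b::{banach, second_countable_topology}" where
  "conv \<mu> G x = (LINT s|\<mu>. G (x + s))"

definition bounded_borel :: "('a::topological_space \<Rightarrow> 'b::real_normed_vector) \<Rightarrow> bool" where
  "bounded_borel G \<longleftrightarrow> G \<in> borel_measurable borel \<and> bounded (range G)"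

lemma bounded_borelI:
  assumes "G \<in> borel_measurable borel" "\<And>x. norm (G x) \<le> B"
  shows "bounded_borel G"
  using assms by (auto simp: bounded_borel_def intro!: boundedI)

lemma bounded_borelE:
  assumes "bounded_borel G"
  obtains B where "B \<ge> 0" "\<And>x. norm (G x) \<le> B"
proof -
  obtain B where "\<And>x. norm (G x) \<le> B" using assms by (auto simp: bounded_borel_def bounded_iff)
  moreover from this have "B \<ge> 0" using norm_ge_zero order_trans by blast
  ultimately show ?thesis using that by blast
qed

lemma bounded_borel_measurable: "bounded_borel G \<Longrightarrow> G \<in> borel_measurable borel"
  by (simp add: bounded_borel_def)

lemma bounded_borel_add:
  fixes F G :: "'a::topological_space \<Rightarrow> 'b::{real_normed_vector, second_countable_topology}"
  assumes "bounded_borel F" "bounded_borel G"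
  shows "bounded_borel (\<lambda>x. F x + G x)"
  using assms by (auto simp: bounded_borel_def intro: bounded_plus_comp)

lemma bounded_borel_minus:
  fixes F G :: "'a::topological_space \<Rightarrow> 'b::{real_normed_vector, second_countable_topology}"
  assumes "bounded_borel F" "bounded_borel G"
  shows "bounded_borel (\<lambda>x. F x - G x)"
  using assms by (auto simp: bounded_borel_def intro: bounded_minus_comp)

lemma (in prob_space) integral_norm_bound_const:
  fixes F :: "'a \<Rightarrow> 'b::{banach, second_countable_topology}"
  assumes [measurable]: "F \<in> borel_measurable M" and le: "\<And>x. x \<in> space M \<Longrightarrow> norm (F x) \<le> B"
  shows "integrable M F" "norm (LINT x|M. F x) \<le> B"
proof -
  show int: "integrable M F" by (rule integrable_const_bound[of _ B]) (auto simp: le)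
  have "norm (LINT x|M. F x) \<le> (LINT x|M. norm (F x))" by (rule integral_norm_bound)
  also have "\<dots> \<le> (LINT x|M. B)" by (rule integral_mono) (auto simp: le int)
  finally show "norm (LINT x|M. F x) \<le> B" by (simp add: prob_space)
qed

locale torus_prob =
  fixes \<mu> :: "'d::finite torus measure"
  assumes prob: "prob_space \<mu>" and sets_mu [measurable_cong]: "sets \<mu> = sets borel"
begin

sublocale prob_space \<mu> by (rule prob)

lemma bounded_borel_conv:
  fixes G :: "'d torus \<Rightarrow> 'b::{banach, second_countable_topology}"
  assumes G: "bounded_borel G"
  shows "bounded_borel (conv \<mu> G)"
proof -
  note [measurable] = bounded_borel_measurable[OF G]
  obtain B where B: "\<And>x. norm (G x) \<le> B" using bounded_borelE[OF G] by blast
  show ?thesis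
  proof (rule bounded_borelI)
    show "conv \<mu> G \<in> borel_measurable borel" unfolding conv_def by measurable
    show "norm (conv \<mu> G x) \<le> B" for x
      unfolding conv_def by (rule integral_norm_bound_const) (auto simp: B)
  qed
qed

lemma integrable_translate:
  fixes G :: "'d torus \<Rightarrow> 'b::{banach, second_countable_topology}"
  assumes G: "bounded_borel G"
  shows "integrable \<mu> (\<lambda>s. G (x + s))"
proof -
  note [measurable] = bounded_borel_measurable[OF G]
  obtain B where B: "\<And>x. norm (G x) \<le> B" using bounded_borelE[OF G] by blast
  show ?thesis by (rule integral_norm_bound_const(1)[where B=B]) (auto simp: B)
qed

lemma bounded_borel_conv_pow:
  fixes G :: "'d torus \<Rightarrow> 'b::{banach, second_countable_topology}"
  shows "bounded_borel G \<Longrightarrow> bounded_borel ((conv \<mu> ^^ l) G)"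
  by (induction l) (auto intro: bounded_borel_conv)

lemma conv_add:
  fixes F G :: "'d torus \<Rightarrow> 'b::{banach, second_countable_topology}"
  assumes "bounded_borel F" "bounded_borel G"
  shows "conv \<mu> (\<lambda>x. F x + G x) = (\<lambda>x. conv \<mu> F x + conv \<mu> G x)"
  using assms by (simp add: conv_def fun_eq_iff integrable_translate)

lemma conv_pow_add:
  fixes F G :: "'d torus \<Rightarrow> 'b::{banach, second_countable_topology}"
  assumes "bounded_borel F" "bounded_borel G"
  shows "(conv \<mu> ^^ l) (\<lambda>x. F x + G x) = (\<lambda>x. (conv \<mu> ^^ l) F x + (conv \<mu> ^^ l) G x)"
proof (induction l)
  case (Suc l)
  then show ?case
    using bounded_borel_conv_pow[OF assms(1), of l] bounded_borel_conv_pow[OF assms(2), of l]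
    by (simp add: conv_add)
qed simp

lemma conv_pow_diff_le:
  fixes F G :: "'d torus \<Rightarrow> 'b::{banach, second_countable_topology}"
  assumes F: "bounded_borel F" and G: "bounded_borel G" and le: "\<And>x. norm (F x - G x) \<le> e"
  shows "norm ((conv \<mu> ^^ l) F x - (conv \<mu> ^^ l) G x) \<le> e"
proof (induction l arbitrary: x)
  case (Suc l)
  note [measurable] = bounded_borel_measurable[OF bounded_borel_conv_pow[OF F]]
    bounded_borel_measurable[OF bounded_borel_conv_pow[OF G]]
  have "(conv \<mu> ^^ Suc l) F x - (conv \<mu> ^^ Suc l) G x
      = (LINT s|\<mu>. (conv \<mu> ^^ l) F (x + s) - (conv \<mu> ^^ l) G (x + s))"
    using F G by (simp add: conv_def integrable_translate bounded_borel_conv_pow)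
  also have "norm \<dots> \<le> e"
    by (rule integral_norm_bound_const) (auto simp: Suc)
  finally show ?case .
qed (use le in simp)

lemma conv_pow_of_real:
  "(conv \<mu> ^^ l) (\<lambda>x. complex_of_real (G x)) = (\<lambda>x. complex_of_real ((conv \<mu> ^^ l) G x))"
  by (induction l) (auto simp: conv_def fun_eq_iff)

lemma conv_pow_character:
  "(conv \<mu> ^^ l) (\<lambda>x. c * torus_character k x) = (\<lambda>x. c * fourier_coeff \<mu> k ^ l * torus_character k x)"
  by (induction l) (auto simp: conv_def fun_eq_iff torus_character_add fourier_coeff_def)

end

text \<open>
  A trigonometric polynomial with frequencies bounded by \<open>R\<close> whose coefficients have absolute sum at most \<open>A\<close>:
  \<open>R\<close> determines the spectral gap, and \<open>A\<close> the constant in front of the decay. With an inductive predicate, sums over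
  frequency sets never have to be multiplied out.
\<close>

inductive trig_poly :: "nat \<Rightarrow> real \<Rightarrow> ('d::finite torus \<Rightarrow> complex) \<Rightarrow> bool" where
  monomial: "\<lbrakk>\<And>i. \<bar>k $ i\<bar> \<le> int R; cmod c \<le> A\<rbrakk> \<Longrightarrow> trig_poly R A (\<lambda>x. c * torus_character k x)"
| add: "\<lbrakk>trig_poly R A p; trig_poly R B q\<rbrakk> \<Longrightarrow> trig_poly R (A + B) (\<lambda>x. p x + q x)"

lemma trig_poly_const: "trig_poly R (cmod c) (\<lambda>x. c)"
  using trig_poly.monomial[of 0 R c "cmod c"] by simp

lemma trig_poly_mult:
  assumes "trig_poly R A p" "trig_poly S B q"
  shows "trig_poly (R + S) (A * B) (\<lambda>x. p x * q x)"
  using assms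
proof (induction R A p rule: trig_poly.induct)
  case (monomial k R c A)
  have "A \<ge> 0" using monomial.hyps norm_ge_zero order_trans by blast
  show ?case using monomial.prems monomial.hyps
  proof (induction S B q rule: trig_poly.induct)
    case (monomial l S c' B)
    have "trig_poly (R + S) (A * B) (\<lambda>x. (c * c') * torus_character (k + l) x)"
    proof (rule trig_poly.monomial)
      show "\<bar>(k + l) $ i\<bar> \<le> int (R + S)" for i
        using monomial(1)[of i] monomial(3)[of i] by simp
      show "cmod (c * c') \<le> A * B"
        using monomial(2,4) \<open>A \<ge> 0\<close> by (simp add: norm_mult mult_mono)
    qed
    then show ?case by (simp add: torus_character_mult[symmetric] algebra_simps)
  next
    case (add S A' p B' q)
    from trig_poly.add[OF add.IH[OF add.prems] ] show ?case
      by (simp add: algebra_simps)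
  qed
next
  case (add R A1 p B1 q)
  from trig_poly.add[OF add.IH(1)[OF add.prems] add.IH(2)[OF add.prems]] show ?case
    by (simp add: algebra_simps)
qed

lemma trig_poly_power:
  assumes "trig_poly R 1 p"
  shows "trig_poly (n * R) 1 (\<lambda>x. p x ^ n)"
proof (induction n)
  case 0
  show ?case using trig_poly_const[of 0 1] by simp
next
  case (Suc n)
  from trig_poly_mult[OF assms Suc] show ?case by simp
qed

lemma trig_poly_prod:
  assumes "finite I" "\<And>i. i \<in> I \<Longrightarrow> trig_poly R 1 (p i)"
  shows "trig_poly (card I * R) 1 (\<lambda>x. \<Prod>i\<in>I. p i x)"
  using assms
proof (induction I rule: finite_induct)
  case empty
  show ?case using trig_poly_const[of 0 1] by simp
next
  case (insert i I)
  have "trig_poly (R + card I * R) (1 * 1) (\<lambda>x. p i x * (\<Prod>i\<in>I. p i x))"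
    using insert by (intro trig_poly_mult) auto
  then show ?case using insert by simp
qed

text \<open>
  For a kernel \<open>p\<close> concentrated near \<open>0\<close>, this is, up to the total mass of \<open>p\<close>, the average of \<open>G\<close> over
  a neighbourhood of \<open>x\<close>.
\<close>

definition corr :: "('d::finite torus \<Rightarrow> real) \<Rightarrow> ('d torus \<Rightarrow> complex) \<Rightarrow> 'd torus \<Rightarrow> complex" where
  "corr G p x = (LINT y|haar_torus. complex_of_real (G y) * p (y - x))"

lemma continuous_trig_poly:
  "trig_poly R A p \<Longrightarrow> continuous_on UNIV p"
  by (induction rule: trig_poly.induct) (auto intro!: continuous_intros continuous_torus_character)

lemma norm_trig_poly: "trig_poly R A p \<Longrightarrow> cmod (p x) \<le> A"
proof (induction rule: trig_poly.induct)
  case (add R A p B q)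
  then show ?case by (smt (verit) norm_triangle_ineq)
qed (simp add: norm_mult)

context torus_prob begin

text \<open>
  Every frequency \<open>k\<close> of \<open>p\<close> contributes a multiple of the character of \<open>- k\<close> to \<^term>\<open>corr G p\<close>. Since characters
  are eigenfunctions of \<^term>\<open>conv \<mu>\<close> with the Fourier coefficients as eigenvalues, \<open>l\<close> steps contract this
  contribution by \<open>\<rho> ^ l\<close> if \<open>k \<noteq> 0\<close>. The contribution of \<open>k = 0\<close> is the product of the two means.
\<close>

lemma conv_pow_corr_trig_poly:
  assumes "trig_poly R A p" and G: "bounded_borel G" and B: "\<And>x. \<bar>G x\<bar> \<le> B"
    and rho: "\<rho> \<ge> 0"
    and gap: "\<And>k. k \<noteq> 0 \<Longrightarrow> (\<And>i. \<bar>k $ i\<bar> \<le> int R) \<Longrightarrow> cmod (fourier_coeff \<mu> k) \<le> \<rho>"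
  shows "bounded_borel (corr G p) \<and> (\<forall>x. cmod ((conv \<mu> ^^ l) (corr G p) x -
    (LINT y|haar_torus. p y) * complex_of_real (LINT y|haar_torus. G y)) \<le> A * (B * \<rho> ^ l))"
  using assms(1) gap
proof (induction R A p rule: trig_poly.induct)
  case (monomial k R c A)
  interpret H: prob_space "haar_torus :: 'd torus measure" by (rule prob_space_haar_torus)
  note [measurable] = bounded_borel_measurable[OF G]
  define gk where "gk = (LINT y|haar_torus. complex_of_real (G y) * torus_character k y)"
  have gk: "cmod gk \<le> B"
    unfolding gk_def by (rule H.integral_norm_bound_const) (auto simp: norm_mult B)
  have "corr G (\<lambda>x. c * torus_character k x) x = c * gk * torus_character (-k) x" for x
  proof -
    have "complex_of_real (G y) * (c * torus_character k (y - x))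
       = (complex_of_real (G y) * torus_character k y) * (c * torus_character (-k) x)" for y
    proof -
      have "torus_character k y = torus_character k (y - x) * torus_character k x"
        by (simp flip: torus_character_add)
      moreover have "torus_character k x * torus_character (-k) x = 1"
        by (simp add: torus_character_mult)
      ultimately show ?thesis by (simp add: algebra_simps)
    qed
    then show ?thesis unfolding corr_def gk_def by (simp only: integral_mult_left_zero) (simp only: mult_ac)
  qed
  then have eq: "corr G (\<lambda>x. c * torus_character k x) = (\<lambda>x. (c * gk) * torus_character (-k) x)" by auto
  have bb: "bounded_borel (\<lambda>x. (c * gk) * torus_character (-k) x)"
    by (rule bounded_borelI[where B="cmod (c * gk)"]) (auto simp: norm_mult)
  have B0: "B \<ge> 0" using B[of 0] by linarith
  have "A \<ge> 0" using monomial norm_ge_zero order_trans by blast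
  show ?case
  proof (cases "k = 0")
    case True
    have "\<rho> ^ l \<ge> 0" using rho by simp
    have "fourier_coeff \<mu> 0 = 1" by (simp add: fourier_coeff_def prob_space)
    moreover have "gk = complex_of_real (LINT y|haar_torus. G y)"
      unfolding gk_def True by simp
    moreover have "(LINT y|haar_torus. c * torus_character k y) = c"
      using H.prob_space by (simp add: True)
    ultimately show ?thesis using bb \<open>A \<ge> 0\<close> B0 \<open>\<rho> ^ l \<ge> 0\<close>
      unfolding eq conv_pow_character by (simp add: True)
  next
    case False
    have "cmod (fourier_coeff \<mu> (-k)) \<le> \<rho>"
      using False monomial by (intro monomial(3)) auto
    then have "cmod (fourier_coeff \<mu> (-k)) ^ l \<le> \<rho> ^ l" by (rule power_mono) simp
    then have "cmod c * (cmod gk * cmod (fourier_coeff \<mu> (-k)) ^ l) \<le> A * (B * \<rho> ^ l)"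
      using gk B0 \<open>A \<ge> 0\<close> monomial(2) by (intro mult_mono) auto
    moreover have z: "(LINT y|haar_torus. c * torus_character k y) = 0"
      using integral_haar_torus_character[OF False] by simp
    ultimately show ?thesis using bb
      unfolding eq conv_pow_character z by (simp add: norm_mult norm_power mult_ac)
  qed
next
  case (add R A1 p A2 q)
  interpret H: prob_space "haar_torus :: 'd torus measure" by (rule prob_space_haar_torus)
  note [measurable] = bounded_borel_measurable[OF G]
  have p[measurable]: "p \<in> borel_measurable borel" and q[measurable]: "q \<in> borel_measurable borel"
    using add.hyps continuous_trig_poly borel_measurable_continuous_onI by auto
  have B0: "B \<ge> 0" using B[of 0] by linarith
  have intG: "integrable haar_torus (\<lambda>y. complex_of_real (G y) * r (y - x))" 
    if "r \<in> borel_measurable borel" "trig_poly R A r" for r :: "'d torus \<Rightarrow> complex" and A x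
    using that norm_trig_poly[OF that(2)] B B0
    by (intro H.integral_norm_bound_const(1)[where B="B * A"]) (auto simp: norm_mult intro!: mult_mono)
  have int: "integrable haar_torus r" if "r \<in> borel_measurable borel" "trig_poly R A r" for r :: "'d torus \<Rightarrow> complex" and A
    using that norm_trig_poly[OF that(2)] by (intro H.integral_norm_bound_const(1)[where B=A]) auto
  have eq: "corr G (\<lambda>x. p x + q x) = (\<lambda>x. corr G p x + corr G q x)"
    using intG[OF p add.hyps(1)] intG[OF q add.hyps(2)]
    by (simp add: corr_def fun_eq_iff distrib_left)
  have P: "bounded_borel (corr G p)" "bounded_borel (corr G q)" using add by auto
  show ?case
  proof (intro conjI allI)
    show "bounded_borel (corr G (\<lambda>x. p x + q x))" unfolding eq by (rule bounded_borel_add[OF P])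
    fix x
    let ?g = "complex_of_real (LINT y|haar_torus. G y)"
    have "(conv \<mu> ^^ l) (corr G (\<lambda>x. p x + q x)) x - (LINT y|haar_torus. p y + q y) * ?g
       = ((conv \<mu> ^^ l) (corr G p) x - (LINT y|haar_torus. p y) * ?g)
       + ((conv \<mu> ^^ l) (corr G q) x - (LINT y|haar_torus. q y) * ?g)"
      using int[OF p add.hyps(1)] int[OF q add.hyps(2)]
      by (simp add: eq conv_pow_add[OF P] algebra_simps)
    also have "cmod \<dots> \<le> A1 * (B * \<rho> ^ l) + A2 * (B * \<rho> ^ l)"
      using add.IH(1)[OF add.prems] add.IH(2)[OF add.prems] by (intro norm_triangle_mono) auto
    finally show "cmod ((conv \<mu> ^^ l) (corr G (\<lambda>x. p x + q x)) x - (LINT y|haar_torus. p y + q y) * ?g)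
       \<le> (A1 + A2) * (B * \<rho> ^ l)" by (simp add: algebra_simps)
  qed
qed

end


section \<open>Concentrated trigonometric kernels\<close>

text \<open>
  In coordinates this is \<open>(cos (pi * x $ i))\<^sup>2\<close>, a trigonometric polynomial that attains its maximum \<open>1\<close>
  exactly where \<open>x $ i\<close> is an integer.
\<close>

definition cos_sq :: "'d \<Rightarrow> 'd::finite torus \<Rightarrow> real" where
  "cos_sq i x = (1 + Re (torus_character (axis i 1) x)) / 2"

lemma cos_sq_torus_of: "cos_sq i (torus_of x) = (cos (pi * x $ i))\<^sup>2"
proof -
  have "(\<Sum>j\<in>UNIV. real_of_int (axis i 1 $ j) * x $ j) = x $ i"
    by (simp add: axis_def if_distrib[of real_of_int] if_distribR sum.delta' cong: if_cong)
      (simp add: if_distrib[of "\<lambda>z. z * _"] sum.delta cong: if_cong)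
  then show ?thesis
    by (simp add: cos_sq_def torus_character_of cos_double_cos mult.assoc)
qed

lemma cos_sq_bounds: "0 \<le> cos_sq i x" "cos_sq i x \<le> 1"
proof -
  obtain y where "x = torus_of y" by (rule torus_of_surj)
  then show "0 \<le> cos_sq i x" "cos_sq i x \<le> 1"
    by (simp_all add: cos_sq_torus_of abs_square_le_1)
qed

lemma cos_sq_measurable [measurable]: "cos_sq i \<in> borel_measurable borel"
  unfolding cos_sq_def by measurable

lemma trig_poly_cos_sq: "trig_poly 1 1 (\<lambda>x. complex_of_real (cos_sq i x))"
proof -
  have "trig_poly 1 (1/2 + (1/4 + 1/4)) (\<lambda>x. (1/2) * torus_character 0 x +
     ((1/4) * torus_character (axis i 1) x + (1/4) * torus_character (- axis i 1) x))"
    by (intro trig_poly.intros) (auto simp: axis_def)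
  also have "(\<lambda>x. (1/2) * torus_character 0 x +
     ((1/4) * torus_character (axis i 1) x + (1/4) * torus_character (- axis i 1) x))
     = (\<lambda>x. complex_of_real (cos_sq i x))"
    by (auto simp: cos_sq_def torus_character_minus complex_eq_iff fun_eq_iff)
  finally show ?thesis by simp
qed

text \<open>
  On \<open>[0, pi / 2]\<close> the cubic Taylor bound gives \<open>sin x \<ge> x - x ^ 3 / 6 \<ge> x / 2\<close>.
\<close>

lemma square_le_sin_square:
  fixes t :: real assumes "\<bar>t\<bar> \<le> 1/2"
  shows "t\<^sup>2 \<le> (sin (pi * t))\<^sup>2"
proof -
  define x where "x = pi * \<bar>t\<bar>"
  have x: "0 \<le> x" "x \<le> pi / 2" using assms by (auto simp: x_def mult_left_mono[of "\<bar>t\<bar>" "1/2" pi])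
  have "pi \<le> 16/5" by (rule order_trans[OF pi_approx(2)]) simp
  then have x2: "x \<le> 8/5" using x(2) by linarith
  have "\<bar>sin x - (\<Sum>m<3. sin_coeff m * x ^ m)\<bar> \<le> inverse (fact 3) * \<bar>x\<bar> ^ 3"
    by (rule Maclaurin_sin_bound)
  moreover have "(\<Sum>m<3. sin_coeff m * x ^ m) = x"
    by (simp add: sin_coeff_def eval_nat_numeral)
  ultimately have "\<bar>sin x - x\<bar> \<le> x ^ 3 / 6" using x(1) by (simp add: fact_numeral)
  then have "sin x \<ge> x - x ^ 3 / 6" by linarith
  moreover have "x ^ 3 \<le> 3 * x"
  proof -
    have "x * x \<le> 8/5 * (8/5)" using x x2 by (intro mult_mono) auto
    then have "x * (x * x) \<le> x * 3" using x by (intro mult_left_mono) auto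
    then show ?thesis by (simp add: power3_eq_cube mult_ac)
  qed
  ultimately have "sin x \<ge> x / 2" by simp
  moreover have "x / 2 \<ge> \<bar>t\<bar>" using mult_right_mono[OF pi_ge_two, of "\<bar>t\<bar>"] by (simp add: x_def mult.commute)
  ultimately have "\<bar>t\<bar> \<le> sin x" by simp
  then have "\<bar>t\<bar>\<^sup>2 \<le> (sin x)\<^sup>2" by (intro power_mono) auto
  moreover have "(sin x)\<^sup>2 = (sin (pi * t))\<^sup>2" by (simp add: x_def abs_if)
  ultimately show ?thesis by simp
qed

text \<open>
  Rounding the coordinates of a representative to the nearest integers bounds the distance to \<open>0\<close>, and
  \<open>1 - cos_sq i\<close> is a squared sine, which dominates the squared distance to the nearest integer.
\<close>

lemma dist_torus_sq_le: "(dist x 0)\<^sup>2 \<le> (\<Sum>i\<in>UNIV. 1 - cos_sq i (x :: 'd::finite torus))"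
proof -
  obtain y where y: "x = torus_of y" by (rule torus_of_surj)
  define k where "k = (\<chi> i. real_of_int (round (y $ i)))"
  have k: "k \<in> int_lattice" by (simp add: k_def int_lattice_def)
  have z: "(0 :: 'd torus) = torus_of 0" by (simp add: zero_torus_def)
  have "dist x 0 = infdist y int_lattice" by (simp add: y z dist_torus.abs_eq)
  also have "\<dots> \<le> norm (y - k)" using infdist_le[OF k] by (simp add: dist_norm)
  finally have "(dist x 0)\<^sup>2 \<le> (norm (y - k))\<^sup>2" by (intro power_mono) auto
  also have "\<dots> = (\<Sum>i\<in>UNIV. (y $ i - k $ i)\<^sup>2)"
    by (simp add: norm_vec_def L2_set_def sum_nonneg)
  also have "\<dots> \<le> (\<Sum>i\<in>UNIV. 1 - cos_sq i x)"
  proof (rule sum_mono)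
    fix i
    have "\<bar>y $ i - k $ i\<bar> \<le> 1/2"
      using of_int_round_abs_le[of "y $ i"] by (simp add: k_def abs_minus_commute)
    then have "(y $ i - k $ i)\<^sup>2 \<le> (sin (pi * (y $ i - k $ i)))\<^sup>2" by (rule square_le_sin_square)
    also have "\<dots> = 1 - cos_sq i (torus_of (y - k))"
      by (simp add: cos_sq_torus_of cos_squared_eq)
    also have "torus_of (y - k) = x"
      using int_lattice_minus[OF k] by (simp add: y torus.abs_eq_iff)
    finally show "(y $ i - k $ i)\<^sup>2 \<le> 1 - cos_sq i x" .
  qed
  finally show ?thesis .
qed

definition wallis :: "nat \<Rightarrow> real" where
  "wallis n = (LINT y|lborel. indicator {0..1} y * ((cos (pi * y))\<^sup>2) ^ n)"

lemma wallis_integrable: "integrable lborel (\<lambda>y::real. indicator {0..1} y * ((cos (pi * y))\<^sup>2) ^ n)"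
  using borel_integrable_atLeastAtMost'[of 0 1 "\<lambda>y. ((cos (pi * y))\<^sup>2) ^ n"]
  by (simp add: set_integrable_def continuous_intros)

lemma wallis_0: "wallis 0 = 1"
  by (simp add: wallis_def)

text \<open>
  The derivative of \<open>sin (pi * y) * cos (pi * y) ^ (2 * n + 1)\<close> has integral zero over \<open>[0, 1]\<close>.
\<close>

lemma wallis_Suc: "real (2 * n + 2) * wallis (Suc n) = real (2 * n + 1) * wallis n"
proof -
  let ?F = "\<lambda>y::real. sin (pi * y) * cos (pi * y) ^ (2 * n + 1)"
  let ?f = "\<lambda>y::real. pi * (real (2 * n + 2) * ((cos (pi * y))\<^sup>2) ^ Suc n - real (2 * n + 1) * ((cos (pi * y))\<^sup>2) ^ n)"
  have der: "(?F has_field_derivative ?f y) (at y within S)" for y S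
  proof -
    have "(?F has_field_derivative
        (cos (pi * y) * pi) * cos (pi * y) ^ (2 * n + 1)
        + sin (pi * y) * (real (2 * n + 1) * cos (pi * y) ^ (2 * n) * (- sin (pi * y) * pi))) (at y within S)"
      by (auto intro!: derivative_eq_intros) (cases n; simp add: algebra_simps)
    also have "(cos (pi * y) * pi) * cos (pi * y) ^ (2 * n + 1)
        + sin (pi * y) * (real (2 * n + 1) * cos (pi * y) ^ (2 * n) * (- sin (pi * y) * pi))
        = pi * (((cos (pi * y))\<^sup>2) ^ Suc n - real (2 * n + 1) * (sin (pi * y))\<^sup>2 * ((cos (pi * y))\<^sup>2) ^ n)"
    proof -
      define c where "c = cos (pi * y)"
      have 1: "c ^ (2 * n) = (c\<^sup>2) ^ n" by (rule power_mult)
      have 2: "c ^ (2 * n + 1) = (c\<^sup>2) ^ n * c" by (simp add: 1)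
      have 3: "(c\<^sup>2) ^ Suc n = (c\<^sup>2) ^ n * c * c" by (simp add: power2_eq_square)
      show ?thesis
        unfolding c_def[symmetric] 1 2 3 by (simp add: algebra_simps power2_eq_square)
    qed
    also have "(sin (pi * y))\<^sup>2 = 1 - (cos (pi * y))\<^sup>2" by (rule sin_squared_eq)
    finally show ?thesis by (simp add: algebra_simps)
  qed
  have "integral\<^sup>L lborel (\<lambda>y. indicator {0..1} y *\<^sub>R ?f y) = ?F 1 - ?F 0"
  proof (rule integral_FTC_atLeastAtMost)
    show "(?F has_vector_derivative ?f y) (at y within {0..1})" for y
      using der by (simp only: has_real_derivative_iff_has_vector_derivative)
    show "continuous_on {0..1} ?f" by (intro continuous_intros)
  qed simp
  also have "?F 1 - ?F 0 = 0" by simp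
  also have "(\<lambda>y. indicator {0..1} y *\<^sub>R ?f y) =
     (\<lambda>y. pi * (real (2 * n + 2) * (indicator {0..1} y * ((cos (pi * y))\<^sup>2) ^ Suc n)
        - real (2 * n + 1) * (indicator {0..1} y * ((cos (pi * y))\<^sup>2) ^ n)))"
    by (simp add: fun_eq_iff algebra_simps)
  also have "integral\<^sup>L lborel \<dots> = pi * (real (2 * n + 2) * wallis (Suc n) - real (2 * n + 1) * wallis n)"
    using wallis_integrable[of "Suc n"] wallis_integrable[of n]
    unfolding wallis_def by (simp only: integral_mult_right_zero Bochner_Integration.integral_diff integrable_mult_right)
  finally show ?thesis by simp
qed

lemma wallis_ge: "wallis n \<ge> 1 / (real n + 1)"
proof (induction n)
  case (Suc n)
  have "real (2 * n + 2) * (1 / (real (Suc n) + 1)) \<le> real (2 * n + 1) * (1 / (real n + 1))"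
    by (simp add: field_simps)
  also have "\<dots> \<le> real (2 * n + 1) * wallis n" using Suc by (intro mult_left_mono) auto
  also have "\<dots> = real (2 * n + 2) * wallis (Suc n)" by (rule wallis_Suc[symmetric])
  finally show ?case by (subst (asm) mult_le_cancel_left_pos) auto
qed (simp add: wallis_0)

text \<open>
  The integrand is a product of functions of one coordinate each, so Fubini on the unit cube applies.
\<close>

lemma integral_haar_prod_cos_sq:
  fixes n :: "'d::finite \<Rightarrow> nat"
  shows "(LINT x|haar_torus. (\<Prod>i\<in>UNIV. cos_sq i x ^ n i)) = (\<Prod>i\<in>UNIV. wallis (n i))"
proof -
  interpret H: prob_space "haar_torus :: 'd torus measure" by (rule prob_space_haar_torus)
  let ?p = "\<lambda>x :: 'd torus. \<Prod>i\<in>UNIV. cos_sq i x ^ n i"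
  let ?w = "\<lambda>i y. indicator {0..1} y * ((cos (pi * y))\<^sup>2) ^ n i :: real"
  have wpos: "wallis k \<ge> 0" for k using wallis_ge[of k] by (meson divide_nonneg_nonneg le_less order_trans of_nat_0_le_iff add_nonneg_nonneg zero_le_one)
  have p0: "?p x \<ge> 0" for x by (intro prod_nonneg) (auto simp: cos_sq_bounds)
  have p1: "?p x \<le> 1" for x by (intro prod_le_1) (auto simp: cos_sq_bounds power_le_one)
  have int: "integrable haar_torus ?p"
    by (rule H.integral_norm_bound_const(1)[where B=1]) (use p0 p1 in auto)
  have one: "(1 :: real^'d) \<bullet> b = 1" if "b \<in> Basis" for b
    using that by (auto simp: Basis_vec_def inner_axis)
  have e1: "emeasure lborel (cbox 0 (1 :: real^'d)) = 1"
    by (subst emeasure_lborel_cbox) (simp_all add: one)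
  let ?ax = "\<lambda>i::'d. axis i (1::real)"
  have inj: "inj ?ax" by (auto simp: inj_on_def axis_eq_axis)
  have Basis: "Basis = range ?ax" by (auto simp: Basis_vec_def)
  have "ennreal (LINT x|haar_torus. ?p x) = (\<integral>\<^sup>+x. ennreal (?p x) \<partial>haar_torus)"
    using p0 by (intro nn_integral_eq_integral[OF int, symmetric]) auto
  also have "\<dots> = (\<integral>\<^sup>+y. ennreal (?p (torus_of y)) * indicator (cbox 0 (1 :: real^'d)) y \<partial>lborel)"
    unfolding haar_torus_def
    by (subst nn_integral_distr) (auto simp: nn_integral_uniform_measure e1 divide_ennreal_def)
  also have "\<dots> = (\<integral>\<^sup>+y. (\<Prod>b\<in>Basis. ennreal (?w (the_inv ?ax b) (y \<bullet> b))) \<partial>lborel)"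
  proof (rule nn_integral_cong)
    fix y :: "real^'d"
    have "(\<Prod>b\<in>Basis. ennreal (?w (the_inv ?ax b) (y \<bullet> b))) = (\<Prod>i\<in>UNIV. ennreal (?w i (y $ i)))"
      unfolding Basis by (subst prod.reindex[OF inj]) (simp add: the_inv_f_f[OF inj] inner_axis)
    also have "\<dots> = ennreal (\<Prod>i\<in>UNIV. ?w i (y $ i))"
      by (rule prod_ennreal) auto
    also have "(\<Prod>i\<in>UNIV. ?w i (y $ i)) = ?p (torus_of y) * indicator (cbox 0 1) y"
    proof (cases "y \<in> cbox 0 1")
      case True
      then show ?thesis by (simp add: cbox01 cos_sq_torus_of indicator_def)
    next
      case False
      then obtain i where "\<not> (0 \<le> y $ i \<and> y $ i \<le> 1)" by (auto simp: cbox01)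
      then have "(\<Prod>i\<in>UNIV. ?w i (y $ i)) = 0" by (intro prod_zero) (auto simp: indicator_def)
      then show ?thesis using False by simp
    qed
    finally show "ennreal (?p (torus_of y)) * indicator (cbox 0 1) y
       = (\<Prod>b\<in>Basis. ennreal (?w (the_inv ?ax b) (y \<bullet> b)))"
      using p0 by (simp add: ennreal_mult' indicator_def)
  qed
  also have "\<dots> = (\<Prod>b\<in>Basis. \<integral>\<^sup>+y. ennreal (?w (the_inv ?ax b) y) \<partial>lborel)"
    by (rule nn_integral_lborel_prod) auto
  also have "\<dots> = (\<Prod>i\<in>UNIV. \<integral>\<^sup>+y. ennreal (?w i y) \<partial>lborel)"
    unfolding Basis by (subst prod.reindex[OF inj]) (simp add: the_inv_f_f[OF inj])
  also have "\<dots> = (\<Prod>i\<in>UNIV. ennreal (wallis (n i)))"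
    unfolding wallis_def by (intro prod.cong refl nn_integral_eq_integral wallis_integrable) auto
  also have "\<dots> = ennreal (\<Prod>i\<in>UNIV. wallis (n i))"
    by (rule prod_ennreal) (rule wpos)
  finally show ?thesis
    using p0 wpos by (subst (asm) ennreal_inj) (auto intro!: prod_nonneg integral_nonneg)
qed

text \<open>
  The kernel of de la Vallee-Poussin, without the factor that normalises its integral to \<open>1\<close>. Its mass sits
  within distance of order \<open>1 / sqrt n\<close> of \<open>0\<close>, and its degree is linear in \<open>n\<close>.
\<close>

definition cos_kernel :: "nat \<Rightarrow> 'd::finite torus \<Rightarrow> real" where
  "cos_kernel n x = (\<Prod>i\<in>UNIV. cos_sq i x ^ n)"

lemma cos_kernel_nonneg: "cos_kernel n x \<ge> 0"
  unfolding cos_kernel_def by (intro prod_nonneg) (auto simp: cos_sq_bounds)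

lemma cos_kernel_le_1: "cos_kernel n x \<le> 1"
  unfolding cos_kernel_def by (intro prod_le_1) (auto simp: cos_sq_bounds power_le_one)

lemma cos_kernel_measurable [measurable]: "cos_kernel n \<in> borel_measurable borel"
  unfolding cos_kernel_def[abs_def] by measurable

lemma integral_cos_kernel: "(LINT x|haar_torus. cos_kernel n (x :: 'd::finite torus)) = wallis n ^ CARD('d)"
  unfolding cos_kernel_def by (subst integral_haar_prod_cos_sq) simp

lemma trig_poly_cos_kernel: "trig_poly (CARD('d::finite) * n) 1 (\<lambda>x :: 'd torus. complex_of_real (cos_kernel n x))"
proof -
  have "trig_poly (CARD('d) * (n * 1)) 1 (\<lambda>x :: 'd torus. \<Prod>i\<in>UNIV. complex_of_real (cos_sq i x) ^ n)"
    by (intro trig_poly_prod trig_poly_power trig_poly_cos_sq) auto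
  then show ?thesis by (simp add: cos_kernel_def)
qed

text \<open>
  Multiplication by \<open>cos_sq i\<close> raises one exponent from \<open>n\<close> to \<open>n + 1\<close>, so the integral is a difference of two
  consecutive Wallis integrals.
\<close>

lemma integral_cos_kernel_moment:
  fixes i :: "'d::finite"
  shows "(LINT x|haar_torus. (1 - cos_sq i x) * cos_kernel n x) = wallis n ^ CARD('d) / (2 * real n + 2)"
proof -
  interpret H: prob_space "haar_torus :: 'd torus measure" by (rule prob_space_haar_torus)
  let ?m = "\<lambda>j. if j = i then Suc n else n"
  let ?W = "\<Prod>j\<in>UNIV - {i}. wallis n"
  have split: "prod g UNIV = g i * prod g (UNIV - {i})" for g :: "'d \<Rightarrow> real"
    by (rule prod.remove) auto
  have k: "cos_sq i x * cos_kernel n x = (\<Prod>j\<in>UNIV. cos_sq j x ^ ?m j)" for x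
    unfolding cos_kernel_def by (subst (1 2) split) (auto intro!: prod.cong)
  have int: "integrable haar_torus (\<lambda>x :: 'd torus. cos_kernel n x)" "integrable haar_torus (\<lambda>x. cos_sq i x * cos_kernel n x)"
    subgoal by (rule H.integral_norm_bound_const(1)[where B=1]) (auto simp: cos_kernel_nonneg cos_kernel_le_1)
    subgoal by (rule H.integral_norm_bound_const(1)[where B=1])
        (auto simp: cos_kernel_nonneg cos_kernel_le_1 cos_sq_bounds abs_mult intro!: mult_le_one)
    done
  have "(LINT x|haar_torus. (1 - cos_sq i x) * cos_kernel n x)
      = (LINT x|haar_torus. cos_kernel n (x :: 'd torus)) - (LINT x|haar_torus. cos_sq i x * cos_kernel n x)"
    using int by (simp add: left_diff_distrib)
  also have "(LINT x|haar_torus. cos_sq i x * cos_kernel n x) = wallis (Suc n) * ?W"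
    unfolding k integral_haar_prod_cos_sq by (subst split) (auto intro!: prod.cong)
  also have "(LINT x|haar_torus. cos_kernel n (x :: 'd torus)) = wallis n * ?W"
    unfolding cos_kernel_def by (subst integral_haar_prod_cos_sq, subst split) auto
  also have "wallis n * ?W - wallis (Suc n) * ?W = (wallis n - wallis (Suc n)) * ?W"
    by (simp add: algebra_simps)
  also have "wallis n - wallis (Suc n) = wallis n / (2 * real n + 2)"
    using wallis_Suc[of n] by (simp add: field_simps)
  also have "wallis n / (2 * real n + 2) * ?W = (wallis n * ?W) / (2 * real n + 2)" by simp
  also have "wallis n * ?W = wallis n ^ CARD('d)"
    using split[of "\<lambda>_. wallis n"] by simp
  finally show ?thesis .
qed

text \<open>
  Replace \<open>G\<close> by its average against the normalised kernel. The error is at most \<open>a\<close> plus \<open>b\<close> times the second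
  moment of the kernel, also after any number of random steps, because \<^term>\<open>conv \<mu>\<close> is a contraction in the
  supremum norm. The average itself is handled by the spectral gap; the polynomial factor comes from the
  normalisation, as the Wallis integral is at least \<open>1 / (n + 1)\<close>. A modulus of continuity of the form
  \<open>a + b * (dist x y)\<^sup>2\<close> covers both Hoelder functions and arbitrary uniformly continuous bounded functions.
\<close>

lemma (in torus_prob) conv_pow_equidistribution:
  fixes G :: "'d torus \<Rightarrow> real"
  assumes G: "bounded_borel G" and B: "\<And>x. \<bar>G x\<bar> \<le> B"
    and ab: "b \<ge> 0" "\<And>x y. \<bar>G x - G y\<bar> \<le> a + b * (dist x y)\<^sup>2"
    and rho: "\<rho> \<ge> 0"
    and gap: "\<And>k. k \<noteq> 0 \<Longrightarrow> (\<And>i. \<bar>k $ i\<bar> \<le> int (CARD('d) * n)) \<Longrightarrow> cmod (fourier_coeff \<mu> k) \<le> \<rho>"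
  shows "\<bar>(conv \<mu> ^^ l) G x - (LINT y|haar_torus. G y)\<bar>
    \<le> a + b * real CARD('d) / (2 * real n + 2) + B * (real n + 1) ^ CARD('d) * \<rho> ^ l"
proof -
  interpret H: prob_space "haar_torus :: 'd torus measure" by (rule prob_space_haar_torus)
  note [measurable] = bounded_borel_measurable[OF G]
  define Z where "Z = wallis n ^ CARD('d)"
  have Z1: "1 \<le> (real n + 1) ^ CARD('d) * Z"
  proof -
    have "1 \<le> (real n + 1) * wallis n" using wallis_ge[of n] by (simp add: field_simps)
    then have "1 \<le> ((real n + 1) * wallis n) ^ CARD('d)" by (rule one_le_power)
    then show ?thesis by (simp add: Z_def power_mult_distrib)
  qed
  have Z0: "Z > 0"
  proof (rule ccontr)
    assume "\<not> Z > 0"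
    then have "(real n + 1) ^ CARD('d) * Z \<le> 0" by (intro mult_nonneg_nonpos) auto
    with Z1 show False by linarith
  qed
  have B0: "B \<ge> 0" using B[of 0] by linarith
  let ?k = "\<lambda>x :: 'd torus. complex_of_real (cos_kernel n x)"
  define I where "I = (LINT y|haar_torus. G y)"
  have main: "bounded_borel (corr G ?k)"
    "cmod ((conv \<mu> ^^ l) (corr G ?k) x - (LINT y|haar_torus. ?k y) * complex_of_real I) \<le> 1 * (B * \<rho> ^ l)"
    using conv_pow_corr_trig_poly[OF trig_poly_cos_kernel G B rho gap, of n l] by (auto simp: I_def)
  have Zk: "(LINT y|haar_torus. ?k y) = complex_of_real Z"
    by (simp add: integral_cos_kernel Z_def)
  have close: "cmod (complex_of_real Z * complex_of_real (G x) - corr G ?k x)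
     \<le> Z * (a + b * real CARD('d) / (2 * real n + 2))" for x
  proof -
    have int: "integrable haar_torus (\<lambda>y. cos_kernel n y * G (y + x))" "integrable haar_torus (\<lambda>y. cos_kernel n (y :: 'd torus))"
      "integrable haar_torus (\<lambda>y. cos_kernel n y * \<bar>G x - G (y + x)\<bar>)"
      "integrable haar_torus (\<lambda>y. (1 - cos_sq i y) * cos_kernel n y)" for i :: 'd
    proof -
      have le: "cos_kernel n y * t \<le> C" if "0 \<le> t" "t \<le> C" for y :: "'d torus" and t C
        using mult_mono[OF cos_kernel_le_1 that(2) _ that(1), of n y] by simp
      show "integrable haar_torus (\<lambda>y. cos_kernel n y * G (y + x))"
        using B by (intro H.integral_norm_bound_const(1)[where B="B"]) (auto simp: abs_mult cos_kernel_nonneg intro!: le)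
      show "integrable haar_torus (\<lambda>y. cos_kernel n (y :: 'd torus))"
        by (intro H.integral_norm_bound_const(1)[where B="1"]) (auto simp: cos_kernel_nonneg cos_kernel_le_1)
      have "\<bar>G x - G y\<bar> \<le> 2 * B" for y using B[of x] B[of y] by linarith
      then show "integrable haar_torus (\<lambda>y. cos_kernel n y * \<bar>G x - G (y + x)\<bar>)"
        by (intro H.integral_norm_bound_const(1)[where B="2*B"]) (auto simp: abs_mult cos_kernel_nonneg intro!: le)
      show "integrable haar_torus (\<lambda>y. (1 - cos_sq i y) * cos_kernel n y)"
        by (intro H.integral_norm_bound_const(1)[where B="1"])
          (auto simp: abs_mult cos_sq_bounds cos_kernel_nonneg cos_kernel_le_1 intro!: mult_le_one)
    qed
    have "corr G ?k x = (LINT y|haar_torus. (\<lambda>y. complex_of_real (G y) * ?k (y - x)) (y + x))"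
      unfolding corr_def by (rule integral_haar_torus_translate[symmetric]) measurable
    also have "\<dots> = complex_of_real (LINT y|haar_torus. cos_kernel n y * G (y + x))"
      by (subst integral_complex_of_real[symmetric]) (simp add: mult.commute)
    finally have c: "corr G ?k x = complex_of_real (LINT y|haar_torus. cos_kernel n y * G (y + x))" .
    have "Z * G x - (LINT y|haar_torus. cos_kernel n y * G (y + x)) = (LINT y|haar_torus. cos_kernel n y * (G x - G (y + x)))"
      using int by (simp add: right_diff_distrib integral_cos_kernel Z_def)
    also have "\<bar>\<dots>\<bar> \<le> (LINT y|haar_torus. \<bar>cos_kernel n y * (G x - G (y + x))\<bar>)"
      by (rule integral_abs_bound)
    also have "\<dots> = (LINT y|haar_torus. cos_kernel n y * \<bar>G x - G (y + x)\<bar>)"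
      by (simp add: abs_mult cos_kernel_nonneg)
    also have "\<dots> \<le> (LINT y|haar_torus. a * cos_kernel n (y :: 'd torus) + b * (\<Sum>i\<in>UNIV. (1 - cos_sq i y) * cos_kernel n y))"
    proof (rule integral_mono)
      fix y :: "'d torus"
      have "\<bar>G x - G (y + x)\<bar> \<le> a + b * (dist y 0)\<^sup>2"
        using ab(2)[of x "y + x"] dist_torus_add_right[of 0 x y] by (simp add: dist_commute)
      also have "\<dots> \<le> a + b * (\<Sum>i\<in>UNIV. 1 - cos_sq i y)"
        using ab(1) dist_torus_sq_le[of y] by (intro add_left_mono mult_left_mono) auto
      finally have "cos_kernel n y * \<bar>G x - G (y + x)\<bar> \<le> cos_kernel n y * (a + b * (\<Sum>i\<in>UNIV. 1 - cos_sq i y))"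
        by (rule mult_left_mono) (rule cos_kernel_nonneg)
      also have "\<dots> = a * cos_kernel n y + b * (\<Sum>i\<in>UNIV. (1 - cos_sq i y) * cos_kernel n y)"
        by (simp only: sum_distrib_right[symmetric]) (simp add: algebra_simps)
      finally show "cos_kernel n y * \<bar>G x - G (y + x)\<bar> \<le> a * cos_kernel n y + b * (\<Sum>i\<in>UNIV. (1 - cos_sq i y) * cos_kernel n y)" .
    qed (use int in auto)
    also have "\<dots> = a * Z + b * (real CARD('d) * (Z / (2 * real n + 2)))"
      using int by (simp add: Bochner_Integration.integral_sum integral_cos_kernel integral_cos_kernel_moment Z_def)
    also have "\<dots> = Z * (a + b * real CARD('d) / (2 * real n + 2))"
      by (simp add: algebra_simps)
    finally show ?thesis unfolding c
      by (simp only: of_real_mult[symmetric] of_real_diff[symmetric] norm_of_real)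
  qed
  have ZG: "bounded_borel (\<lambda>x. complex_of_real Z * complex_of_real (G x))"
    using B Z0 by (intro bounded_borelI[where B="Z * B"]) (auto simp: norm_mult)
  have convZ: "(conv \<mu> ^^ l) (\<lambda>x. complex_of_real Z * complex_of_real (G x)) x
     = complex_of_real (Z * (conv \<mu> ^^ l) G x)"
  proof -
    have "(conv \<mu> ^^ l) (\<lambda>x. complex_of_real Z * complex_of_real (G x))
      = (\<lambda>x. complex_of_real Z * (conv \<mu> ^^ l) (\<lambda>x. complex_of_real (G x)) x)"
      by (induction l) (auto simp: conv_def fun_eq_iff)
    then show ?thesis by (simp add: conv_pow_of_real)
  qed
  have d1: "cmod (complex_of_real (Z * (conv \<mu> ^^ l) G x) - (conv \<mu> ^^ l) (corr G ?k) x)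
     \<le> Z * (a + b * real CARD('d) / (2 * real n + 2))"
    using conv_pow_diff_le[OF ZG main(1) close, of l x] by (simp add: convZ)
  have "Z * \<bar>(conv \<mu> ^^ l) G x - I\<bar> = cmod (complex_of_real (Z * (conv \<mu> ^^ l) G x) - complex_of_real (Z * I))"
    using Z0 by (simp only: of_real_diff[symmetric] right_diff_distrib[symmetric] norm_of_real abs_mult)
  also have "\<dots> \<le> Z * (a + b * real CARD('d) / (2 * real n + 2)) + B * \<rho> ^ l"
    using d1 main(2) unfolding Zk by (intro norm_diff_triangle_le[where y="(conv \<mu> ^^ l) (corr G ?k) x"]) auto
  also have "B * \<rho> ^ l \<le> ((real n + 1) ^ CARD('d) * Z) * (B * \<rho> ^ l)"
    using mult_right_mono[OF Z1, of "B * \<rho> ^ l"] B0 rho by simp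
  finally have "Z * \<bar>(conv \<mu> ^^ l) G x - I\<bar> \<le>
     Z * (a + b * real CARD('d) / (2 * real n + 2) + B * (real n + 1) ^ CARD('d) * \<rho> ^ l)"
    by (simp add: algebra_simps)
  then show ?thesis using Z0 by (simp add: I_def)
qed

section \<open>Conditional expectation given the past\<close>

type_synonym 'd phase = "(int \<Rightarrow> 'd torus) \<times> 'd torus"

definition splice_at :: "int \<Rightarrow> (int \<Rightarrow> 'a) \<Rightarrow> (int \<Rightarrow> 'a) \<Rightarrow> int \<Rightarrow> 'a" where
  "splice_at a \<omega> \<omega>' = (\<lambda>j. if j < a then \<omega> j else \<omega>' j)"

definition skew_inv :: "'d::finite phase \<Rightarrow> 'd phase" where
  "skew_inv = (\<lambda>(\<omega>, \<theta>). ((\<lambda>n. \<omega> (n - 1)), \<theta> - \<omega> (-1)))"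

lemma skew_inv_skew [simp]: "skew_inv (skew_product x) = x"
  by (cases x) (simp add: skew_inv_def skew_product_def)

lemma skew_pow_formula:
  "(skew_product ^^ n) (\<omega>, \<theta>) = ((\<lambda>j. \<omega> (j + int n)), \<theta> + (\<Sum>i<n. \<omega> (int i)))"
  by (induction n) (auto simp: skew_product_def algebra_simps)

lemma skew_inv_pow_formula:
  "(skew_inv ^^ n) (\<omega>, \<theta>) = ((\<lambda>j. \<omega> (j - int n)), \<theta> - (\<Sum>i<n. \<omega> (- 1 - int i)))"
  by (induction n) (auto simp: skew_inv_def algebra_simps)

lemma borel_measurable_coordinate:
  fixes F :: "'b \<Rightarrow> 'i::countable \<Rightarrow> 'a::second_countable_topology"
  assumes "F \<in> borel_measurable M"
  shows "(\<lambda>x. F x j) \<in> borel_measurable M"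
  by (rule measurable_compose[OF assms measurable_product_coordinates])

lemma borel_measurable_fst: "fst \<in> borel_measurable (borel :: ('a::topological_space \<times> 'b::topological_space) measure)"
  by (intro borel_measurable_continuous_onI continuous_on_fst continuous_on_id)

lemma borel_measurable_snd: "snd \<in> borel_measurable (borel :: ('a::topological_space \<times> 'b::topological_space) measure)"
  by (intro borel_measurable_continuous_onI continuous_on_snd continuous_on_id)

lemma splice_measurable [measurable]:
  fixes F G :: "'b \<Rightarrow> int \<Rightarrow> 'd::finite torus"
  assumes [measurable]: "F \<in> borel_measurable M" "G \<in> borel_measurable M"
  shows "(\<lambda>x. splice_at a (F x) (G x)) \<in> borel_measurable M"
proof (rule measurable_coordinatewise_then_product)
  fix j
  have "(\<lambda>x. F x j) \<in> borel_measurable M" "(\<lambda>x. G x j) \<in> borel_measurable M"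
    by (rule borel_measurable_coordinate, rule assms)+
  then show "(\<lambda>x. splice_at a (F x) (G x) j) \<in> borel_measurable M"
    by (simp add: splice_at_def)
qed

lemma skew_product_measurable [measurable]: "skew_product \<in> borel_measurable (borel :: ('d::finite phase) measure)"
proof -
  note borel_measurable_coordinate[OF borel_measurable_fst, measurable] borel_measurable_snd[measurable]
  have "(\<lambda>x :: 'd phase. ((\<lambda>n. fst x (n + 1)), snd x + fst x 0)) \<in> borel_measurable borel"
    by (intro borel_measurable_Pair measurable_coordinatewise_then_product) measurable
  then show ?thesis by (simp add: skew_product_def case_prod_beta)
qed

lemma skew_inv_measurable [measurable]: "skew_inv \<in> borel_measurable (borel :: ('d::finite phase) measure)"
proof -
  note borel_measurable_coordinate[OF borel_measurable_fst, measurable] borel_measurable_snd[measurable]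
  have "(\<lambda>x :: 'd phase. ((\<lambda>n. fst x (n - 1)), snd x - fst x (-1))) \<in> borel_measurable borel"
    by (intro borel_measurable_Pair measurable_coordinatewise_then_product) measurable
  then show ?thesis by (simp add: skew_inv_def case_prod_beta)
qed

lemma skew_pow_measurable [measurable]: "(skew_product ^^ n) \<in> borel_measurable (borel :: ('d::finite phase) measure)"
  by (induction n) (auto intro: measurable_comp)

lemma skew_inv_pow_measurable [measurable]: "(skew_inv ^^ n) \<in> borel_measurable (borel :: ('d::finite phase) measure)"
  by (induction n) (auto intro: measurable_comp)

lemma bounded_borel_comp:
  assumes G: "bounded_borel G" and T: "T \<in> borel_measurable borel"
  shows "bounded_borel (\<lambda>x. G (T x))"
proof -
  obtain B where "\<And>x. norm (G x) \<le> B" using bounded_borelE[OF G] by blast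
  then show ?thesis
    using measurable_compose[OF T bounded_borel_measurable[OF G]] by (intro bounded_borelI)
qed

text \<open>
  Measurability with respect to \<open>\<theta>\<close> and the coordinates \<open>\<omega> j\<close> with \<open>j < a\<close>, stated pointwise.
\<close>

definition past :: "int \<Rightarrow> ('d::finite phase \<Rightarrow> 'b) \<Rightarrow> bool" where
  "past a \<psi> \<longleftrightarrow> (\<forall>\<omega> \<omega>' \<theta>. (\<forall>j<a. \<omega> j = \<omega>' j) \<longrightarrow> \<psi> (\<omega>, \<theta>) = \<psi> (\<omega>', \<theta>))"

lemma pastD: "past a \<psi> \<Longrightarrow> (\<And>j. j < a \<Longrightarrow> \<omega> j = \<omega>' j) \<Longrightarrow> \<psi> (\<omega>, \<theta>) = \<psi> (\<omega>', \<theta>)"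
  by (auto simp: past_def)

lemma past_mono: "past a \<psi> \<Longrightarrow> a \<le> b \<Longrightarrow> past b \<psi>"
  unfolding past_def by (meson order_less_le_trans)

lemma past_comp_skew: "past a \<psi> \<Longrightarrow> a \<ge> 0 \<Longrightarrow> past (a + 1) (\<lambda>x. \<psi> (skew_product x))"
  unfolding past_def skew_product_def by fastforce

lemma past_comp_skew_inv: "past (a + 1) \<psi> \<Longrightarrow> a \<ge> 0 \<Longrightarrow> past a (\<lambda>x. \<psi> (skew_inv x))"
  unfolding past_def skew_inv_def by auto

context torus_prob begin

definition paths :: "(int \<Rightarrow> 'd torus) measure" where
  "paths = (\<Pi>\<^sub>M j\<in>UNIV. \<mu>)"

lemma sets_paths [simp, measurable_cong]: "sets paths = sets borel"
proof -
  have "sets paths = sets (\<Pi>\<^sub>M j\<in>(UNIV::int set). (borel :: 'd torus measure))"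
    unfolding paths_def by (rule sets_PiM_cong) (simp_all add: sets_mu)
  also have "\<dots> = sets borel" by (rule sets_PiM_equal_borel)
  finally show ?thesis .
qed

lemma space_paths [simp]: "space paths = UNIV"
  using sets_eq_imp_space_eq[OF sets_paths] by simp

lemma space_mu [simp]: "space \<mu> = UNIV"
  using sets_eq_imp_space_eq[OF sets_mu] by simp

sublocale W: prob_space paths
  unfolding paths_def by (rule prob_space_PiM) (rule prob)

sublocale WW: pair_prob_space paths paths ..

interpretation PP: product_prob_space "\<lambda>j::int. \<mu>" UNIV
  by unfold_locales

lemma distr_shift: "distr paths paths (\<lambda>\<omega> n. \<omega> (n + c)) = paths"
  using distr_PiM_reindex[of UNIV "\<lambda>_::int. \<mu>" "\<lambda>n. n + c" UNIV] prob
  by (simp add: paths_def restrict_UNIV inj_on_def)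

lemma distr_component: "distr paths \<mu> (\<lambda>\<omega>. \<omega> j) = \<mu>"
  unfolding paths_def by (rule distr_PiM_component) (auto simp: prob)

text \<open>
  A cylinder set splits into its coordinates before \<open>a\<close> and those from \<open>a\<close> on, which are drawn from two
  independent sequences with the same product distribution.
\<close>

lemma distr_splice: "distr (paths \<Otimes>\<^sub>M paths) paths (\<lambda>(\<omega>, \<omega>'). splice_at a \<omega> \<omega>') = paths"
proof -
  have meas: "(\<lambda>(\<omega>, \<omega>'). splice_at a \<omega> \<omega>') \<in> measurable (paths \<Otimes>\<^sub>M paths) paths" by measurable
  have "distr (paths \<Otimes>\<^sub>M paths) paths (\<lambda>(\<omega>, \<omega>'). splice_at a \<omega> \<omega>') = (\<Pi>\<^sub>M j\<in>UNIV. \<mu>)"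
  proof (rule PP.PiM_eq)
    show "sets (distr (paths \<Otimes>\<^sub>M paths) paths (\<lambda>(\<omega>, \<omega>'). splice_at a \<omega> \<omega>')) = sets (\<Pi>\<^sub>M j\<in>UNIV. \<mu>)"
      by (simp add: paths_def)
    fix J F assume J: "finite J" "J \<subseteq> (UNIV :: int set)" and F: "\<And>j. j \<in> J \<Longrightarrow> F j \<in> sets \<mu>"
    let ?X = "\<lambda>J. prod_emb UNIV (\<lambda>j::int. \<mu>) J (\<Pi>\<^sub>E j\<in>J. F j)"
    let ?J1 = "J \<inter> {..<a}" and ?J2 = "J \<inter> {a..}"
    have X: "?X K \<in> sets paths" "emeasure paths (?X K) = (\<Prod>j\<in>K. emeasure \<mu> (F j))" if "K \<subseteq> J" for K
    proof -
      have K: "finite K" using that J finite_subset by blast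
      show "?X K \<in> sets paths" unfolding paths_def using that K F by (intro sets_PiM_I) auto
      show "emeasure paths (?X K) = (\<Prod>j\<in>K. emeasure \<mu> (F j))"
        unfolding paths_def using that K F by (intro emeasure_PiM_emb prob) auto
    qed
    have XE: "?X K = {\<omega>. \<forall>j\<in>K. \<omega> j \<in> F j}" for K
      by (auto simp: prod_emb_def PiE_def Pi_def extensional_def restrict_def)
    have "emeasure (distr (paths \<Otimes>\<^sub>M paths) paths (\<lambda>(\<omega>, \<omega>'). splice_at a \<omega> \<omega>')) (?X J)
       = emeasure (paths \<Otimes>\<^sub>M paths) ((\<lambda>(\<omega>, \<omega>'). splice_at a \<omega> \<omega>') -` ?X J \<inter> space (paths \<Otimes>\<^sub>M paths))"
      using X by (intro emeasure_distr[OF meas]) auto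
    also have "(\<lambda>(\<omega>, \<omega>'). splice_at a \<omega> \<omega>') -` ?X J \<inter> space (paths \<Otimes>\<^sub>M paths) = ?X ?J1 \<times> ?X ?J2"
      unfolding XE by (auto simp: splice_at_def space_pair_measure not_less)
    also have "emeasure (paths \<Otimes>\<^sub>M paths) (?X ?J1 \<times> ?X ?J2) = emeasure paths (?X ?J1) * emeasure paths (?X ?J2)"
      using X by (intro W.emeasure_pair_measure_Times) auto
    also have "\<dots> = (\<Prod>j\<in>?J1. emeasure \<mu> (F j)) * (\<Prod>j\<in>?J2. emeasure \<mu> (F j))"
      using X(2)[of ?J1] X(2)[of ?J2] by simp
    also have "\<dots> = (\<Prod>j\<in>?J1 \<union> ?J2. emeasure \<mu> (F j))"
      using J by (intro prod.union_disjoint[symmetric]) auto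
    also have "?J1 \<union> ?J2 = J" by auto
    finally show "emeasure (distr (paths \<Otimes>\<^sub>M paths) paths (\<lambda>(\<omega>, \<omega>'). splice_at a \<omega> \<omega>')) (?X J) = (\<Prod>j\<in>J. emeasure \<mu> (F j))" .
  qed
  then show ?thesis by (simp add: paths_def)
qed

lemma integral_shift:
  fixes F :: "(int \<Rightarrow> 'd torus) \<Rightarrow> 'b::{banach, second_countable_topology}"
  assumes [measurable]: "F \<in> borel_measurable borel"
  shows "(LINT \<omega>|paths. F (\<lambda>n. \<omega> (n + c))) = (LINT \<omega>|paths. F \<omega>)"
proof -
  have [measurable]: "(\<lambda>\<omega> :: int \<Rightarrow> 'd torus. (\<lambda>n. \<omega> (n + c))) \<in> borel_measurable borel"
    by (rule measurable_coordinatewise_then_product, rule borel_measurable_coordinate[of "\<lambda>\<omega>. \<omega>"]) simp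
  show ?thesis by (subst (2) distr_shift[of c, symmetric], subst integral_distr) auto
qed

lemma integral_splice:
  fixes F :: "(int \<Rightarrow> 'd torus) \<Rightarrow> 'b::{banach, second_countable_topology}"
  assumes [measurable]: "F \<in> borel_measurable borel" and B: "\<And>\<omega>. norm (F \<omega>) \<le> B"
  shows "(LINT \<omega>|paths. LINT \<omega>'|paths. F (splice_at a \<omega> \<omega>')) = (LINT \<omega>|paths. F \<omega>)"
proof -
  have int: "integrable (paths \<Otimes>\<^sub>M paths) (\<lambda>(\<omega>, \<omega>'). F (splice_at a \<omega> \<omega>'))"
    by (rule WW.P.integral_norm_bound_const(1)[where B=B]) (auto simp: B)
  have "(LINT \<omega>|paths. F \<omega>) = (LINT x|distr (paths \<Otimes>\<^sub>M paths) paths (\<lambda>(\<omega>, \<omega>'). splice_at a \<omega> \<omega>'). F x)"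
    by (simp add: distr_splice)
  also have "\<dots> = integral\<^sup>L (paths \<Otimes>\<^sub>M paths) (\<lambda>x. F (case x of (\<omega>, \<omega>') \<Rightarrow> splice_at a \<omega> \<omega>'))"
    by (rule integral_distr) measurable
  also have "\<dots> = integral\<^sup>L (paths \<Otimes>\<^sub>M paths) (\<lambda>(\<omega>, \<omega>'). F (splice_at a \<omega> \<omega>'))"
    by (intro Bochner_Integration.integral_cong) auto
  also have "\<dots> = (LINT \<omega>|paths. LINT \<omega>'|paths. F (splice_at a \<omega> \<omega>'))"
    by (rule WW.integral_fst'[OF int, symmetric, simplified])
  finally show ?thesis by simp
qed

text \<open>
  The conditional expectation given \<open>\<theta>\<close> and the coordinates \<open>\<omega> j\<close> with \<open>j < a\<close>: the past is kept and all other
  coordinates are drawn afresh. Unlike an abstract conditional expectation, this version is defined at every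
  point, so that it preserves continuity and the identities below hold everywhere.
\<close>

definition past_exp :: "int \<Rightarrow> ('d phase \<Rightarrow> 'b) \<Rightarrow>
    'd phase \<Rightarrow> 'b::{banach, second_countable_topology}" where
  "past_exp a \<psi> = (\<lambda>(\<omega>, \<theta>). LINT \<omega>'|paths. \<psi> (splice_at a \<omega> \<omega>', \<theta>))"

context
  fixes \<psi> :: "'d phase \<Rightarrow> 'b::{banach, second_countable_topology}"
  assumes bb: "bounded_borel \<psi>"
begin

lemma psi_pair_measurable: "\<psi> \<in> borel_measurable (borel \<Otimes>\<^sub>M borel)"
  using bounded_borel_measurable[OF bb] by (simp only: borel_prod)

lemma past_exp_integrable: "integrable paths (\<lambda>\<omega>'. \<psi> (splice_at a \<omega> \<omega>', \<theta>))"
proof -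
  note psi_pair_measurable[measurable]
  obtain B where "\<And>x. norm (\<psi> x) \<le> B" using bounded_borelE[OF bb] by blast
  then show ?thesis by (intro W.integral_norm_bound_const(1)[where B=B]) auto
qed

lemma norm_past_exp_le: "(\<And>x. norm (\<psi> x) \<le> B) \<Longrightarrow> norm (past_exp a \<psi> x) \<le> B"
  supply psi_pair_measurable[measurable]
  unfolding past_exp_def case_prod_beta
  by (rule W.integral_norm_bound_const(2)) auto

lemma bounded_borel_past_exp: "bounded_borel (past_exp a \<psi>)"
proof -
  note psi_pair_measurable[measurable]
  obtain B where "\<And>x. norm (\<psi> x) \<le> B" using bounded_borelE[OF bb] by blast
  moreover have "past_exp a \<psi> \<in> borel_measurable (borel \<Otimes>\<^sub>M borel)"
    unfolding past_exp_def by measurable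
  ultimately show ?thesis by (intro bounded_borelI norm_past_exp_le) (simp_all add: borel_prod)
qed

text \<open>
  Resampling twice, first from \<open>a\<close> on and then from \<open>b\<close> on, has the same effect as resampling once from \<open>a\<close> on, as
  the spliced sample is again distributed according to the product measure.
\<close>

lemma past_exp_tower:
  assumes "a \<le> b"
  shows "past_exp a (past_exp b \<psi>) = past_exp a \<psi>"
proof (rule ext, clarify)
  fix \<omega> \<theta>
  note psi_pair_measurable[measurable]
  obtain B where B: "\<And>x. norm (\<psi> x) \<le> B" using bounded_borelE[OF bb] by blast
  have "splice_at b (splice_at a \<omega> \<omega>') \<omega>'' = splice_at a \<omega> (splice_at b \<omega>' \<omega>'')" for \<omega>' \<omega>'' :: "int \<Rightarrow> 'd torus"
    using assms by (auto simp: splice_at_def fun_eq_iff)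
  then have "past_exp a (past_exp b \<psi>) (\<omega>, \<theta>)
     = (LINT \<omega>'|paths. LINT \<omega>''|paths. (\<lambda>x. \<psi> (splice_at a \<omega> x, \<theta>)) (splice_at b \<omega>' \<omega>''))"
    by (simp add: past_exp_def)
  also have "\<dots> = past_exp a \<psi> (\<omega>, \<theta>)"
    unfolding past_exp_def by (subst integral_splice[where B=B]) (auto simp: B)
  finally show "past_exp a (past_exp b \<psi>) (\<omega>, \<theta>) = past_exp a \<psi> (\<omega>, \<theta>)" .
qed

text \<open>
  The shift moves the boundary of the past by one. The condition \<open>a \<ge> 0\<close> puts \<open>\<omega> 0\<close>, by which the
  fibre is translated, into the past at time \<open>a + 1\<close>.
\<close>

lemma past_exp_comp_skew:
  assumes "a \<ge> 0"
  shows "past_exp (a + 1) (\<lambda>x. \<psi> (skew_product x)) = (\<lambda>x. past_exp a \<psi> (skew_product x))"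
proof (rule ext, clarify)
  fix \<omega> \<theta>
  note psi_pair_measurable[measurable]
  have s: "(\<lambda>n. splice_at (a + 1) \<omega> \<omega>' (n + 1)) = splice_at a (\<lambda>n. \<omega> (n + 1)) (\<lambda>n. \<omega>' (n + 1))"
    "splice_at (a + 1) \<omega> \<omega>' 0 = \<omega> 0" for \<omega>' :: "int \<Rightarrow> 'd torus"
    using assms by (auto simp: splice_at_def fun_eq_iff)
  have "past_exp (a + 1) (\<lambda>x. \<psi> (skew_product x)) (\<omega>, \<theta>)
     = (LINT \<omega>'|paths. (\<lambda>x. \<psi> (splice_at a (\<lambda>n. \<omega> (n + 1)) x, \<theta> + \<omega> 0)) (\<lambda>n. \<omega>' (n + 1)))"
    by (simp add: past_exp_def skew_product_def s)
  also have "\<dots> = past_exp a \<psi> (skew_product (\<omega>, \<theta>))"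
    unfolding past_exp_def by (subst integral_shift) (auto simp: skew_product_def)
  finally show "past_exp (a + 1) (\<lambda>x. \<psi> (skew_product x)) (\<omega>, \<theta>) = past_exp a \<psi> (skew_product (\<omega>, \<theta>))" .
qed

end

lemma past_past_exp: "past a (past_exp a \<psi>)"
proof -
  have s: "splice_at a \<omega> = splice_at a \<omega>'" if "\<forall>j<a. \<omega> j = \<omega>' j" for \<omega> \<omega>' :: "int \<Rightarrow> 'd torus"
    using that by (auto simp: splice_at_def fun_eq_iff)
  show ?thesis
    unfolding past_def
  proof (intro allI impI)
    fix \<omega> \<omega>' :: "int \<Rightarrow> 'd torus" and \<theta> :: "'d torus" assume "\<forall>j<a. \<omega> j = \<omega>' j"
    then show "past_exp a \<psi> (\<omega>, \<theta>) = past_exp a \<psi> (\<omega>', \<theta>)"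
      unfolding past_exp_def split by (simp only: s)
  qed
qed

lemma past_exp_past:
  assumes "past a \<psi>"
  shows "past_exp a \<psi> = \<psi>"
proof (rule ext, clarify)
  fix \<omega> \<theta>
  have "\<psi> (splice_at a \<omega> \<omega>', \<theta>) = \<psi> (\<omega>, \<theta>)" for \<omega>'
    by (rule pastD[OF assms]) (simp add: splice_at_def)
  then show "past_exp a \<psi> (\<omega>, \<theta>) = \<psi> (\<omega>, \<theta>)"
    using W.prob_space by (simp add: past_exp_def)
qed

lemma past_exp_mult:
  fixes A \<psi> :: "'d phase \<Rightarrow> 'b::{real_normed_field, banach, second_countable_topology}"
  assumes "past a A"
  shows "past_exp a (\<lambda>x. A x * \<psi> x) = (\<lambda>x. A x * past_exp a \<psi> x)"
proof (rule ext, clarify)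
  fix \<omega> \<theta>
  have "A (splice_at a \<omega> \<omega>', \<theta>) = A (\<omega>, \<theta>)" for \<omega>'
    by (rule pastD[OF assms]) (simp add: splice_at_def)
  then show "past_exp a (\<lambda>x. A x * \<psi> x) (\<omega>, \<theta>) = A (\<omega>, \<theta>) * past_exp a \<psi> (\<omega>, \<theta>)"
    by (simp add: past_exp_def)
qed

lemma past_exp_const: "past_exp a (\<lambda>x. c) = (\<lambda>x. c)"
  using W.prob_space by (simp add: past_exp_def fun_eq_iff)

lemma past_exp_add:
  assumes "bounded_borel \<psi>" "bounded_borel \<xi>"
  shows "past_exp a (\<lambda>x. \<psi> x + \<xi> x) = (\<lambda>x. past_exp a \<psi> x + past_exp a \<xi> x)"
  using past_exp_integrable[OF assms(1)] past_exp_integrable[OF assms(2)]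
  by (simp add: past_exp_def fun_eq_iff)

lemma past_exp_minus:
  assumes "bounded_borel \<psi>" "bounded_borel \<xi>"
  shows "past_exp a (\<lambda>x. \<psi> x - \<xi> x) = (\<lambda>x. past_exp a \<psi> x - past_exp a \<xi> x)"
  using past_exp_integrable[OF assms(1)] past_exp_integrable[OF assms(2)]
  by (simp add: past_exp_def fun_eq_iff)

lemma bounded_borel_skew_pow:
  fixes \<psi> :: "'d phase \<Rightarrow> 'b::{banach, second_countable_topology}"
  shows "bounded_borel \<psi> \<Longrightarrow> bounded_borel (\<lambda>x. \<psi> ((skew_product ^^ n) x))"
  by (rule bounded_borel_comp) measurable

lemma past_exp_comp_skew_pow:
  fixes \<psi> :: "'d phase \<Rightarrow> 'b::{banach, second_countable_topology}"
  assumes "bounded_borel \<psi>"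
  shows "past_exp (int n) (\<lambda>x. \<psi> ((skew_product ^^ n) x)) = (\<lambda>x. past_exp 0 \<psi> ((skew_product ^^ n) x))"
proof (induction n)
  case (Suc n)
  have "past_exp (int n + 1) (\<lambda>x. \<psi> ((skew_product ^^ n) (skew_product x))) =
        (\<lambda>x. past_exp (int n) (\<lambda>x. \<psi> ((skew_product ^^ n) x)) (skew_product x))"
    by (rule past_exp_comp_skew[OF bounded_borel_skew_pow[OF assms]]) simp
  then show ?case by (simp add: Suc funpow_Suc_right add.commute del: funpow.simps)
qed simp

text \<open>
  The Markov property of the process seen from time \<open>l\<close>: conditioning at time \<open>l\<close> first does not change the
  conditional expectation at time \<open>0\<close>.
\<close>

lemma past_exp_markov:
  fixes \<psi> :: "'d phase \<Rightarrow> 'b::{banach, second_countable_topology}"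
  assumes bb: "bounded_borel \<psi>"
  shows "past_exp 0 (\<lambda>x. past_exp 0 \<psi> ((skew_product ^^ l) x)) = past_exp 0 (\<lambda>x. \<psi> ((skew_product ^^ l) x))"
  using past_exp_tower[OF bounded_borel_skew_pow[OF bb], of 0 "int l" l]
  by (simp add: past_exp_comp_skew_pow[OF bb])

text \<open>
  For functions of the fibre coordinate only, conditional expectation of the future is the random walk on the
  torus.
\<close>

lemma past_exp_conv:
  fixes G :: "'d torus \<Rightarrow> 'b::{banach, second_countable_topology}"
  assumes G: "bounded_borel G"
  shows "past_exp 0 (\<lambda>x. G (snd ((skew_product ^^ l) x))) = (\<lambda>x. (conv \<mu> ^^ l) G (snd x))"
proof (induction l)
  case 0
  have "past_exp 0 (\<lambda>x. G (snd x)) = (\<lambda>x. G (snd x))"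
    by (rule past_exp_past) (simp add: past_def)
  then show ?case by simp
next
  case (Suc l)
  note m = borel_measurable_snd
  have bG: "bounded_borel (\<lambda>x :: 'd phase. G (snd x))"
    using bounded_borel_comp[OF G m] .
  note bl = bounded_borel_skew_pow[OF bG, of l]
  note [measurable] = bounded_borel_measurable[OF bounded_borel_conv_pow[OF G]]
  have "past_exp 0 (\<lambda>x. G (snd ((skew_product ^^ Suc l) x)))
      = past_exp 0 (\<lambda>x. past_exp 0 (\<lambda>x. G (snd ((skew_product ^^ l) x))) (skew_product x))"
    using past_exp_markov[OF bl, of 1] by (simp add: funpow_Suc_right del: funpow.simps(2))
  also have "\<dots> = past_exp 0 (\<lambda>x. (conv \<mu> ^^ l) G (snd (skew_product x)))"
    by (simp add: Suc)
  also have "\<dots> = (\<lambda>x. (conv \<mu> ^^ Suc l) G (snd x))"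
  proof (rule ext, clarify)
    fix \<omega> :: "int \<Rightarrow> 'd torus" and \<theta> :: "'d torus"
    have c: "(\<lambda>\<omega>. \<omega> 0) \<in> measurable paths \<mu>"
      using borel_measurable_coordinate[of "\<lambda>\<omega>. \<omega>" borel 0] by (simp add: measurable_cong_sets[OF sets_paths sets_mu])
    have "past_exp 0 (\<lambda>x. (conv \<mu> ^^ l) G (snd (skew_product x))) (\<omega>, \<theta>)
       = (LINT \<omega>'|paths. (conv \<mu> ^^ l) G (\<theta> + \<omega>' 0))"
      by (simp add: past_exp_def skew_product_def splice_at_def)
    also have "\<dots> = (LINT s|distr paths \<mu> (\<lambda>\<omega>. \<omega> 0). (conv \<mu> ^^ l) G (\<theta> + s))"
      by (rule integral_distr[OF c, symmetric]) measurable
    also have "\<dots> = (conv \<mu> ^^ Suc l) G (snd (\<omega>, \<theta>))"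
      by (simp add: distr_component conv_def)
    finally show "past_exp 0 (\<lambda>x. (conv \<mu> ^^ l) G (snd (skew_product x))) (\<omega>, \<theta>) = (conv \<mu> ^^ Suc l) G (snd (\<omega>, \<theta>))" .
  qed
  finally show ?case .
qed

abbreviation forecast where
  "forecast n \<psi> \<equiv> past_exp 0 (\<lambda>x. \<psi> ((skew_product ^^ n) x))"

sublocale H: prob_space "haar_torus :: 'd torus measure" by (rule prob_space_haar_torus)

sublocale WH: pair_prob_space paths "haar_torus :: 'd torus measure" ..

lemma skew_measure_eq: "skew_measure \<mu> = paths \<Otimes>\<^sub>M haar_torus"
  by (simp add: skew_measure_def paths_def)

sublocale S: prob_space "skew_measure \<mu>"
  unfolding skew_measure_eq by unfold_locales

lemma sets_skew [simp, measurable_cong]: "sets (skew_measure \<mu>) = sets borel"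
  by (rule sets_skew_measure[OF sets_mu])

lemma space_skew [simp]: "space (skew_measure \<mu>) = UNIV"
  using sets_eq_imp_space_eq[OF sets_skew] by simp

abbreviation nu ("\<nu>") where "\<nu> \<equiv> skew_measure \<mu>"

lemma integrable_skew:
  fixes \<psi> :: "'d phase \<Rightarrow> 'b::{banach, second_countable_topology}"
  assumes "bounded_borel \<psi>"
  shows "integrable (\<nu>) \<psi>"
proof -
  obtain B where B: "\<And>x. norm (\<psi> x) \<le> B" using bounded_borelE[OF assms] by blast
  show ?thesis
    using bounded_borel_measurable[OF assms] by (intro S.integral_norm_bound_const(1)[where B=B]) (auto simp: B cong: measurable_cong_sets)
qed

lemma integral_skew_eq:
  fixes \<psi> :: "'d phase \<Rightarrow> 'b::{banach, second_countable_topology}"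
  assumes "bounded_borel \<psi>"
  shows "(LINT x|\<nu>. \<psi> x) = (LINT \<theta>|haar_torus. LINT \<omega>|paths. \<psi> (\<omega>, \<theta>))"
    "(LINT x|\<nu>. \<psi> x) = (LINT \<omega>|paths. LINT \<theta>|haar_torus. \<psi> (\<omega>, \<theta>))"
proof -
  have i: "integrable (paths \<Otimes>\<^sub>M haar_torus) (\<lambda>(\<omega>, \<theta>). \<psi> (\<omega>, \<theta>))"
    using integrable_skew[OF assms] by (simp add: skew_measure_eq)
  show "(LINT x|\<nu>. \<psi> x) = (LINT \<theta>|haar_torus. LINT \<omega>|paths. \<psi> (\<omega>, \<theta>))"
    using WH.integral_snd[OF i] by (simp add: skew_measure_eq)
  show "(LINT x|\<nu>. \<psi> x) = (LINT \<omega>|paths. LINT \<theta>|haar_torus. \<psi> (\<omega>, \<theta>))"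
    using WH.integral_fst'[OF i] by (simp add: skew_measure_eq)
qed

lemma integral_comp_skew:
  fixes \<psi> :: "'d phase \<Rightarrow> 'b::{banach, second_countable_topology}"
  assumes bb: "bounded_borel \<psi>"
  shows "(LINT x|\<nu>. \<psi> (skew_product x)) = (LINT x|\<nu>. \<psi> x)"
proof -
  note psi_pair_measurable[OF bb, measurable]
  have "(LINT x|\<nu>. \<psi> (skew_product x))
     = (LINT \<omega>|paths. LINT \<theta>|haar_torus. \<psi> ((\<lambda>n. \<omega> (n + 1)), \<theta> + \<omega> 0))"
    by (subst integral_skew_eq(2)[OF bounded_borel_comp[OF bb skew_product_measurable]]) (auto simp: skew_product_def)
  also have "\<dots> = (LINT \<omega>|paths. LINT \<theta>|haar_torus. \<psi> ((\<lambda>n. \<omega> (n + 1)), \<theta>))"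
    by (subst integral_haar_torus_translate[of "\<lambda>\<theta>. \<psi> (_, \<theta>)"]) auto
  also have "\<dots> = (LINT \<omega>|paths. LINT \<theta>|haar_torus. \<psi> (\<omega>, \<theta>))"
    by (rule integral_shift[of "\<lambda>\<omega>. LINT \<theta>|haar_torus. \<psi> (\<omega>, \<theta>)" 1]) measurable
  also have "\<dots> = (LINT x|\<nu>. \<psi> x)"
    by (rule integral_skew_eq(2)[OF bb, symmetric])
  finally show ?thesis .
qed

lemma integral_comp_skew_pow:
  fixes \<psi> :: "'d phase \<Rightarrow> 'b::{banach, second_countable_topology}"
  assumes bb: "bounded_borel \<psi>"
  shows "(LINT x|\<nu>. \<psi> ((skew_product ^^ n) x)) = (LINT x|\<nu>. \<psi> x)"
proof (induction n)
  case (Suc n)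
  show ?case using integral_comp_skew[OF bounded_borel_skew_pow[OF bb, of n]] Suc
    by (simp add: funpow_Suc_right del: funpow.simps)
qed simp

lemma integral_past_exp:
  fixes \<psi> :: "'d phase \<Rightarrow> 'b::{banach, second_countable_topology}"
  assumes bb: "bounded_borel \<psi>"
  shows "(LINT x|\<nu>. past_exp a \<psi> x) = (LINT x|\<nu>. \<psi> x)"
proof -
  note psi_pair_measurable[OF bb, measurable]
  obtain B where B: "\<And>x. norm (\<psi> x) \<le> B" using bounded_borelE[OF bb] by blast
  have "(LINT \<omega>|paths. past_exp a \<psi> (\<omega>, \<theta>)) = (LINT \<omega>|paths. \<psi> (\<omega>, \<theta>))" for \<theta>
    unfolding past_exp_def by (simp, rule integral_splice[of "\<lambda>\<omega>. \<psi> (\<omega>, \<theta>)" B]) (auto simp: B)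
  then show ?thesis
    by (simp add: integral_skew_eq(1)[OF bounded_borel_past_exp[OF bb]] integral_skew_eq(1)[OF bb])
qed

text \<open>
  The mean of the observable at time \<open>k\<close> when the walk starts at \<open>\<theta>\<close> and the whole environment is random.
\<close>

definition fibre_mean :: "nat \<Rightarrow> ('d phase \<Rightarrow> real) \<Rightarrow> 'd torus \<Rightarrow> real" where
  "fibre_mean k \<psi> \<theta> = (LINT \<omega>|paths. \<psi> ((skew_product ^^ k) (\<omega>, \<theta>)))"

context
  fixes \<psi> :: "'d phase \<Rightarrow> real" and B :: real
  assumes bb: "bounded_borel \<psi>" and B: "\<And>x. \<bar>\<psi> x\<bar> \<le> B"
begin

lemma psi_pow_pair_measurable: "(\<lambda>x. \<psi> ((skew_product ^^ k) x)) \<in> borel_measurable (borel \<Otimes>\<^sub>M borel)"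
  by (rule psi_pair_measurable[OF bounded_borel_skew_pow[OF bb]])

lemma abs_fibre_mean_le: "\<bar>fibre_mean k \<psi> \<theta>\<bar> \<le> B"
  supply psi_pow_pair_measurable[measurable]
  using W.integral_norm_bound_const(2)[of "\<lambda>\<omega>. \<psi> ((skew_product ^^ k) (\<omega>, \<theta>))" B]
  by (simp add: fibre_mean_def B)

lemma fibre_integrable: "integrable paths (\<lambda>\<omega>. \<psi> ((skew_product ^^ k) (\<omega>, \<theta>)))"
  supply psi_pow_pair_measurable[measurable]
  by (rule W.integral_norm_bound_const(1)[where B=B]) (auto simp: B)

lemma bounded_borel_fibre_mean: "bounded_borel (fibre_mean k \<psi>)"
proof (rule bounded_borelI[where B=B])
  note psi_pow_pair_measurable[measurable]
  show "fibre_mean k \<psi> \<in> borel_measurable borel"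
    unfolding fibre_mean_def[abs_def] by measurable
qed (simp add: abs_fibre_mean_le)

lemma integral_fibre_mean: "(LINT \<theta>|haar_torus. fibre_mean k \<psi> \<theta>) = (LINT x|\<nu>. \<psi> x)"
  unfolding fibre_mean_def
  using integral_skew_eq(1)[OF bounded_borel_skew_pow[OF bb, of k]] integral_comp_skew_pow[OF bb, of k] by simp

lemma fibre_mean_modulus:
  assumes le: "\<And>\<omega> x y. \<bar>\<psi> (\<omega>, x) - \<psi> (\<omega>, y)\<bar> \<le> e (dist x y)"
  shows "\<bar>fibre_mean k \<psi> x - fibre_mean k \<psi> y\<bar> \<le> e (dist x y)"
proof -
  note psi_pow_pair_measurable[measurable]
  have "fibre_mean k \<psi> x - fibre_mean k \<psi> y
     = (LINT \<omega>|paths. \<psi> ((skew_product ^^ k) (\<omega>, x)) - \<psi> ((skew_product ^^ k) (\<omega>, y)))"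
    unfolding fibre_mean_def by (rule Bochner_Integration.integral_diff[OF fibre_integrable fibre_integrable, symmetric])
  also have "norm \<dots> \<le> e (dist x y)"
  proof (rule W.integral_norm_bound_const(2))
    fix \<omega>
    show "norm (\<psi> ((skew_product ^^ k) (\<omega>, x)) - \<psi> ((skew_product ^^ k) (\<omega>, y))) \<le> e (dist x y)"
      using le[of _ "x + (\<Sum>i<k. \<omega> (int i))" "y + (\<Sum>i<k. \<omega> (int i))"]
      by (simp add: skew_pow_formula dist_torus_add_right)
  qed measurable
  finally show ?thesis by simp
qed

text \<open>
  At time \<open>k\<close> the past of time \<open>0\<close> has moved to the coordinates before \<open>- k\<close>. An observable that hardly sees
  these coordinates does not notice whether they are given or random.
\<close>

lemma past_exp_fibre_mean:
  assumes le: "\<And>\<omega> \<omega>' \<theta>. (\<And>j. j \<ge> - int k \<Longrightarrow> \<omega> j = \<omega>' j) \<Longrightarrow> \<bar>\<psi> (\<omega>, \<theta>) - \<psi> (\<omega>', \<theta>)\<bar> \<le> e"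
  shows "\<bar>forecast k \<psi> x - fibre_mean k \<psi> (snd x)\<bar> \<le> e"
proof (cases x)
  case (Pair \<omega> \<theta>)
  note psi_pow_pair_measurable[measurable]
  have "forecast k \<psi> x - fibre_mean k \<psi> (snd x)
     = (LINT \<omega>'|paths. \<psi> ((skew_product ^^ k) (splice_at 0 \<omega> \<omega>', \<theta>)) - \<psi> ((skew_product ^^ k) (\<omega>', \<theta>)))"
    unfolding fibre_mean_def past_exp_def Pair split snd_conv
    by (rule Bochner_Integration.integral_diff[OF past_exp_integrable[OF bounded_borel_skew_pow[OF bb]] fibre_integrable, symmetric])
  also have "norm \<dots> \<le> e"
  proof (rule W.integral_norm_bound_const(2))
    fix \<omega>'
    have "(\<Sum>i<k. splice_at 0 \<omega> \<omega>' (int i)) = (\<Sum>i<k. \<omega>' (int i))" by (simp add: splice_at_def)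
    moreover have "splice_at 0 \<omega> \<omega>' (j + int k) = \<omega>' (j + int k)" if "j \<ge> - int k" for j
      using that by (simp add: splice_at_def)
    ultimately show "norm (\<psi> ((skew_product ^^ k) (splice_at 0 \<omega> \<omega>', \<theta>)) - \<psi> ((skew_product ^^ k) (\<omega>', \<theta>))) \<le> e"
      using le[of "\<lambda>j. splice_at 0 \<omega> \<omega>' (j + int k)" "\<lambda>j. \<omega>' (j + int k)"]
      by (simp add: skew_pow_formula)
  qed measurable
  finally show ?thesis by simp
qed

text \<open>
  The last \<open>k\<close> steps serve to forget the base coordinates: up to the error \<open>e\<close>, the observable at time \<open>k + l\<close> becomes
  a function of the fibre coordinate at time \<open>l\<close>. The first \<open>l\<close> steps equidistribute that coordinate.
\<close>

lemma past_exp_decay: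
  assumes base: "\<And>\<omega> \<omega>' \<theta>. (\<And>j. j \<ge> - int k \<Longrightarrow> j \<le> int k \<Longrightarrow> \<omega> j = \<omega>' j) \<Longrightarrow> \<bar>\<psi> (\<omega>, \<theta>) - \<psi> (\<omega>', \<theta>)\<bar> \<le> e"
    and fibre: "b \<ge> 0" "\<And>\<omega> x y. \<bar>\<psi> (\<omega>, x) - \<psi> (\<omega>, y)\<bar> \<le> a + b * (dist x y)\<^sup>2"
    and rho: "\<rho> \<ge> 0"
    and gap: "\<And>k. k \<noteq> 0 \<Longrightarrow> (\<And>i. \<bar>k $ i\<bar> \<le> int (CARD('d) * n)) \<Longrightarrow> cmod (fourier_coeff \<mu> k) \<le> \<rho>"
  shows "\<bar>forecast (k + l) \<psi> x - (LINT x|\<nu>. \<psi> x)\<bar>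
    \<le> e + (a + b * real CARD('d) / (2 * real n + 2) + B * (real n + 1) ^ CARD('d) * \<rho> ^ l)"
proof -
  define F where "F = forecast k \<psi>"
  define G where "G = fibre_mean k \<psi>"
  have bF: "bounded_borel F" unfolding F_def by (rule bounded_borel_past_exp[OF bounded_borel_skew_pow[OF bb]])
  have bG: "bounded_borel G" unfolding G_def by (rule bounded_borel_fibre_mean)
  have bGs: "bounded_borel (\<lambda>x :: 'd phase. G (snd x))"
    by (rule bounded_borel_comp[OF bG borel_measurable_snd])
  have FG: "\<bar>F x - G (snd x)\<bar> \<le> e" for x
    unfolding F_def G_def by (rule past_exp_fibre_mean) (rule base, blast)
  have eq: "forecast (k + l) \<psi> = forecast l F"
    unfolding F_def past_exp_markov[OF bounded_borel_skew_pow[OF bb]] by (simp add: funpow_add)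
  have "\<bar>forecast l F x - (conv \<mu> ^^ l) G (snd x)\<bar> \<le> e"
  proof -
    have "forecast l F x - (conv \<mu> ^^ l) G (snd x)
      = past_exp 0 (\<lambda>x. F ((skew_product ^^ l) x) - G (snd ((skew_product ^^ l) x))) x"
      using past_exp_minus[OF bounded_borel_skew_pow[OF bF, of l] bounded_borel_skew_pow[OF bGs, of l], of 0]
      by (simp add: past_exp_conv[OF bG])
    also have "norm \<dots> \<le> e"
      using FG by (intro norm_past_exp_le bounded_borel_minus bounded_borel_skew_pow[OF bF] bounded_borel_skew_pow[OF bGs]) auto
    finally show ?thesis by simp
  qed
  moreover have "\<bar>(conv \<mu> ^^ l) G (snd x) - (LINT y|haar_torus. G y)\<bar>
    \<le> a + b * real CARD('d) / (2 * real n + 2) + B * (real n + 1) ^ CARD('d) * \<rho> ^ l"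
    unfolding G_def
    by (rule conv_pow_equidistribution[OF bounded_borel_fibre_mean abs_fibre_mean_le fibre(1)
          fibre_mean_modulus[where e="\<lambda>d. a + b * d\<^sup>2", OF fibre(2)] rho gap])
  ultimately show ?thesis using integral_fibre_mean[of k] unfolding G_def eq by linarith
qed

end

end

section \<open>Uniformly continuous observables\<close>

definition osc_less :: "('d::finite phase \<Rightarrow> real) \<Rightarrow> real \<Rightarrow> nat \<Rightarrow> real \<Rightarrow> bool" where
  "osc_less \<psi> e k \<delta> \<longleftrightarrow> (\<forall>\<omega> \<omega>' \<theta> \<theta>'.
     (\<forall>j. \<bar>j\<bar> \<le> int k \<longrightarrow> \<omega> j = \<omega>' j) \<longrightarrow> dist \<theta> \<theta>' < \<delta> \<longrightarrow> \<bar>\<psi> (\<omega>, \<theta>) - \<psi> (\<omega>', \<theta>')\<bar> < e)"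

lemma osc_lessI:
  assumes "\<And>\<omega> \<omega>' \<theta> \<theta>'. \<forall>j. \<bar>j\<bar> \<le> int k \<longrightarrow> \<omega> j = \<omega>' j \<Longrightarrow> dist \<theta> \<theta>' < \<delta> \<Longrightarrow> \<bar>\<psi> (\<omega>, \<theta>) - \<psi> (\<omega>', \<theta>')\<bar> < e"
  shows "osc_less \<psi> e k \<delta>"
  using assms by (simp add: osc_less_def)

lemma osc_lessD:
  assumes "osc_less \<psi> e k \<delta>" "\<And>j. \<bar>j\<bar> \<le> int k \<Longrightarrow> \<omega> j = \<omega>' j" "dist \<theta> \<theta>' < \<delta>"
  shows "\<bar>\<psi> (\<omega>, \<theta>) - \<psi> (\<omega>', \<theta>')\<bar> < e"
  using assms by (simp add: osc_less_def)

text \<open>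
  Bounded Borel functions that are uniformly continuous for the product of \<^const>\<open>seq_dist\<close> and the metric of
  the torus. This class is closed under all operations of the martingale construction, and it is large enough to
  contain both Hoelder observables and the squares and limits that occur there.
\<close>

definition ucb :: "('d::finite phase \<Rightarrow> real) \<Rightarrow> bool" where
  "ucb \<psi> \<longleftrightarrow> bounded_borel \<psi> \<and> (\<forall>e>0. \<exists>k. \<exists>\<delta>>0. osc_less \<psi> e k \<delta>)"

lemma ucb_bounded_borel: "ucb \<psi> \<Longrightarrow> bounded_borel \<psi>"
  by (simp add: ucb_def)

lemma ucbE:
  assumes "ucb \<psi>" "e > 0"
  obtains k \<delta> where "\<delta> > 0" "osc_less \<psi> e k \<delta>"
  using assms unfolding ucb_def by blast

lemma ucbI:
  assumes "bounded_borel \<psi>" "\<And>e. e > 0 \<Longrightarrow> \<exists>k. \<exists>\<delta>>0. osc_less \<psi> e k \<delta>"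
  shows "ucb \<psi>"
  using assms by (simp add: ucb_def)

lemma ucb_combine:
  assumes F: "ucb F" and G: "ucb G" and bb: "bounded_borel (\<lambda>x. H (F x) (G x))" and L: "L > 0"
    and lip: "\<And>x y. \<bar>H (F x) (G x) - H (F y) (G y)\<bar> \<le> L * (\<bar>F x - F y\<bar> + \<bar>G x - G y\<bar>)"
  shows "ucb (\<lambda>x. H (F x) (G x))"
proof (rule ucbI[OF bb])
  fix e :: real assume "e > 0"
  then have e: "e / (2 * L) > 0" using L by simp
  obtain k1 d1 where 1: "d1 > 0" "osc_less (F) (e / (2 * L)) k1 d1"
    by (rule ucbE[OF F e])
  obtain k2 d2 where 2: "d2 > 0" "osc_less (G) (e / (2 * L)) k2 d2"
    by (rule ucbE[OF G e])
  show "\<exists>k. \<exists>\<delta>>0. osc_less (\<lambda>x. H (F x) (G x)) e k \<delta>"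
  proof (intro exI[of _ "max k1 k2"] exI[of _ "min d1 d2"] conjI osc_lessI)
    show "min d1 d2 > 0" using 1 2 by simp
    fix \<omega> \<omega>' :: "int \<Rightarrow> 'a torus" and \<theta> \<theta>' :: "'a torus"
    assume a: "\<forall>j. \<bar>j\<bar> \<le> int (max k1 k2) \<longrightarrow> \<omega> j = \<omega>' j" "dist \<theta> \<theta>' < min d1 d2"
    have "\<bar>F (\<omega>, \<theta>) - F (\<omega>', \<theta>')\<bar> < e / (2 * L)" by (rule osc_lessD[OF 1(2)]) (use a in auto)
    moreover have "\<bar>G (\<omega>, \<theta>) - G (\<omega>', \<theta>')\<bar> < e / (2 * L)" by (rule osc_lessD[OF 2(2)]) (use a in auto)
    ultimately have "L * (\<bar>F (\<omega>, \<theta>) - F (\<omega>', \<theta>')\<bar> + \<bar>G (\<omega>, \<theta>) - G (\<omega>', \<theta>')\<bar>) < L * (e / (2 * L) + e / (2 * L))"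
      using L by (intro mult_strict_left_mono add_strict_mono)
    also have "\<dots> = e" using L by (simp add: field_simps)
    finally show "\<bar>H (F (\<omega>, \<theta>)) (G (\<omega>, \<theta>)) - H (F (\<omega>', \<theta>')) (G (\<omega>', \<theta>'))\<bar> < e"
      using lip[of "(\<omega>, \<theta>)" "(\<omega>', \<theta>')"] by linarith
  qed
qed

lemma ucb_add: "ucb F \<Longrightarrow> ucb G \<Longrightarrow> ucb (\<lambda>x. F x + G x)"
  by (rule ucb_combine[where L=1]) (auto intro: bounded_borel_add ucb_bounded_borel)

lemma ucb_minus: "ucb F \<Longrightarrow> ucb G \<Longrightarrow> ucb (\<lambda>x. F x - G x)"
  by (rule ucb_combine[where L=1]) (auto intro: bounded_borel_minus ucb_bounded_borel)

lemma ucb_power2: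
  assumes F: "ucb F"
  shows "ucb (\<lambda>x. (F x)\<^sup>2)"
proof -
  obtain B where B: "B \<ge> 0" "\<And>x. \<bar>F x\<bar> \<le> B"
    using bounded_borelE[OF ucb_bounded_borel[OF F]] by auto
  note [measurable] = bounded_borel_measurable[OF ucb_bounded_borel[OF F]]
  show ?thesis
  proof (rule ucb_combine[where H="\<lambda>u v. u\<^sup>2" and L="2 * B + 1", OF F F])
    show "bounded_borel (\<lambda>x. (F x)\<^sup>2)"
      by (rule bounded_borelI[where B="B\<^sup>2"]) (auto simp: power2_le_iff_abs_le B)
    show "2 * B + 1 > 0" using B by simp
    fix x y
    have "\<bar>(F x)\<^sup>2 - (F y)\<^sup>2\<bar> = \<bar>F x + F y\<bar> * \<bar>F x - F y\<bar>"
      by (simp add: abs_mult[symmetric] power2_eq_square algebra_simps)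
    also have "\<dots> \<le> (2 * B + 1) * (\<bar>F x - F y\<bar> + \<bar>F x - F y\<bar>)"
      using B(1) B(2)[of x] B(2)[of y] by (intro mult_mono) auto
    finally show "\<bar>(F x)\<^sup>2 - (F y)\<^sup>2\<bar> \<le> (2 * B + 1) * (\<bar>F x - F y\<bar> + \<bar>F x - F y\<bar>)" .
  qed
qed

lemma ucb_zero: "ucb (\<lambda>x. 0)"
  by (rule ucbI) (auto intro!: bounded_borelI exI[of _ 1] simp: osc_less_def)

lemma ucb_sum: "(\<And>i. i < n \<Longrightarrow> ucb (F i)) \<Longrightarrow> ucb (\<lambda>x. \<Sum>i<(n::nat). F i x)"
  by (induction n) (auto intro: ucb_zero ucb_add)

lemma dist_torus_diff_right: "dist (x - z) (y - z) = dist x (y :: 'd::finite torus)"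
  using dist_torus_add_right[of "x - z" z "y - z"] by simp

lemma ucb_comp:
  fixes F :: "'d::finite phase \<Rightarrow> real" and T :: "'d phase \<Rightarrow> 'd phase"
  assumes F: "ucb F" and T: "T \<in> borel_measurable borel"
    and base: "\<And>\<omega> \<omega>' \<theta> \<theta>' k j. \<forall>j. \<bar>j\<bar> \<le> int (Suc k) \<longrightarrow> \<omega> j = \<omega>' j \<Longrightarrow> \<bar>j\<bar> \<le> int k \<Longrightarrow>
      fst (T (\<omega>, \<theta>)) j = fst (T (\<omega>', \<theta>')) j"
    and fibre: "\<And>\<omega> \<omega>' \<theta> \<theta>'. \<forall>j. \<bar>j\<bar> \<le> 1 \<longrightarrow> \<omega> j = \<omega>' j \<Longrightarrow>
      dist (snd (T (\<omega>, \<theta>))) (snd (T (\<omega>', \<theta>'))) = dist \<theta> \<theta>'"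
  shows "ucb (\<lambda>x. F (T x))"
proof (rule ucbI)
  show "bounded_borel (\<lambda>x. F (T x))"
    by (rule bounded_borel_comp[OF ucb_bounded_borel[OF F] T])
  fix e :: real assume "e > 0"
  obtain k d where 1: "d > 0" "osc_less F e k d"
    by (rule ucbE[OF F \<open>e > 0\<close>])
  show "\<exists>k. \<exists>\<delta>>0. osc_less (\<lambda>x. F (T x)) e k \<delta>"
  proof (intro exI[of _ "Suc k"] exI[of _ d] conjI osc_lessI)
    fix \<omega> \<omega>' :: "int \<Rightarrow> 'd torus" and \<theta> \<theta>' :: "'d torus"
    assume a: "\<forall>j. \<bar>j\<bar> \<le> int (Suc k) \<longrightarrow> \<omega> j = \<omega>' j" "dist \<theta> \<theta>' < d"
    have "\<bar>F (fst (T (\<omega>, \<theta>)), snd (T (\<omega>, \<theta>))) - F (fst (T (\<omega>', \<theta>')), snd (T (\<omega>', \<theta>')))\<bar> < e"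
    proof (rule osc_lessD[OF 1(2) base[OF a(1)]])
      show "dist (snd (T (\<omega>, \<theta>))) (snd (T (\<omega>', \<theta>'))) < d"
        using a fibre[of \<omega> \<omega>' \<theta> \<theta>'] by simp
    qed
    then show "\<bar>F (T (\<omega>, \<theta>)) - F (T (\<omega>', \<theta>'))\<bar> < e" by simp
  qed (rule 1)
qed

lemma ucb_comp_skew: "ucb F \<Longrightarrow> ucb (\<lambda>x. F (skew_product x))"
  by (rule ucb_comp[OF _ skew_product_measurable]) (auto simp: skew_product_def dist_torus_add_right)

lemma ucb_comp_skew_inv: "ucb F \<Longrightarrow> ucb (\<lambda>x. F (skew_inv x))"
  by (rule ucb_comp[OF _ skew_inv_measurable]) (auto simp: skew_inv_def dist_torus_diff_right)

lemma ucb_comp_skew_pow: "ucb F \<Longrightarrow> ucb (\<lambda>x. F ((skew_product ^^ n) x))"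
proof (induction n)
  case (Suc n)
  then show ?case using ucb_comp_skew[of "\<lambda>x. F ((skew_product ^^ n) x)"] 
    by (simp add: funpow_Suc_right del: funpow.simps)
qed simp

lemma ucb_comp_skew_inv_pow: "ucb F \<Longrightarrow> ucb (\<lambda>x. F ((skew_inv ^^ n) x))"
proof (induction n)
  case (Suc n)
  then show ?case using ucb_comp_skew_inv[of "\<lambda>x. F ((skew_inv ^^ n) x)"] 
    by (simp add: funpow_Suc_right del: funpow.simps)
qed simp

lemma ucb_uniform_limit:
  assumes F: "\<And>n. ucb (F n)" and lim: "uniform_limit UNIV F G sequentially"
  shows "ucb G"
proof (rule ucbI)
  have close: "\<exists>n. \<forall>x. \<bar>F n x - G x\<bar> < e" if "e > 0" for e
    using uniform_limitD[OF lim that] by (auto simp: dist_real_def eventually_sequentially)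
  show "bounded_borel G"
  proof -
    obtain n where n: "\<And>x. \<bar>F n x - G x\<bar> < 1" using close[of 1] by auto
    obtain B where B: "\<And>x. norm (F n x) \<le> B" using bounded_borelE[OF ucb_bounded_borel[OF F[of n]]] by blast
    show ?thesis
    proof (rule bounded_borelI[where B="B + 1"])
      show "G \<in> borel_measurable borel"
        by (rule borel_measurable_LIMSEQ_metric[where f=F, OF bounded_borel_measurable[OF ucb_bounded_borel[OF F]]])
          (rule tendsto_uniform_limitI[OF lim UNIV_I])
      show "norm (G x) \<le> B + 1" for x using n[of x] B[of x] by auto
    qed
  qed
  fix e :: real assume "e > 0"
  then have "e / 3 > 0" by simp
  obtain n where n: "\<And>x. \<bar>F n x - G x\<bar> < e / 3" using close[OF \<open>e / 3 > 0\<close>] by auto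
  obtain k d where 1: "d > 0" "osc_less (F n) (e / 3) k d"
    by (rule ucbE[OF F[of n] \<open>e / 3 > 0\<close>])
  show "\<exists>k. \<exists>\<delta>>0. osc_less G e k \<delta>"
  proof (intro exI[of _ k] exI[of _ d] conjI osc_lessI)
    fix \<omega> \<omega>' :: "int \<Rightarrow> 'a torus" and \<theta> \<theta>' :: "'a torus"
    assume a: "\<forall>j. \<bar>j\<bar> \<le> int k \<longrightarrow> \<omega> j = \<omega>' j" "dist \<theta> \<theta>' < d"
    then have "\<bar>F n (\<omega>, \<theta>) - F n (\<omega>', \<theta>')\<bar> < e / 3" by (intro osc_lessD[OF 1(2)]) auto
    with n[of "(\<omega>, \<theta>)"] n[of "(\<omega>', \<theta>')"] show "\<bar>G (\<omega>, \<theta>) - G (\<omega>', \<theta>')\<bar> < e" by linarith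
  qed (rule 1)
qed

lemma ucb_suminf:
  assumes "\<And>n. ucb (u n)" "\<And>n x. \<bar>u n x\<bar> \<le> r n" "summable r"
  shows "ucb (\<lambda>x. \<Sum>n. u n x)"
  by (rule ucb_uniform_limit[OF ucb_sum Weierstrass_m_test]) (use assms in auto)

text \<open>
  Agreement of the coordinates in \<open>[- k, k]\<close> is the same as \<open>seq_dist < (1 / 2) ^ k\<close>.
\<close>

lemma ucb_continuous_map:
  assumes F: "ucb F"
  shows "continuous_map (Metric_space.mtopology UNIV (prod_dist seq_dist dist)) euclideanreal F"
proof -
  interpret M12: Metric_space12 UNIV seq_dist UNIV "dist :: 'a torus \<Rightarrow> _"
    by (intro Metric_space12.intro Metric_space_seq_dist Met_TC.Metric_space_axioms)
  have "continuous_map M12.Prod_metric.mtopology (Metric_space.mtopology UNIV (dist :: real \<Rightarrow> _)) F"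
    unfolding Metric_space.metric_continuous_map[OF M12.Prod_metric.Metric_space_axioms Met_TC.Metric_space_axioms]
  proof (intro conjI ballI allI impI)
    fix x :: "'a phase" and e :: real assume "e > 0"
    obtain \<omega> \<theta> where x: "x = (\<omega>, \<theta>)" by (cases x)
    obtain k d where 1: "d > 0" "osc_less (F) (e) k d"
      by (rule ucbE[OF F \<open>e > 0\<close>])
    show "\<exists>\<delta>>0. \<forall>y. y \<in> UNIV \<times> UNIV \<and> prod_dist seq_dist dist x y < \<delta> \<longrightarrow> dist (F x) (F y) < e"
    proof (intro exI[of _ "min d ((1/2) ^ k)"] conjI allI impI)
      fix y assume y: "y \<in> UNIV \<times> UNIV \<and> prod_dist seq_dist dist x y < min d ((1/2) ^ k)"
      obtain \<omega>' \<theta>' where y': "y = (\<omega>', \<theta>')" by (cases y)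
      have "seq_dist \<omega> \<omega>' \<le> prod_dist seq_dist dist x y" "dist \<theta> \<theta>' \<le> prod_dist seq_dist dist x y"
        unfolding x y' by (rule M12.component_le_prod_metric)+
      then have "seq_dist \<omega> \<omega>' < (1/2) ^ k" "dist \<theta> \<theta>' < d" using y by auto
      then show "dist (F x) (F y) < e"
        unfolding seq_dist_less_iff x y' dist_real_def by (intro osc_lessD[OF 1(2)]) auto
    qed (use 1 in auto)
  qed auto
  then show ?thesis by simp
qed

lemma (in torus_prob) ucb_past_exp:
  assumes F: "ucb F"
  shows "ucb (past_exp a F)"
proof (rule ucbI)
  note bb = ucb_bounded_borel[OF F]
  show "bounded_borel (past_exp a F)" by (rule bounded_borel_past_exp[OF bb])
  note psi_pair_measurable[OF bb, measurable]
  fix e :: real assume "e > 0"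
  then have "e / 2 > 0" by simp
  obtain k d where 1: "d > 0" "osc_less (F) (e / 2) k d"
    by (rule ucbE[OF F \<open>e / 2 > 0\<close>])
  show "\<exists>k. \<exists>\<delta>>0. osc_less (past_exp a F) e k \<delta>"
  proof (intro exI[of _ k] exI[of _ d] conjI osc_lessI)
    fix \<omega> \<omega>' :: "int \<Rightarrow> 'd torus" and \<theta> \<theta>' :: "'d torus"
    assume a: "\<forall>j. \<bar>j\<bar> \<le> int k \<longrightarrow> \<omega> j = \<omega>' j" "dist \<theta> \<theta>' < d"
    have "past_exp a F (\<omega>, \<theta>) - past_exp a F (\<omega>', \<theta>')
       = (LINT \<xi>|paths. F (splice_at a \<omega> \<xi>, \<theta>) - F (splice_at a \<omega>' \<xi>, \<theta>'))"
      unfolding past_exp_def split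
      by (rule Bochner_Integration.integral_diff[OF past_exp_integrable[OF bb] past_exp_integrable[OF bb], symmetric])
    also have "norm \<dots> \<le> e / 2"
    proof (rule W.integral_norm_bound_const(2))
      fix \<xi>
      have "\<bar>F (splice_at a \<omega> \<xi>, \<theta>) - F (splice_at a \<omega>' \<xi>, \<theta>')\<bar> < e / 2"
        using a by (intro osc_lessD[OF 1(2)]) (auto simp: splice_at_def)
      then show "norm (F (splice_at a \<omega> \<xi>, \<theta>) - F (splice_at a \<omega>' \<xi>, \<theta>')) \<le> e / 2" by simp
    qed measurable
    finally show "\<bar>past_exp a F (\<omega>, \<theta>) - past_exp a F (\<omega>', \<theta>')\<bar> < e" using \<open>e > 0\<close> by simp
  qed (rule 1)
qed

section \<open>Rates of mixing\<close>

lemma is_norm_nonneg: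
  assumes "is_norm N"
  shows "N x \<ge> 0"
proof -
  have scale: "N (c *\<^sub>R y) = \<bar>c\<bar> * N y" and zero: "N 0 = 0" and tri: "N (y + z) \<le> N y + N z" for c y z
    using assms unfolding is_norm_def by blast+
  have "N (- x) = N x" using scale[of "-1" x] by simp
  then show ?thesis using tri[of x "- x"] zero by simp
qed

lemma is_norm_le_sum:
  fixes x :: "real^'d::finite"
  assumes N: "is_norm N"
  shows "N x \<le> (\<Sum>i\<in>UNIV. \<bar>x $ i\<bar> * N (axis i 1))"
proof -
  have "N (\<Sum>i\<in>I. f i) \<le> (\<Sum>i\<in>I. N (f i))" if "finite I" for I and f :: "'d \<Rightarrow> real^'d"
    using that
  proof (induction I rule: finite_induct)
    case empty
    have "N 0 = 0" using N unfolding is_norm_def by blast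
    then show ?case by simp
  next
    case (insert i I)
    have "N (f i + (\<Sum>i\<in>I. f i)) \<le> N (f i) + N (\<Sum>i\<in>I. f i)" using N by (simp add: is_norm_def)
    with insert show ?case by simp
  qed
  from this[of UNIV "\<lambda>i. (x $ i) *\<^sub>R axis i 1"] show ?thesis
    using N basis_expansion[of x] by (simp add: is_norm_def scalar_mult_eq_scaleR)
qed

text \<open>
  Every norm is bounded by a multiple of the maximum norm, so the Diophantine condition can be stated for the latter
  at the price of a smaller constant.
\<close>

lemma mixing_diophantine_gap:
  fixes \<mu> :: "'d::finite torus measure"
  assumes N: "is_norm N" and "\<gamma> > 0" "\<tau> > 0" and md: "mixing_diophantine N \<gamma> \<tau> \<mu>"
  obtains g where "g > 0"
    "\<And>R k. k \<noteq> 0 \<Longrightarrow> (\<And>i. \<bar>k $ i\<bar> \<le> int R) \<Longrightarrow> cmod (fourier_coeff \<mu> k) \<le> 1 - g / real R powr \<tau>"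
proof -
  define C where "C = (\<Sum>i\<in>UNIV. N (axis i 1 :: real^'d))"
  have C: "C > 0"
  proof -
    have "N (axis i 1 :: real^'d) > 0" for i
      using N is_norm_nonneg[OF N, of "axis i 1"] by (auto simp: is_norm_def less_le axis_eq_0_iff)
    then show ?thesis unfolding C_def by (intro sum_pos) auto
  qed
  show ?thesis
  proof (rule that[of "\<gamma> / C powr \<tau>"])
    show "\<gamma> / C powr \<tau> > 0" using \<open>\<gamma> > 0\<close> C by simp
    fix R :: nat and k :: "int^'d" assume k: "k \<noteq> 0" "\<And>i. \<bar>k $ i\<bar> \<le> int R"
    let ?k = "\<chi> i. real_of_int (k $ i) :: real^'d"
    have "?k \<noteq> 0" using k(1) by (auto simp: vec_eq_iff)
    then have pos: "N ?k > 0"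
      using N is_norm_nonneg[OF N, of ?k] by (auto simp: is_norm_def less_le)
    have "N ?k \<le> (\<Sum>i\<in>UNIV. \<bar>?k $ i\<bar> * N (axis i 1))" by (rule is_norm_le_sum[OF N])
    also have "\<dots> \<le> (\<Sum>i\<in>UNIV. real R * N (axis i 1 :: real^'d))"
    proof (rule sum_mono, rule mult_right_mono)
      show "\<bar>?k $ i\<bar> \<le> real R" for i
        using k(2)[of i] by simp
    qed (rule is_norm_nonneg[OF N])
    also have "\<dots> = C * real R" by (simp add: C_def sum_distrib_left mult.commute)
    finally have le: "N ?k \<le> C * real R" .
    have R: "real R > 0" using le pos C by (smt (verit) mult_nonneg_nonpos)
    have "\<gamma> / C powr \<tau> / real R powr \<tau> = \<gamma> / (C * real R) powr \<tau>"
      using C by (simp add: powr_mult)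
    also have "\<dots> \<le> \<gamma> / N ?k powr \<tau>"
      using le pos C R \<open>\<gamma> > 0\<close> \<open>\<tau> > 0\<close> by (intro divide_left_mono powr_mono2 mult_pos_pos) auto
    finally show "cmod (fourier_coeff \<mu> k) \<le> 1 - \<gamma> / C powr \<tau> / real R powr \<tau>"
      using md k(1) unfolding mixing_diophantine_def by fastforce
  qed
qed

definition holder_bound :: "real \<Rightarrow> real \<Rightarrow> ('d::finite phase \<Rightarrow> real) \<Rightarrow> bool" where
  "holder_bound \<alpha> v \<phi> \<longleftrightarrow> v \<ge> 0 \<and> bounded_borel \<phi> \<and>
     (\<forall>\<omega> \<omega>' \<theta>. \<bar>\<phi> (\<omega>, \<theta>) - \<phi> (\<omega>', \<theta>)\<bar> \<le> v * seq_dist \<omega> \<omega>' powr \<alpha>) \<and>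
     (\<forall>\<omega> \<theta> \<theta>'. \<bar>\<phi> (\<omega>, \<theta>) - \<phi> (\<omega>, \<theta>')\<bar> \<le> v * dist \<theta> \<theta>' powr \<alpha>)"

lemma holder_boundD:
  assumes "holder_bound \<alpha> v \<phi>"
  shows "v \<ge> 0" "bounded_borel \<phi>"
    "\<bar>\<phi> (\<omega>, \<theta>) - \<phi> (\<omega>', \<theta>)\<bar> \<le> v * seq_dist \<omega> \<omega>' powr \<alpha>"
    "\<bar>\<phi> (\<omega>, \<theta>) - \<phi> (\<omega>, \<theta>')\<bar> \<le> v * dist \<theta> \<theta>' powr \<alpha>"
  using assms by (simp_all add: holder_bound_def)

lemma holder_space_bound:
  fixes \<phi> :: "'d::finite phase \<Rightarrow> real"
  assumes "\<phi> \<in> holder_space \<alpha>"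
  shows "\<exists>v. holder_bound \<alpha> v \<phi>"
proof -
  have fin: "holder_base \<alpha> \<phi> < \<infinity>" "holder_fibre \<alpha> \<phi> < \<infinity>" and bb: "bounded_borel \<phi>"
    using assms by (auto simp: holder_space_def bounded_borel_def)
  define v where "v = max (enn2real (holder_base \<alpha> \<phi>)) (enn2real (holder_fibre \<alpha> \<phi>))"
  have v0: "v \<ge> 0" by (simp add: v_def le_max_iff_disj)
  have vb: "holder_base \<alpha> \<phi> \<le> ennreal v" "holder_fibre \<alpha> \<phi> \<le> ennreal v"
    using fin ennreal_leI[of "enn2real (holder_base \<alpha> \<phi>)" v] ennreal_leI[of "enn2real (holder_fibre \<alpha> \<phi>)" v]
    by (simp_all add: v_def)
  have "holder_bound \<alpha> v \<phi>"
    unfolding holder_bound_def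
  proof (intro conjI allI v0 bb)
    fix \<omega> \<omega>' :: "int \<Rightarrow> 'd torus" and \<theta> \<theta>' :: "'d torus"
    show "\<bar>\<phi> (\<omega>, \<theta>) - \<phi> (\<omega>', \<theta>)\<bar> \<le> v * seq_dist \<omega> \<omega>' powr \<alpha>"
    proof (cases "\<omega> = \<omega>'")
      case False
      then have pos: "seq_dist \<omega> \<omega>' > 0" by (simp add: seq_dist_def)
      have "ennreal (\<bar>\<phi> (\<omega>, \<theta>) - \<phi> (\<omega>', \<theta>)\<bar> / seq_dist \<omega> \<omega>' powr \<alpha>) \<le> holder_base \<alpha> \<phi>"
        unfolding holder_base_def using False by (intro SUP_upper2[of \<theta>] SUP_upper2[of "(\<omega>, \<omega>')"]) auto
      also note vb(1)
      finally show ?thesis using v0 pos by (simp add: ennreal_le_iff divide_le_eq)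
    qed (use v0 in simp)
    show "\<bar>\<phi> (\<omega>, \<theta>) - \<phi> (\<omega>, \<theta>')\<bar> \<le> v * dist \<theta> \<theta>' powr \<alpha>"
    proof (cases "\<theta> = \<theta>'")
      case False
      then have pos: "dist \<theta> \<theta>' > 0" by simp
      have "ennreal (\<bar>\<phi> (\<omega>, \<theta>) - \<phi> (\<omega>, \<theta>')\<bar> / dist \<theta> \<theta>' powr \<alpha>) \<le> holder_fibre \<alpha> \<phi>"
        unfolding holder_fibre_def using False by (intro SUP_upper2[of \<omega>] SUP_upper2[of "(\<theta>, \<theta>')"]) auto
      also note vb(2)
      finally show ?thesis using v0 pos by (simp add: ennreal_le_iff divide_le_eq)
    qed (use v0 in simp)
  qed
  then show ?thesis ..
qed

lemma seq_dist_le: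
  assumes "\<And>j. \<bar>j\<bar> \<le> int k \<Longrightarrow> \<omega> j = \<omega>' j"
  shows "seq_dist \<omega> \<omega>' \<le> (1 / 2) ^ k"
proof -
  have "seq_dist \<omega> \<omega>' < (1 / 2) ^ k" unfolding seq_dist_less_iff using assms by auto
  then show ?thesis by simp
qed

lemma holder_agree_bound:
  fixes \<phi> :: "'d::finite phase \<Rightarrow> real"
  assumes hb: "holder_bound \<alpha> v \<phi>" and "\<alpha> > 0"
    and agree: "\<And>j. \<bar>j\<bar> \<le> int k \<Longrightarrow> \<omega> j = \<omega>' j"
  shows "\<bar>\<phi> (\<omega>, \<theta>) - \<phi> (\<omega>', \<theta>)\<bar> \<le> v * ((1/2) powr \<alpha>) ^ k"
proof -
  have "seq_dist \<omega> \<omega>' powr \<alpha> \<le> ((1/2) ^ k) powr \<alpha>"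
    using \<open>\<alpha> > 0\<close> seq_dist_le[OF agree] by (intro powr_mono2) (auto simp: seq_dist_def)
  also have "((1/2::real) ^ k) powr \<alpha> = ((1/2) powr \<alpha>) ^ k"
    by (simp add: powr_realpow[symmetric] powr_powr mult.commute)
  finally show ?thesis
    using holder_boundD(3)[OF hb, of \<omega> \<theta> \<omega>'] mult_left_mono[OF _ holder_boundD(1)[OF hb]] by (meson order_trans)
qed

text \<open>
  The constants \<open>k\<close> and \<open>\<delta>\<close> are chosen such that the base and the fibre each contribute at most half of \<open>e\<close>.
\<close>

lemma ucb_holder:
  fixes \<phi> :: "'d::finite phase \<Rightarrow> real"
  assumes hb: "holder_bound \<alpha> v \<phi>" and \<alpha>: "\<alpha> > 0"
  shows "ucb \<phi>"
proof (rule ucbI[OF holder_boundD(2)[OF hb]])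
  note v = holder_boundD(1)[OF hb]
  fix e :: real assume e: "e > 0"
  have "(1/2::real) powr \<alpha> < 1" using powr_less_mono2[of \<alpha> "1/2" 1] \<alpha> by simp
  then have "(\<lambda>k. v * ((1/2) powr \<alpha>) ^ k) \<longlonglongrightarrow> v * 0"
    by (intro tendsto_mult tendsto_const LIMSEQ_realpow_zero) auto
  then have "\<forall>\<^sub>F k in sequentially. v * ((1/2) powr \<alpha>) ^ k < e / 2"
    by (rule order_tendstoD(2)) (use e in simp)
  then obtain k where k: "v * ((1/2) powr \<alpha>) ^ k < e / 2" by (auto simp: eventually_sequentially)
  define \<delta> where "\<delta> = (e / (2 * (v + 1))) powr (1 / \<alpha>)"
  have \<delta>: "\<delta> > 0" using e v by (simp add: \<delta>_def)
  have \<delta>2: "v * \<delta> powr \<alpha> \<le> e / 2"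
  proof -
    have "\<delta> powr \<alpha> = e / (2 * (v + 1))" using e v \<alpha> by (simp add: \<delta>_def powr_powr)
    moreover have "v * (e / (2 * (v + 1))) \<le> e / 2" using e v by (simp add: field_simps)
    ultimately show ?thesis by simp
  qed
  show "\<exists>k. \<exists>\<delta>>0. osc_less \<phi> e k \<delta>"
  proof (intro exI conjI osc_lessI)
    show "\<delta> > 0" by (rule \<delta>)
    fix \<omega> \<omega>' :: "int \<Rightarrow> 'd torus" and \<theta> \<theta>' :: "'d torus"
    assume a: "\<forall>j. \<bar>j\<bar> \<le> int k \<longrightarrow> \<omega> j = \<omega>' j" "dist \<theta> \<theta>' < \<delta>"
    have "\<bar>\<phi> (\<omega>, \<theta>) - \<phi> (\<omega>', \<theta>)\<bar> \<le> v * ((1/2) powr \<alpha>) ^ k"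
      by (rule holder_agree_bound[OF hb \<alpha>]) (use a in auto)
    moreover have "v * dist \<theta> \<theta>' powr \<alpha> \<le> v * \<delta> powr \<alpha>"
      using a \<alpha> v by (intro mult_left_mono powr_mono2) auto
    ultimately show "\<bar>\<phi> (\<omega>, \<theta>) - \<phi> (\<omega>', \<theta>')\<bar> < e"
      using holder_boundD(4)[OF hb, of \<omega>' \<theta> \<theta>'] k \<delta>2 by linarith
  qed
qed

text \<open>
  This turns a Hoelder modulus into one of the form required in \<open>conv_pow_equidistribution\<close>, at a scale \<open>\<delta>\<close> that
  can be chosen freely: below the scale the first summand dominates, above it the second.
\<close>

lemma powr_le_quadratic:
  fixes t \<delta> :: real
  assumes "t \<ge> 0" "\<delta> > 0" "0 < \<alpha>" "\<alpha> \<le> 2"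
  shows "t powr \<alpha> \<le> \<delta> powr \<alpha> + \<delta> powr (\<alpha> - 2) * t\<^sup>2"
proof (cases "t \<le> \<delta>")
  case True
  then have "t powr \<alpha> \<le> \<delta> powr \<alpha>" using assms by (intro powr_mono2) auto
  then show ?thesis by (simp add: add_increasing2)
next
  case False
  then have t: "t > 0" using assms by simp
  have "t powr \<alpha> = t powr (\<alpha> - 2) * t powr 2" by (subst powr_add[symmetric]) simp
  also have "\<dots> = t powr (\<alpha> - 2) * t\<^sup>2" using t by (simp add: powr_numeral)
  also have "\<dots> \<le> \<delta> powr (\<alpha> - 2) * t\<^sup>2"
    using False assms by (intro mult_right_mono powr_mono2') auto
  finally show ?thesis by (simp add: add_increasing)
qed

lemma summable_half:
  fixes t :: "nat \<Rightarrow> real"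
  assumes "summable t" "\<And>n. t n \<ge> 0"
  shows "summable (\<lambda>n. t (n div 2))"
proof (rule summableI_nonneg_bounded)
  show "0 \<le> t (n div 2)" for n by (rule assms(2))
  have two: "(\<Sum>i<2 * n. t (i div 2)) = 2 * (\<Sum>i<n. t i)" for n
    by (induction n) (simp_all add: algebra_simps)
  fix n
  have "(\<Sum>i<n. t (i div 2)) \<le> (\<Sum>i<2 * n. t (i div 2))"
    using assms(2) by (intro sum_mono2) auto
  also have "\<dots> \<le> 2 * suminf t"
    unfolding two using sum_le_suminf[OF assms(1), of "{..<n}"] assms(2) by simp
  finally show "(\<Sum>i<n. t (i div 2)) \<le> 2 * suminf t" .
qed

lemma summable_powr_exp:
  fixes a c p :: real
  assumes "c > 0" "p > 0"
  shows "summable (\<lambda>k::nat. real k powr a * exp (- c * real k powr p))"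
proof (rule summable_comparison_test_ev)
  have "(\<lambda>k::nat. real k powr (a + 2) * exp (- c * real k powr p)) \<longlonglongrightarrow> 0"
    using assms by real_asymp
  then have "\<forall>\<^sub>F k in sequentially. real k powr (a + 2) * exp (- c * real k powr p) < 1"
    by (rule order_tendstoD(2)) simp
  then show "\<forall>\<^sub>F k in sequentially. norm (real k powr a * exp (- c * real k powr p)) \<le> real k powr (- 2)"
    using eventually_gt_at_top[of 0]
  proof eventually_elim
    case (elim k)
    then have "real k powr (-2) * (real k powr (a + 2) * exp (- c * real k powr p)) \<le> real k powr (-2) * 1"
      by (intro mult_left_mono) auto
    moreover have "real k powr (-2) * real k powr (a + 2) = real k powr a"
      by (simp add: powr_add[symmetric])
    ultimately show ?case by (simp add: abs_mult mult.assoc[symmetric])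
  qed
  show "summable (\<lambda>k::nat. real k powr (- 2))" by (simp add: summable_real_powr_iff)
qed

locale diophantine_prob = torus_prob \<mu> for \<mu> :: "'d::finite torus measure" +
  fixes g \<tau> :: real
  assumes g: "g > 0" and tau: "\<tau> > 0"
    and gap: "\<And>R k. k \<noteq> 0 \<Longrightarrow> (\<And>i. \<bar>k $ i\<bar> \<le> int R) \<Longrightarrow> cmod (fourier_coeff \<mu> k) \<le> 1 - g / real R powr \<tau>"
begin

text \<open>
  No rate can be expected here. The constants are fixed one after the other: the scale of uniform continuity, then
  the exponent \<open>n\<close> of the kernel, and finally the number of steps that the spectral gap for this exponent requires.
\<close>

lemma ucb_mixing:
  assumes F: "ucb F" and e: "e > 0"
  shows "\<exists>L. \<forall>n\<ge>L. \<forall>x. \<bar>forecast n F x - (LINT x|\<nu>. F x)\<bar> < e"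
proof -
  note bb = ucb_bounded_borel[OF F]
  obtain B where B: "B \<ge> 0" "\<And>x. \<bar>F x\<bar> \<le> B" using bounded_borelE[OF bb] by auto
  define e' where "e' = e / 5"
  have e': "e' > 0" using e by (simp add: e'_def)
  obtain k d where 1: "d > 0" "osc_less (F) (e') k d"
    by (rule ucbE[OF F e'])
  define b where "b = 2 * B / d\<^sup>2"
  have b: "b \<ge> 0" using B by (simp add: b_def)
  have fibre: "\<bar>F (\<omega>, x) - F (\<omega>, y)\<bar> \<le> e' + b * (dist x y)\<^sup>2" for \<omega> x y
  proof (cases "dist x y < d")
    case True
    have "\<bar>F (\<omega>, x) - F (\<omega>, y)\<bar> < e'" by (rule osc_lessD[OF 1(2) _ True]) simp
    moreover have "b * (dist x y)\<^sup>2 \<ge> 0" using b by simp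
    ultimately show ?thesis by linarith
  next
    case False
    then have "d\<^sup>2 \<le> (dist x y)\<^sup>2" using 1(1) by (intro power_mono) auto
    then have "b * d\<^sup>2 \<le> b * (dist x y)\<^sup>2" using b by (rule mult_left_mono)
    moreover have "b * d\<^sup>2 = 2 * B" using 1(1) by (simp add: b_def)
    ultimately show ?thesis using B(2)[of "(\<omega>, x)"] B(2)[of "(\<omega>, y)"] e' by linarith
  qed
  have base: "\<bar>F (\<omega>, \<theta>) - F (\<omega>', \<theta>)\<bar> \<le> e'" if "\<And>j. j \<ge> - int k \<Longrightarrow> j \<le> int k \<Longrightarrow> \<omega> j = \<omega>' j" for \<omega> \<omega>' \<theta>
    using osc_lessD[OF 1(2), of \<omega> \<omega>' \<theta> \<theta>] that 1(1) by (auto simp: abs_le_iff less_imp_le)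
  have "(\<lambda>n::nat. b * real CARD('d) / (2 * real n + 2)) \<longlonglongrightarrow> 0" by real_asymp
  then have "\<forall>\<^sub>F n in sequentially. b * real CARD('d) / (2 * real n + 2) < e'"
    using e' by (rule order_tendstoD)
  then obtain n0 where n0: "\<And>n. n \<ge> n0 \<Longrightarrow> b * real CARD('d) / (2 * real n + 2) < e'"
    by (auto simp: eventually_sequentially)
  define n where "n = max 1 n0"
  have n: "n \<ge> 1" "b * real CARD('d) / (2 * real n + 2) < e'"
    using n0[of n] by (auto simp: n_def)
  define \<rho> where "\<rho> = max 0 (1 - g / real (CARD('d) * n) powr \<tau>)"
  have "real (CARD('d) * n) > 0" using n(1) by (simp del: of_nat_mult add: card_gt_0_iff)
  then have "g / real (CARD('d) * n) powr \<tau> > 0" using g n(1) by (intro divide_pos_pos) auto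
  then have rho: "0 \<le> \<rho>" "\<rho> < 1" by (auto simp: \<rho>_def)
  have gap': "cmod (fourier_coeff \<mu> k) \<le> \<rho>" if "k \<noteq> 0" "\<And>i. \<bar>k $ i\<bar> \<le> int (CARD('d) * n)" for k
    using gap[OF that] by (simp add: \<rho>_def)
  have "(\<lambda>l. B * (real n + 1) ^ CARD('d) * \<rho> ^ l) \<longlonglongrightarrow> B * (real n + 1) ^ CARD('d) * 0"
    using rho by (intro tendsto_mult tendsto_const LIMSEQ_realpow_zero) auto
  then have "\<forall>\<^sub>F l in sequentially. B * (real n + 1) ^ CARD('d) * \<rho> ^ l < e'"
    by (rule order_tendstoD(2)) (use e' in simp)
  then obtain L where L: "\<And>l. l \<ge> L \<Longrightarrow> B * (real n + 1) ^ CARD('d) * \<rho> ^ l < e'"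
    by (auto simp: eventually_sequentially)
  show ?thesis
  proof (intro exI[of _ "k + L"] allI impI)
    fix m x assume m: "m \<ge> k + L"
    define l where "l = m - k"
    have l: "m = k + l" "l \<ge> L" using m by (auto simp: l_def)
    have "\<bar>forecast (k + l) F x - (LINT x|\<nu>. F x)\<bar>
      \<le> e' + (e' + b * real CARD('d) / (2 * real n + 2) + B * (real n + 1) ^ CARD('d) * \<rho> ^ l)"
      by (rule past_exp_decay[OF bb B(2) base b fibre rho(1) gap'])
    also have "\<dots> < e' + (e' + e' + e')" using n(2) L[OF l(2)] by (intro add_strict_mono add_strict_left_mono) auto
    also have "\<dots> \<le> e" using e by (simp add: e'_def)
    finally show "\<bar>forecast m F x - (LINT x|\<nu>. F x)\<bar> < e"
      by (simp add: l)
  qed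
qed

text \<open>
  The time \<open>m\<close> is split into halves, \<open>k\<close> for the base and \<open>l\<close> for the fibre, and the exponent \<open>n\<close> of the kernel is
  about \<open>k powr q\<close>. The kernel smooths at scale \<open>n powr (- 1 / 2)\<close>, which costs \<open>k powr (- q * \<alpha> / 2)\<close>, while the
  spectral gap of order \<open>k powr (- q * \<tau>)\<close> yields the factor \<open>exp (- c * k powr (1 - q * \<tau>))\<close>. Both bounds are
  summable for \<open>2 / \<alpha> < q < 1 / \<tau>\<close>.
\<close>

lemma holder_mixing_rate:
  assumes hb: "holder_bound \<alpha> v \<phi>" and \<alpha>: "0 < \<alpha>" "\<alpha> \<le> 1" "\<alpha> > 2 * \<tau>"
  obtains r where "summable r"
    "\<And>n x. \<bar>forecast n \<phi> x - (LINT x|\<nu>. \<phi> x)\<bar> \<le> r n"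
proof -
  note v = holder_boundD(1)[OF hb] and bb = holder_boundD(2)[OF hb]
  obtain B where B: "B \<ge> 0" "\<And>x. \<bar>\<phi> x\<bar> \<le> B" using bounded_borelE[OF bb] by auto
  define D where "D = real CARD('d)"
  have D: "D \<ge> 1" unfolding D_def using card_gt_0_iff[of "UNIV :: 'd set"] by (simp add: Suc_leI)
  \<comment> \<open>the midpoint of the interval \<open>2 / \<alpha> < q < 1 / \<tau>\<close>\<close>
  define q where "q = (2 / \<alpha> + 1 / \<tau>) / 2"
  have "2 / \<alpha> < 1 / \<tau>" using \<alpha> tau by (simp add: field_simps)
  then have q: "q * \<alpha> > 2" "q * \<tau> < 1" using \<alpha> tau by (auto simp: q_def field_simps)
  have q0: "q > 0" using \<alpha> tau by (simp add: q_def add_pos_pos)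
  define p where "p = 1 - q * \<tau>"
  define c where "c = g / (2 * D) powr \<tau>"
  have p: "p > 0" and c: "c > 0" using q g D by (auto simp: p_def c_def)
  define s :: real where "s = (1/2) powr \<alpha>"
  have s: "0 \<le> s" "s < 1" using powr_less_mono2[of \<alpha> "1/2" 1] \<alpha> by (auto simp: s_def)
  define t where "t k = (if k = 0 then 2 * B else
      v * s ^ k + v * (1 + D) * real k powr (- (q * \<alpha> / 2))
      + B * 3 ^ CARD('d) * (real k powr (q * D) * exp (- c * real k powr p)))" for k :: nat
  have t0: "t k \<ge> 0" for k using v B D s by (auto simp: t_def intro!: add_nonneg_nonneg mult_nonneg_nonneg)
  have "summable (\<lambda>k::nat. v * s ^ k + v * (1 + D) * real k powr (- (q * \<alpha> / 2))
      + B * 3 ^ CARD('d) * (real k powr (q * D) * exp (- c * real k powr p)))"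
    using s q c p by (intro summable_add summable_mult summable_geometric summable_powr_exp)
      (auto simp: summable_real_powr_iff)
  then have "summable t"
    by (rule summable_cong[THEN iffD1, rotated]) (auto simp: t_def eventually_at_top_linorder intro!: exI[of _ 1])
  then have "summable (\<lambda>n. t (n div 2))" using t0 by (rule summable_half)
  moreover have "\<bar>forecast m \<phi> x - (LINT x|\<nu>. \<phi> x)\<bar> \<le> t (m div 2)" for m x
  proof (cases "m div 2 = 0")
    case True
    have "\<bar>forecast m \<phi> x\<bar> \<le> B"
      using norm_past_exp_le[OF bounded_borel_skew_pow[OF bb, of m], of B 0 x] B by simp
    moreover have "\<bar>LINT x|\<nu>. \<phi> x\<bar> \<le> B"
      using S.integral_norm_bound_const(2)[of \<phi> B] B bounded_borel_measurable[OF bb] by simp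
    ultimately show ?thesis using True by (simp add: t_def)
  next
    case False
    define k where "k = m div 2"
    define l where "l = m - k"
    have k: "k \<ge> 1" "m = k + l" "l \<ge> k" using False by (auto simp: k_def l_def)
    have kp: "real k powr a > 0" for a using k by simp
    define n where "n = nat \<lceil>real k powr q\<rceil>"
    have k1: "real k powr q \<ge> 1" using k q0 by (simp add: ge_one_powr_ge_zero)
    have n: "real n \<ge> real k powr q" "real n \<le> 2 * real k powr q" "n \<ge> 1"
    proof -
      show 1: "real n \<ge> real k powr q" unfolding n_def by (rule real_nat_ceiling_ge)
      have "real n \<le> real k powr q + 1" unfolding n_def using k1 by linarith
      with k1 show "real n \<le> 2 * real k powr q" by linarith
      from 1 k1 show "n \<ge> 1" by linarith
    qed
    \<comment> \<open>the scale of the kernel with exponent \<open>n\<close>, which is of order \<open>n powr (- 1 / 2)\<close>\<close>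
    define \<delta> where "\<delta> = real k powr (- (q / 2))"
    have \<delta>: "\<delta> > 0" using k by (simp add: \<delta>_def)
    have \<delta>1: "\<delta> powr \<alpha> = real k powr (- (q * \<alpha> / 2))" by (simp add: \<delta>_def powr_powr)
    have \<delta>2: "\<delta> powr (\<alpha> - 2) = real k powr (- (q * \<alpha> / 2)) * real k powr q"
    proof -
      have "- (q / 2) * (\<alpha> - 2) = - (q * \<alpha> / 2) + q" by (simp add: field_simps)
      then show ?thesis by (simp only: \<delta>_def powr_powr powr_add)
    qed
    define \<rho> where "\<rho> = max 0 (1 - g / real (CARD('d) * n) powr \<tau>)"
    have rho: "0 \<le> \<rho>" "\<rho> \<le> 1" using g by (auto simp: \<rho>_def)
    have gap': "cmod (fourier_coeff \<mu> k) \<le> \<rho>" if "k \<noteq> 0" "\<And>i. \<bar>k $ i\<bar> \<le> int (CARD('d) * n)" for k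
      using gap[OF that] by (simp add: \<rho>_def)
    have base: "\<bar>\<phi> (\<omega>, \<theta>) - \<phi> (\<omega>', \<theta>)\<bar> \<le> v * s ^ k" if "\<And>j. j \<ge> - int k \<Longrightarrow> j \<le> int k \<Longrightarrow> \<omega> j = \<omega>' j" for \<omega> \<omega>' \<theta>
      unfolding s_def by (rule holder_agree_bound[OF hb \<alpha>(1)]) (use that in auto)
    have b0: "v * \<delta> powr (\<alpha> - 2) \<ge> 0" using v by simp
    have fibre: "\<bar>\<phi> (\<omega>, x) - \<phi> (\<omega>, y)\<bar> \<le> v * \<delta> powr \<alpha> + v * \<delta> powr (\<alpha> - 2) * (dist x y)\<^sup>2" for \<omega> x y
    proof -
      have "v * dist x y powr \<alpha> \<le> v * (\<delta> powr \<alpha> + \<delta> powr (\<alpha> - 2) * (dist x y)\<^sup>2)"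
        using v \<delta> \<alpha> by (intro mult_left_mono powr_le_quadratic) auto
      then show ?thesis using holder_boundD(4)[OF hb, of \<omega> x y] by (simp add: algebra_simps)
    qed
    have "\<bar>forecast (k + l) \<phi> x - (LINT x|\<nu>. \<phi> x)\<bar>
      \<le> v * s ^ k + (v * \<delta> powr \<alpha> + v * \<delta> powr (\<alpha> - 2) * real CARD('d) / (2 * real n + 2) + B * (real n + 1) ^ CARD('d) * \<rho> ^ l)"
      by (rule past_exp_decay[OF bb B(2) base b0 fibre rho(1) gap'])
    also have "v * \<delta> powr (\<alpha> - 2) * real CARD('d) / (2 * real n + 2) \<le> v * D * real k powr (- (q * \<alpha> / 2))"
    proof -
      have "v * \<delta> powr (\<alpha> - 2) * real CARD('d) / (2 * real n + 2) \<le> v * \<delta> powr (\<alpha> - 2) * D / real k powr q"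
        unfolding D_def using n(1) v kp[of q] by (intro divide_left_mono) auto
      also have "\<dots> = v * D * real k powr (- (q * \<alpha> / 2))"
        unfolding \<delta>2 using kp[of q] by simp
      finally show ?thesis .
    qed
    also have "B * (real n + 1) ^ CARD('d) * \<rho> ^ l \<le> B * 3 ^ CARD('d) * (real k powr (q * D) * exp (- c * real k powr p))"
    proof -
      have "(real n + 1) ^ CARD('d) \<le> (3 * real k powr q) ^ CARD('d)"
        using n(2) k1 by (intro power_mono) auto
      also have "\<dots> = 3 ^ CARD('d) * real k powr (q * D)"
        using powr_realpow[OF kp[of q], of "CARD('d)"]
        by (simp add: power_mult_distrib D_def powr_powr)
      finally have 1: "(real n + 1) ^ CARD('d) \<le> 3 ^ CARD('d) * real k powr (q * D)" .
      have Dn: "real (CARD('d) * n) > 0" using D n(3) by (simp add: D_def)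
      have "c * real k powr p \<le> real k * (g / real (CARD('d) * n) powr \<tau>)"
      proof -
        have "real (CARD('d) * n) powr \<tau> \<le> (2 * D * real k powr q) powr \<tau>"
          using n(2) D tau by (intro powr_mono2) (auto simp: D_def)
        also have "\<dots> = (2 * D) powr \<tau> * real k powr (q * \<tau>)"
          using D by (simp add: powr_mult powr_powr)
        finally have "g / ((2 * D) powr \<tau> * real k powr (q * \<tau>)) \<le> g / real (CARD('d) * n) powr \<tau>"
          using Dn D kp[of "q * \<tau>"] g n(3) by (intro divide_left_mono mult_pos_pos) auto
        then have "real k * (g / ((2 * D) powr \<tau> * real k powr (q * \<tau>))) \<le> real k * (g / real (CARD('d) * n) powr \<tau>)"
          by (rule mult_left_mono) simp
        moreover have "real k * (g / ((2 * D) powr \<tau> * real k powr (q * \<tau>))) = c * real k powr p"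
          using k kp[of "q * \<tau>"] by (simp add: c_def p_def powr_diff)
        ultimately show ?thesis by simp
      qed
      moreover have "\<rho> ^ l \<le> exp (- (real k * (g / real (CARD('d) * n) powr \<tau>)))"
      proof -
        have "\<rho> ^ l \<le> \<rho> ^ k" using rho k by (intro power_decreasing) auto
        also have "\<dots> \<le> exp (- (g / real (CARD('d) * n) powr \<tau>)) ^ k"
          using exp_ge_add_one_self[of "- (g / real (CARD('d) * n) powr \<tau>)"] rho
          by (intro power_mono) (auto simp: \<rho>_def)
        also have "\<dots> = exp (- (real k * (g / real (CARD('d) * n) powr \<tau>)))"
          by (simp add: exp_of_nat_mult[symmetric])
        finally show ?thesis .
      qed
      ultimately have 2: "\<rho> ^ l \<le> exp (- c * real k powr p)"
        by (smt (verit) exp_le_cancel_iff mult_minus_left)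
      have "B * (real n + 1) ^ CARD('d) * \<rho> ^ l \<le> B * (3 ^ CARD('d) * real k powr (q * D)) * exp (- c * real k powr p)"
        using B(1) 1 2 rho by (intro mult_mono mult_left_mono) auto
      then show ?thesis by (simp add: mult.assoc)
    qed
    finally have "\<bar>forecast m \<phi> x - (LINT x|\<nu>. \<phi> x)\<bar>
      \<le> v * s ^ k + (v * real k powr (- (q * \<alpha> / 2)) + v * D * real k powr (- (q * \<alpha> / 2))
         + B * 3 ^ CARD('d) * (real k powr (q * D) * exp (- c * real k powr p)))"
      by (simp add: k(2) \<delta>1)
    also have "\<dots> = t k" using k(1) by (simp add: t_def algebra_simps)
    finally show ?thesis by (simp add: k_def)
  qed
  ultimately show ?thesis by (rule that)
qed

text \<open>
  The fibre coordinate of \<open>(skew_inv ^^ Suc n) x\<close> is a function of the past, and resampling the coordinates from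
  \<open>0\<close> on changes its base coordinates only from \<open>n + 1\<close> on.
\<close>

lemma holder_past_approx:
  assumes hb: "holder_bound \<alpha> v \<phi>" and \<alpha>: "0 < \<alpha>"
  shows "\<bar>\<phi> ((skew_inv ^^ Suc n) x) - past_exp 0 (\<lambda>x. \<phi> ((skew_inv ^^ Suc n) x)) x\<bar> \<le> v * ((1/2) powr \<alpha>) ^ n"
proof (cases x)
  case (Pair \<omega> \<theta>)
  have bb': "bounded_borel (\<lambda>x. \<phi> ((skew_inv ^^ Suc n) x))"
    by (rule bounded_borel_comp[OF holder_boundD(2)[OF hb] skew_inv_pow_measurable])
  note psi_pair_measurable[OF bb', measurable]
  have "\<phi> ((skew_inv ^^ Suc n) x) - past_exp 0 (\<lambda>x. \<phi> ((skew_inv ^^ Suc n) x)) x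
     = (LINT \<omega>'|paths. \<phi> ((skew_inv ^^ Suc n) (\<omega>, \<theta>)) - \<phi> ((skew_inv ^^ Suc n) (splice_at 0 \<omega> \<omega>', \<theta>)))"
    using past_exp_integrable[OF bb', of 0 \<omega> \<theta>] W.prob_space
    by (simp add: Pair past_exp_def del: funpow.simps)
  also have "norm \<dots> \<le> v * ((1/2) powr \<alpha>) ^ n"
  proof (rule W.integral_norm_bound_const(2))
    fix \<omega>'
    have "(\<Sum>i<Suc n. splice_at 0 \<omega> \<omega>' (- 1 - int i)) = (\<Sum>i<Suc n. \<omega> (- 1 - int i))"
      by (simp add: splice_at_def)
    then show "norm (\<phi> ((skew_inv ^^ Suc n) (\<omega>, \<theta>)) - \<phi> ((skew_inv ^^ Suc n) (splice_at 0 \<omega> \<omega>', \<theta>))) \<le> v * ((1/2) powr \<alpha>) ^ n"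
      unfolding skew_inv_pow_formula real_norm_def
      by (simp only:) (rule holder_agree_bound[OF hb \<alpha>], auto simp: splice_at_def)
  qed measurable
  finally show ?thesis by simp
qed

end

section \<open>Martingale and coboundary decomposition\<close>

lemma past_combine:
  assumes F: "past a F" and G: "past a G"
  shows "past a (\<lambda>x. H (F x) (G x))"
  unfolding past_def
proof (intro allI impI)
  fix \<omega> \<omega>' :: "int \<Rightarrow> 'a torus" and \<theta> :: "'a torus" assume "\<forall>j<a. \<omega> j = \<omega>' j"
  then have "F (\<omega>, \<theta>) = F (\<omega>', \<theta>)" "G (\<omega>, \<theta>) = G (\<omega>', \<theta>)"
    using pastD[OF F, of \<omega> \<omega>' \<theta>] pastD[OF G, of \<omega> \<omega>' \<theta>] by blast+
  then show "H (F (\<omega>, \<theta>)) (G (\<omega>, \<theta>)) = H (F (\<omega>', \<theta>)) (G (\<omega>', \<theta>))" by simp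
qed

lemma past_suminf: "(\<And>n. past a (u n)) \<Longrightarrow> past a (\<lambda>x. \<Sum>n. u n x)"
  unfolding past_def by (intro allI impI suminf_cong) blast

context torus_prob begin

lemma past_exp_suminf:
  fixes u :: "nat \<Rightarrow> 'd phase \<Rightarrow> real"
  assumes bb: "\<And>n. bounded_borel (u n)" and le: "\<And>n x. \<bar>u n x\<bar> \<le> r n" and r: "summable r"
  shows "past_exp a (\<lambda>x. \<Sum>n. u n x) = (\<lambda>x. \<Sum>n. past_exp a (u n) x)"
proof (rule ext, clarify)
  fix \<omega> \<theta>
  note psi_pair_measurable[OF bb, measurable]
  have "(LINT \<omega>'|paths. (\<Sum>n. u n (splice_at a \<omega> \<omega>', \<theta>))) = (\<Sum>n. LINT \<omega>'|paths. u n (splice_at a \<omega> \<omega>', \<theta>))"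
  proof (rule integral_suminf)
    show int: "integrable paths (\<lambda>\<omega>'. u n (splice_at a \<omega> \<omega>', \<theta>))" for n
      by (rule past_exp_integrable[OF bb])
    have "summable (\<lambda>n. norm (u n (splice_at a \<omega> \<omega>', \<theta>)))" for \<omega>'
      by (rule summable_comparison_test[OF _ r]) (use le in auto)
    then show "AE \<omega>' in paths. summable (\<lambda>n. norm (u n (splice_at a \<omega> \<omega>', \<theta>)))" by simp
    have "norm (LINT \<omega>'|paths. norm (u n (splice_at a \<omega> \<omega>', \<theta>))) \<le> r n" for n
      by (rule W.integral_norm_bound_const(2)) (use le in auto)
    then show "summable (\<lambda>n. LINT \<omega>'|paths. norm (u n (splice_at a \<omega> \<omega>', \<theta>)))"
      by (intro summable_comparison_test[OF _ r]) auto
  qed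
  then show "past_exp a (\<lambda>x. \<Sum>n. u n x) (\<omega>, \<theta>) = (\<Sum>n. past_exp a (u n) (\<omega>, \<theta>))"
    by (simp add: past_exp_def)
qed

text \<open>
  Gordin's decomposition for an invertible system. With \<open>a n\<close> the conditional expectation of \<open>\<phi> \<circ> f ^^ n\<close> and \<open>b n\<close>
  the part of \<open>\<phi> \<circ> g ^^ (n + 1)\<close> that is not determined by the past, put \<open>h = (\<Sum>n. a n) - (\<Sum>n. b n)\<close>. Composing
  with \<open>f\<close> and taking the conditional expectation shifts the first series by one index and annihilates
  the second, which gives \<open>E m = 0\<close>. For the dependence on the past, the second series telescopes
  up to terms that are determined by the past.
\<close>

lemma martingale_coboundary_decomposition:
  fixes \<phi> :: "'d phase \<Rightarrow> real"
  assumes \<phi>: "ucb \<phi>"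
    and r1: "summable r1" "\<And>n x. \<bar>forecast n \<phi> x\<bar> \<le> r1 n"
    and r2: "summable r2" "\<And>n x. \<bar>\<phi> ((skew_inv ^^ Suc n) x) - past_exp 0 (\<lambda>x. \<phi> ((skew_inv ^^ Suc n) x)) x\<bar> \<le> r2 n"
  obtains h m where "ucb h" "ucb m" "past 1 m" "past_exp 0 m = (\<lambda>x. 0)"
    "\<And>x. \<phi> x = m x + h x - h (skew_product x)"
proof -
  define a where "a n = forecast n \<phi>" for n
  define c where "c n = past_exp 0 (\<lambda>x. \<phi> ((skew_inv ^^ n) x))" for n
  define b where "b n = (\<lambda>x. \<phi> ((skew_inv ^^ Suc n) x) - c (Suc n) x)" for n
  define A where "A = (\<lambda>x. \<Sum>n. a n x)"
  define B where "B = (\<lambda>x. \<Sum>n. b n x)"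
  define h where "h = (\<lambda>x. A x - B x)"
  define m where "m = (\<lambda>x. \<phi> x - h x + h (skew_product x))"
  note bb\<phi> = ucb_bounded_borel[OF \<phi>]
  have ra: "\<bar>a n x\<bar> \<le> r1 n" and rb: "\<bar>b n x\<bar> \<le> r2 n" for n x
    using r1(2)[of n x] r2(2)[of n x] by (simp_all add: a_def b_def c_def del: funpow.simps)
  have ua: "ucb (a n)" and uc: "ucb (c n)" for n
    unfolding a_def c_def by (intro ucb_past_exp ucb_comp_skew_pow ucb_comp_skew_inv_pow \<phi>)+
  have ub: "ucb (b n)" for n
    unfolding b_def by (intro ucb_minus ucb_comp_skew_inv_pow \<phi> uc)
  have uA: "ucb A" unfolding A_def by (rule ucb_suminf[OF ua ra r1(1)])
  have uB: "ucb B" unfolding B_def by (rule ucb_suminf[OF ub rb r2(1)])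
  have uh: "ucb h" unfolding h_def by (rule ucb_minus[OF uA uB])
  have um: "ucb m" unfolding m_def by (intro ucb_add ucb_minus \<phi> uh ucb_comp_skew)
  have sa: "summable (\<lambda>n. a n x)" for x
    by (rule summable_comparison_test[OF _ r1(1)]) (use ra in auto)
  have sb: "summable (\<lambda>n. b n x)" for x
    by (rule summable_comparison_test[OF _ r2(1)]) (use rb in auto)
  have pA: "past 0 A" unfolding A_def by (intro past_suminf) (simp add: a_def past_past_exp)

  have E_Af: "past_exp 0 (\<lambda>x. A (skew_product x)) = (\<lambda>x. A x - past_exp 0 \<phi> x)"
  proof -
    have af: "past_exp 0 (\<lambda>x. a n (skew_product x)) = a (Suc n)" for n
      using past_exp_markov[OF bounded_borel_skew_pow[OF bb\<phi>], of n 1]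
      unfolding a_def by (simp add: funpow_Suc_right del: funpow.simps(2))
    have "past_exp 0 (\<lambda>x. A (skew_product x)) = (\<lambda>x. \<Sum>n. past_exp 0 (\<lambda>x. a n (skew_product x)) x)"
      unfolding A_def
      by (rule past_exp_suminf[OF ucb_bounded_borel[OF ucb_comp_skew[OF ua]] ra r1(1)])
    also have "\<dots> = (\<lambda>x. \<Sum>n. a (Suc n) x)" by (simp add: af)
    also have "\<dots> = (\<lambda>x. A x - a 0 x)"
      unfolding A_def by (intro ext suminf_split_head sa)
    finally show ?thesis by (simp add: a_def)
  qed
  have E_B: "past_exp 0 B = (\<lambda>x. 0)"
  proof -
    have "past_exp 0 (b n) = (\<lambda>x. 0)" for n
      unfolding b_def
      by (subst past_exp_minus[OF ucb_bounded_borel[OF ucb_comp_skew_inv_pow[OF \<phi>]] ucb_bounded_borel[OF uc]])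
         (simp add: c_def past_exp_past[OF past_past_exp] del: funpow.simps)
    then show ?thesis
      unfolding B_def past_exp_suminf[OF ucb_bounded_borel[OF ub] rb r2(1)] by simp
  qed
  have E_Bf: "past_exp 0 (\<lambda>x. B (skew_product x)) = (\<lambda>x. 0)"
    using past_exp_tower[OF ucb_bounded_borel[OF ucb_comp_skew[OF uB]], of 0 1]
      past_exp_comp_skew[OF ucb_bounded_borel[OF uB], of 0]
    by (simp add: E_B past_exp_const)
  have E_m: "past_exp 0 m = (\<lambda>x. 0)"
  proof -
    have meq: "m = (\<lambda>x. (\<phi> x - (A x - B x)) + (A (skew_product x) - B (skew_product x)))"
      by (simp add: m_def h_def)
    have "past_exp 0 m = (\<lambda>x. (past_exp 0 \<phi> x - (past_exp 0 A x - past_exp 0 B x))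
        + (past_exp 0 (\<lambda>x. A (skew_product x)) x - past_exp 0 (\<lambda>x. B (skew_product x)) x))"
      by (simp only: meq past_exp_add past_exp_minus ucb_bounded_borel ucb_add ucb_minus ucb_comp_skew \<phi> uA uB)
    also have "\<dots> = (\<lambda>x. 0)"
      by (simp add: E_Af E_B E_Bf past_exp_past[OF pA])
    finally show ?thesis .
  qed

  \<comment> \<open>the only part of \<open>m\<close> that does not evidently depend on the past alone\<close>
  define C where "C = (\<lambda>x. \<phi> x + (B x - B (skew_product x)))"
  have pC: "past 1 C"
    unfolding past_def
  proof (intro allI impI)
    fix \<omega> \<omega>' :: "int \<Rightarrow> 'd torus" and \<theta> :: "'d torus"
    assume eq: "\<forall>j<1. \<omega> j = \<omega>' j"
    define D where "D M x = \<phi> x + (\<Sum>n<M. b n x - b n (skew_product x))" for M x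
    have D_lim: "(\<lambda>M. D M x) \<longlonglongrightarrow> C x" for x
      unfolding D_def C_def B_def
      by (intro tendsto_add tendsto_const) (simp add: sum_subtractf, intro tendsto_diff summable_LIMSEQ sb)
    have D_eq: "D M x = \<phi> ((skew_inv ^^ M) x) - (\<Sum>n<M. c (Suc n) x - c (Suc n) (skew_product x))" for M x
    proof (induction M)
      case (Suc M)
      have "D (Suc M) x = D M x + (b M x - b M (skew_product x))" by (simp add: D_def)
      also have "b M (skew_product x) = \<phi> ((skew_inv ^^ M) x) - c (Suc M) (skew_product x)"
        by (simp add: b_def funpow_Suc_right del: funpow.simps)
      finally show ?case using Suc by (simp add: b_def del: funpow.simps)
    qed (simp add: D_def)
    have pc: "past 1 (\<lambda>x. c (Suc n) x - c (Suc n) (skew_product x))" for n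
    proof -
      have "past 0 (c (Suc n))" unfolding c_def by (rule past_past_exp)
      then have "past 1 (c (Suc n))" "past 1 (\<lambda>x. c (Suc n) (skew_product x))"
        using past_mono[of 0 _ 1] past_comp_skew[of 0] by auto
      then show ?thesis by (rule past_combine)
    qed
    have D_diff: "D M (\<omega>, \<theta>) - D M (\<omega>', \<theta>) = \<phi> ((skew_inv ^^ M) (\<omega>, \<theta>)) - \<phi> ((skew_inv ^^ M) (\<omega>', \<theta>))" for M
    proof -
      have "c (Suc n) (\<omega>, \<theta>) - c (Suc n) (skew_product (\<omega>, \<theta>)) = c (Suc n) (\<omega>', \<theta>) - c (Suc n) (skew_product (\<omega>', \<theta>))" for n
        using pastD[OF pc[of n], of \<omega> \<omega>' \<theta>] eq by blast
      then show ?thesis unfolding D_eq by simp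
    qed
    \<comment> \<open>Under \<open>skew_inv ^^ M\<close> the coordinates where \<open>\<omega>\<close> and \<open>\<omega>'\<close> differ move to the right of \<open>M\<close>.\<close>
    have "(\<lambda>M. D M (\<omega>, \<theta>) - D M (\<omega>', \<theta>)) \<longlonglongrightarrow> 0"
    proof (rule LIMSEQ_I)
      fix e :: real assume "e > 0"
      obtain k \<delta> where k: "\<delta> > 0" "osc_less \<phi> e k \<delta>" by (rule ucbE[OF \<phi> \<open>e > 0\<close>])
      show "\<exists>M0. \<forall>M\<ge>M0. norm (D M (\<omega>, \<theta>) - D M (\<omega>', \<theta>) - 0) < e"
      proof (intro exI[of _ k] allI impI)
        fix M assume M: "M \<ge> k"
        have "(\<Sum>i<M. \<omega> (- 1 - int i)) = (\<Sum>i<M. \<omega>' (- 1 - int i))" using eq by (intro sum.cong) auto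
        moreover have "\<omega> (j - int M) = \<omega>' (j - int M)" if "\<bar>j\<bar> \<le> int k" for j
          using eq that M by auto
        ultimately show "norm (D M (\<omega>, \<theta>) - D M (\<omega>', \<theta>) - 0) < e"
          unfolding D_diff skew_inv_pow_formula real_norm_def diff_0_right
          using k(1) by (intro osc_lessD[OF k(2)]) auto
      qed
    qed
    moreover have "(\<lambda>M. D M (\<omega>, \<theta>) - D M (\<omega>', \<theta>)) \<longlonglongrightarrow> C (\<omega>, \<theta>) - C (\<omega>', \<theta>)"
      by (intro tendsto_diff D_lim)
    ultimately have "C (\<omega>, \<theta>) - C (\<omega>', \<theta>) = 0" by (rule LIMSEQ_unique[rotated])
    then show "C (\<omega>, \<theta>) = C (\<omega>', \<theta>)" by simp
  qed
  have pm: "past 1 m"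
  proof -
    have "m = (\<lambda>x. (C x - A x) + A (skew_product x))"
      by (simp add: m_def h_def C_def fun_eq_iff)
    moreover have "past 1 A" "past 1 (\<lambda>x. A (skew_product x))"
      using past_mono[OF pA, of 1] past_comp_skew[OF pA] by auto
    ultimately show ?thesis
      using past_combine[OF past_combine[OF pC, of A "(-)"], of "\<lambda>x. A (skew_product x)" "(+)"] by simp
  qed
  show ?thesis
    by (rule that[OF uh um pm E_m]) (simp add: m_def)
qed

end

section \<open>Central limit theorem for stationary martingale differences\<close>

lemma norm_iexp_diff_le: "cmod (iexp a - iexp b) \<le> \<bar>a - b\<bar>"
proof -
  have "iexp a - iexp b = iexp b * (iexp (a - b) - 1)"
    by (simp add: algebra_simps exp_diff exp_minus)
  then have "cmod (iexp a - iexp b) = cmod (iexp (a - b) - 1)" by (simp add: norm_mult)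
  also have "\<dots> \<le> \<bar>a - b\<bar>" using iexp_approx1[of "a - b" 0] by simp
  finally show ?thesis .
qed

lemma iexp_quadratic_approx:
  "cmod (iexp y - (complex_of_real (1 - y\<^sup>2 / 2) + \<i> * complex_of_real y)) \<le> \<bar>y\<bar> ^ 3 / 6"
proof -
  have eq: "(\<Sum>k\<le>2. (\<i> * complex_of_real y) ^ k / fact k) = complex_of_real (1 - y\<^sup>2 / 2) + \<i> * complex_of_real y"
    by (simp add: eval_nat_numeral power2_eq_square algebra_simps)
  have "Suc 2 = 3" "fact 3 = (6 :: real)" by (simp_all add: fact_numeral)
  then show ?thesis using iexp_approx1[of y 2] unfolding eq by (simp only:)
qed

text \<open>
  The upper bound follows from \<open>exp u \<ge> 1 + u + u\<^sup>2 / 2\<close> and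
  \<open>(1 + u + u\<^sup>2 / 2) * (1 - u + u\<^sup>2 / 2) = 1 + u ^ 4 / 4\<close>.
\<close>

lemma exp_minus_quadratic:
  fixes u :: real assumes "u \<ge> 0"
  shows "\<bar>(1 - u) - exp (- u)\<bar> \<le> u\<^sup>2 / 2"
proof -
  have "1 - u \<le> exp (- u)" using exp_ge_add_one_self[of "- u"] by simp
  moreover have "exp (- u) \<le> 1 - u + u\<^sup>2 / 2"
  proof -
    have 1: "1 + u + u\<^sup>2 / 2 \<le> exp u" using exp_lower_Taylor_quadratic[OF assms] by simp
    have 2: "0 \<le> 1 - u + u\<^sup>2 / 2"
      using sum_squares_ge_zero[of "u - 1" 1] by (simp add: power2_eq_square algebra_simps)
    have "1 \<le> (1 + u + u\<^sup>2 / 2) * (1 - u + u\<^sup>2 / 2)"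
    proof -
      have "(1 + u + u\<^sup>2 / 2) * (1 - u + u\<^sup>2 / 2) = 1 + u ^ 4 / 4"
        by (simp add: power2_eq_square power4_eq_xxxx algebra_simps)
      then show ?thesis by simp
    qed
    also have "\<dots> \<le> exp u * (1 - u + u\<^sup>2 / 2)" using 1 2 by (rule mult_right_mono)
    finally show ?thesis by (simp add: exp_minus field_simps)
  qed
  ultimately show ?thesis by linarith
qed

lemma exp_minus_lipschitz:
  fixes a b :: real assumes "0 \<le> a" "a \<le> b"
  shows "\<bar>exp (- a) - exp (- b)\<bar> \<le> b - a"
proof -
  have "exp (- a) - exp (- b) = exp (- a) * (1 - exp (- (b - a)))"
    by (simp add: algebra_simps exp_diff exp_minus inverse_eq_divide)
  also have "\<dots> \<le> 1 * (b - a)"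
  proof (rule mult_mono)
    show "1 - exp (- (b - a)) \<le> b - a" using exp_ge_add_one_self[of "- (b - a)"] by linarith
  qed (use assms in auto)
  finally show ?thesis using assms by simp
qed

lemma bounded_borel_of_real:
  assumes F: "bounded_borel F"
  shows "bounded_borel (\<lambda>x. complex_of_real (F x))"
proof -
  note [measurable] = bounded_borel_measurable[OF F]
  obtain B where "\<And>x. norm (F x) \<le> B" using bounded_borelE[OF F] by blast
  then show ?thesis by (intro bounded_borelI[where B=B]) auto
qed

lemma birkhoff_sum_Suc: "birkhoff_sum T (Suc n) \<psi> x = birkhoff_sum T n \<psi> x + \<psi> ((T ^^ n) x)"
  by (simp add: birkhoff_sum_def)

lemma birkhoff_sum_coboundary:
  fixes h :: "'a \<Rightarrow> real"
  assumes "\<And>x. \<phi> x = m x + h x - h (T x)"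
  shows "birkhoff_sum T n \<phi> x = birkhoff_sum T n m x + h x - h ((T ^^ n) x)"
  by (induction n) (auto simp: birkhoff_sum_Suc assms birkhoff_sum_def[of T 0])

lemma abs_sum_le_card:
  assumes "\<And>i. \<bar>f i\<bar> \<le> (C::real)"
  shows "\<bar>\<Sum>i<n. f i\<bar> \<le> real n * C"
  using sum_norm_bound[of "{..<n}" f C] assms by simp

context torus_prob begin

lemma past_exp_of_real:
  "past_exp a (\<lambda>x. complex_of_real (F x)) = (\<lambda>x. complex_of_real (past_exp a F x))"
  by (simp add: past_exp_def fun_eq_iff)

lemma past_exp_cmult:
  fixes \<psi> :: "'d phase \<Rightarrow> 'b::{real_normed_field, banach, second_countable_topology}"
  shows "past_exp a (\<lambda>x. k * \<psi> x) = (\<lambda>x. k * past_exp a \<psi> x)"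
  by (rule past_exp_mult) (simp add: past_def)

end

text \<open>
  The assumptions say that the \<open>m \<circ> f ^^ n\<close> are bounded martingale differences for the filtration generated by
  \<open>\<theta>\<close> and the \<open>\<omega> j\<close> with \<open>j < n\<close>.
\<close>

locale stationary_martingale = torus_prob \<mu> for \<mu> :: "'d::finite torus measure" +
  fixes m :: "'d phase \<Rightarrow> real" and C :: real
  assumes m_bb: "bounded_borel m" and m_le: "\<And>x. \<bar>m x\<bar> \<le> C"
    and m_past: "past 1 m" and m_diff: "past_exp 0 m = (\<lambda>x. 0)"
begin

abbreviation M where "M n x \<equiv> birkhoff_sum skew_product n m x"

text \<open>
  The sum over the last \<open>n\<close> steps before time \<open>0\<close>. It has the same distribution as the Birkhoff sum \<^term>\<open>M n\<close> but
  depends only on the past, so that a block \<^term>\<open>M k\<close> following it can be conditioned at time \<open>0\<close>.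
\<close>

definition N where "N n x = (\<Sum>i<n. m ((skew_inv ^^ Suc i) x))"

lemma C_nonneg: "C \<ge> 0"
  using m_le[of "(\<lambda>_. 0, 0)"] by linarith

lemma abs_M_le: "\<bar>M n x\<bar> \<le> real n * C"
  unfolding birkhoff_sum_def by (rule abs_sum_le_card) (rule m_le)

lemma M_measurable [measurable]: "(\<lambda>x. M n x) \<in> borel_measurable borel"
proof -
  note bounded_borel_measurable[OF bounded_borel_skew_pow[OF m_bb], measurable]
  show ?thesis unfolding birkhoff_sum_def by measurable
qed

lemma M_bb: "bounded_borel (\<lambda>x. M n x)"
  by (rule bounded_borelI[OF M_measurable, of _ "real n * C"]) (simp add: abs_M_le)

lemma M_square_bb: "bounded_borel (\<lambda>x. (M n x)\<^sup>2)"
  by (rule bounded_borelI[where B="(real n * C)\<^sup>2"]) (auto simp: power2_le_iff_abs_le C_nonneg abs_M_le)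

lemma m_pow_square_bb: "bounded_borel (\<lambda>x. (m ((skew_product ^^ n) x))\<^sup>2)"
  using bounded_borel_measurable[OF bounded_borel_skew_pow[OF m_bb, of n]]
  by (intro bounded_borelI[where B="C\<^sup>2"]) (auto simp: power2_le_iff_abs_le C_nonneg m_le)

lemma N_measurable [measurable]: "(\<lambda>x. N n x) \<in> borel_measurable borel"
proof -
  have [measurable]: "(\<lambda>x. m ((skew_inv ^^ Suc i) x)) \<in> borel_measurable borel" for i
    by (rule bounded_borel_measurable[OF bounded_borel_comp[OF m_bb skew_inv_pow_measurable]])
  show ?thesis unfolding N_def by measurable
qed

lemma past_m_pow: "past (int i + 1) (\<lambda>x. m ((skew_product ^^ i) x))"
proof (induction i)
  case (Suc i)
  from past_comp_skew[OF this] show ?case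
    by (simp add: funpow_Suc_right add.commute del: funpow.simps)
qed (simp add: m_past)

lemma past_M: "past (int n) (\<lambda>x. M n x)"
  unfolding past_def birkhoff_sum_def
proof (intro allI impI sum.cong refl)
  fix \<omega> \<omega>' :: "int \<Rightarrow> 'd torus" and \<theta> i assume a: "\<forall>j<int n. \<omega> j = \<omega>' j" "i \<in> {..<n}"
  show "m ((skew_product ^^ i) (\<omega>, \<theta>)) = m ((skew_product ^^ i) (\<omega>', \<theta>))"
    by (rule pastD[OF past_m_pow]) (use a in auto)
qed

lemma past_N: "past 0 (\<lambda>x. N n x)"
proof -
  have "past 0 (\<lambda>x. m ((skew_inv ^^ Suc i) x))" for i
  proof (induction i)
    case 0
    show ?case using past_comp_skew_inv[of 0 m] m_past by simp
  next
    case (Suc i)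
    have "past (0 + 1) (\<lambda>x. m ((skew_inv ^^ Suc i) x))" by (rule past_mono[OF Suc]) simp
    from past_comp_skew_inv[OF this] show ?case
      by (simp add: funpow_Suc_right[of "Suc i"] del: funpow.simps)
  qed
  then show ?thesis unfolding past_def N_def by (intro allI impI sum.cong refl) metis
qed

lemma N_shift: "N (j + k) ((skew_product ^^ k) x) = M k x + N j x"
proof (induction k)
  case (Suc k)
  have one: "N (Suc n) (skew_product y) = m y + N n y" for n y
    unfolding N_def sum.lessThan_Suc_shift
    by (simp add: funpow_Suc_right del: funpow.simps(2))
  have "N (j + Suc k) ((skew_product ^^ Suc k) x) = m ((skew_product ^^ k) x) + N (j + k) ((skew_product ^^ k) x)"
    by (simp add: one)
  then show ?case using Suc by (simp add: birkhoff_sum_Suc)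
qed (simp add: birkhoff_sum_def)

lemma past_exp_m_pow: "past_exp (int n) (\<lambda>x. m ((skew_product ^^ n) x)) = (\<lambda>x. 0)"
  by (simp add: past_exp_comp_skew_pow[OF m_bb] m_diff)

lemma past_exp_M: "past_exp 0 (\<lambda>x. M n x) = (\<lambda>x. 0)"
proof (induction n)
  case (Suc n)
  note bn = bounded_borel_skew_pow[OF m_bb, of n]
  have "past_exp 0 (\<lambda>x. m ((skew_product ^^ n) x)) = (\<lambda>x. 0)"
    using past_exp_tower[OF bn, of 0 "int n"] by (simp add: past_exp_m_pow past_exp_const)
  then show ?case
    using past_exp_add[OF M_bb[of n] bn, of 0] Suc by (simp add: birkhoff_sum_Suc)
qed (simp add: birkhoff_sum_def past_exp_const)

text \<open>
  Martingale differences are orthogonal: conditioned at time \<open>n\<close>, the cross term \<open>M n * m \<circ> f ^^ n\<close> vanishes.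
\<close>

lemma past_exp_M_square:
  "past_exp 0 (\<lambda>x. (M n x)\<^sup>2) = (\<lambda>x. \<Sum>i<n. past_exp 0 (\<lambda>x. (m ((skew_product ^^ i) x))\<^sup>2) x)"
proof (induction n)
  case (Suc n)
  note bn = bounded_borel_skew_pow[OF m_bb, of n]
  note [measurable] = bounded_borel_measurable[OF bn]
  note b1 = M_square_bb[of n]
  have b2: "bounded_borel (\<lambda>x. M n x * m ((skew_product ^^ n) x))"
    by (rule bounded_borelI[where B="(real n * C) * C"]) (auto simp: abs_mult C_nonneg abs_M_le m_le intro!: mult_mono)
  have b3: "bounded_borel (\<lambda>x. 2 * (M n x * m ((skew_product ^^ n) x)))"
    using bounded_borel_add[OF b2 b2] by simp
  note b4 = m_pow_square_bb[of n]
  have z: "past_exp 0 (\<lambda>x. M n x * m ((skew_product ^^ n) x)) = (\<lambda>x. 0)"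
    using past_exp_tower[OF b2, of 0 "int n"]
    by (simp add: past_exp_mult[OF past_M] past_exp_m_pow past_exp_const)
  have "past_exp 0 (\<lambda>x. (M (Suc n) x)\<^sup>2)
     = past_exp 0 (\<lambda>x. ((M n x)\<^sup>2 + 2 * (M n x * m ((skew_product ^^ n) x))) + (m ((skew_product ^^ n) x))\<^sup>2)"
    by (simp add: birkhoff_sum_Suc power2_sum algebra_simps)
  also have "\<dots> = (\<lambda>x. past_exp 0 (\<lambda>x. (M n x)\<^sup>2) x + past_exp 0 (\<lambda>x. (m ((skew_product ^^ n) x))\<^sup>2) x)"
    by (simp add: past_exp_add[OF bounded_borel_add[OF b1 b3] b4] past_exp_add[OF b1 b3] past_exp_cmult z)
  finally show ?case by (simp add: Suc)
qed (simp add: birkhoff_sum_def past_exp_const)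

lemma iexp_bb:
  assumes "F \<in> borel_measurable borel"
  shows "bounded_borel (\<lambda>x. iexp (s * F x))"
  using assms by (intro bounded_borelI[where B=1]) auto

text \<open>
  The conditional variance of a block of length \<open>n\<close>, by \<open>past_exp_M_square\<close>.
\<close>

definition V where "V n x = (\<Sum>i<n. past_exp 0 (\<lambda>x. (m ((skew_product ^^ i) x))\<^sup>2) x)"

text \<open>
  The second-order expansion of \<open>iexp\<close> with the crude bound \<open>n * C\<close> for the block sum suffices, because the block
  length stays fixed while \<open>s\<close> tends to \<open>0\<close>.
\<close>

lemma past_exp_iexp_M:
  "cmod (past_exp 0 (\<lambda>x. iexp (s * M n x)) x - complex_of_real (1 - s\<^sup>2 * V n x / 2)) \<le> (\<bar>s\<bar> * (real n * C)) ^ 3 / 6"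
proof -
  let ?q = "\<lambda>x. complex_of_real (1 - (s * M n x)\<^sup>2 / 2) + \<i> * complex_of_real (s * M n x)"
  note b1 = M_square_bb[of n]
  have b0: "bounded_borel (\<lambda>x :: 'd phase. 1 :: real)" by (rule bounded_borelI[where B=1]) auto
  have b2: "bounded_borel (\<lambda>x. (s\<^sup>2 / 2) * (M n x)\<^sup>2)"
    by (rule bounded_borelI[where B="\<bar>s\<^sup>2 / 2\<bar> * (real n * C)\<^sup>2"])
       (auto simp: abs_mult power2_le_iff_abs_le C_nonneg abs_M_le intro!: mult_left_mono divide_right_mono)
  have b3: "bounded_borel (\<lambda>x. 1 - (s\<^sup>2 / 2) * (M n x)\<^sup>2)" by (rule bounded_borel_minus[OF b0 b2])
  have b3c: "bounded_borel (\<lambda>x. complex_of_real (1 - (s\<^sup>2 / 2) * (M n x)\<^sup>2))"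
    by (rule bounded_borel_of_real[OF b3])
  have b4c: "bounded_borel (\<lambda>x. (\<i> * complex_of_real s) * complex_of_real (M n x))"
    by (rule bounded_borelI[where B="\<bar>s\<bar> * (real n * C)"]) (auto simp: norm_mult abs_M_le intro!: mult_left_mono)
  have qeq: "?q = (\<lambda>x. complex_of_real (1 - (s\<^sup>2 / 2) * (M n x)\<^sup>2) + (\<i> * complex_of_real s) * complex_of_real (M n x))"
    by (simp add: power_mult_distrib fun_eq_iff)
  have bq: "bounded_borel ?q" unfolding qeq by (rule bounded_borel_add[OF b3c b4c])
  have Eq: "past_exp 0 ?q = (\<lambda>x. complex_of_real (1 - s\<^sup>2 * V n x / 2))"
    unfolding qeq past_exp_add[OF b3c b4c] past_exp_of_real past_exp_minus[OF b0 b2] past_exp_cmult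
      past_exp_M_square past_exp_M past_exp_const V_def
    by simp
  have "past_exp 0 (\<lambda>x. iexp (s * M n x)) x - complex_of_real (1 - s\<^sup>2 * V n x / 2)
     = past_exp 0 (\<lambda>x. iexp (s * M n x) - ?q x) x"
    unfolding past_exp_minus[OF iexp_bb[OF M_measurable] bq] Eq ..
  also have "cmod \<dots> \<le> (\<bar>s\<bar> * (real n * C)) ^ 3 / 6"
  proof (rule norm_past_exp_le[OF bounded_borel_minus[OF iexp_bb[OF M_measurable] bq]])
    fix x
    have "cmod (iexp (s * M n x) - ?q x) \<le> \<bar>s * M n x\<bar> ^ 3 / 6" by (rule iexp_quadratic_approx)
    also have "\<dots> \<le> (\<bar>s\<bar> * (real n * C)) ^ 3 / 6"
      by (intro divide_right_mono power_mono) (auto simp: abs_mult abs_M_le intro!: mult_left_mono)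
    finally show "cmod (iexp (s * M n x) - ?q x) \<le> (\<bar>s\<bar> * (real n * C)) ^ 3 / 6" .
  qed
  finally show ?thesis .
qed

definition char_N where "char_N s n = (LINT x|\<nu>. iexp (s * N n x))"

text \<open>
  Stationarity turns \<open>N (j + k)\<close> into \<open>N j + M k\<close>, where \<open>N j\<close> belongs to the past. Conditioning on the past
  replaces \<open>iexp (s * M k)\<close> by its conditional expectation, which is \<open>1 - s\<^sup>2 * V k / 2\<close> up to the cubic error,
  and hence close to \<open>exp (- u)\<close> uniformly over all pasts.
\<close>

lemma char_N_step:
  fixes s :: real
  assumes V: "\<And>x. \<bar>V k x - real k * v\<bar> \<le> e" and v: "v \<ge> 0"
  defines "u \<equiv> s\<^sup>2 * (real k * v) / 2"
  shows "cmod (char_N s (j + k) - complex_of_real (exp (- u)) * char_N s j)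
     \<le> (\<bar>s\<bar> * (real k * C)) ^ 3 / 6 + s\<^sup>2 * e / 2 + u\<^sup>2 / 2"
proof -
  let ?w = "complex_of_real (exp (- u))"
  let ?a = "\<lambda>x. iexp (s * N j x)" and ?b = "\<lambda>x. iexp (s * M k x)"
  have u: "u \<ge> 0" using v by (simp add: u_def)
  have ba: "bounded_borel ?a" by (rule iexp_bb) simp
  have bw: "bounded_borel (\<lambda>x :: 'd phase. ?w)"
    by (rule bounded_borelI[where B="cmod ?w"]) auto
  have bb: "bounded_borel (\<lambda>x. ?b x - ?w)"
    by (rule bounded_borel_minus[OF iexp_bb[OF M_measurable] bw])
  have bab: "bounded_borel (\<lambda>x. ?a x * (?b x - ?w))" and bab': "bounded_borel (\<lambda>x. ?a x * ?b x)"
    and baw: "bounded_borel (\<lambda>x. ?w * ?a x)"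
  proof -
    obtain B where B: "\<And>x. cmod (?b x - ?w) \<le> B" using bounded_borelE[OF bb] by blast
    show "bounded_borel (\<lambda>x. ?a x * (?b x - ?w))"
      by (rule bounded_borelI[where B=B]) (use B in \<open>auto simp: norm_mult\<close>)
    show "bounded_borel (\<lambda>x. ?a x * ?b x)"
      by (rule bounded_borelI[where B=1]) (auto simp: norm_mult)
    show "bounded_borel (\<lambda>x. ?w * ?a x)"
      by (rule bounded_borelI[where B="cmod ?w"]) (auto simp: norm_mult)
  qed
  have "char_N s (j + k) = (LINT x|\<nu>. iexp (s * N (j + k) ((skew_product ^^ k) x)))"
    unfolding char_N_def by (rule integral_comp_skew_pow[OF iexp_bb[OF N_measurable], symmetric])
  also have "\<dots> = (LINT x|\<nu>. ?a x * ?b x)"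
    by (simp add: N_shift exp_add[symmetric] algebra_simps)
  finally have "char_N s (j + k) - ?w * char_N s j = (LINT x|\<nu>. ?a x * (?b x - ?w))"
    using integrable_skew[OF bab'] integrable_skew[OF baw]
    by (simp add: char_N_def right_diff_distrib mult.commute[of "?w"] flip: integral_mult_left_zero)
  also have "\<dots> = (LINT x|\<nu>. past_exp 0 (\<lambda>x. ?a x * (?b x - ?w)) x)"
    by (rule integral_past_exp[OF bab, symmetric])
  also have "cmod \<dots> \<le> (\<bar>s\<bar> * (real k * C)) ^ 3 / 6 + s\<^sup>2 * e / 2 + u\<^sup>2 / 2"
  proof (rule S.integral_norm_bound_const(2))
    show "past_exp 0 (\<lambda>x. ?a x * (?b x - ?w)) \<in> borel_measurable (\<nu>)"
      using bounded_borel_measurable[OF bounded_borel_past_exp[OF bab]] by simp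
    fix x
    have pa: "past 0 ?a" using past_N[of j] unfolding past_def by metis
    have "past_exp 0 (\<lambda>x. ?a x * (?b x - ?w)) x = ?a x * (past_exp 0 ?b x - ?w)"
      by (simp only: past_exp_mult[OF pa] past_exp_minus[OF iexp_bb[OF M_measurable] bw] past_exp_const)
    then have "cmod (past_exp 0 (\<lambda>x. ?a x * (?b x - ?w)) x) = cmod (past_exp 0 ?b x - ?w)"
      by (simp add: norm_mult)
    also have "past_exp 0 ?b x - ?w = (past_exp 0 ?b x - complex_of_real (1 - s\<^sup>2 * V k x / 2))
       + complex_of_real ((1 - s\<^sup>2 * V k x / 2) - exp (- u))" by simp
    also have "cmod \<dots> \<le> (\<bar>s\<bar> * (real k * C)) ^ 3 / 6 + (s\<^sup>2 * e / 2 + u\<^sup>2 / 2)"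
    proof (rule norm_triangle_mono[OF past_exp_iexp_M])
      have "(1 - s\<^sup>2 * V k x / 2) - exp (- u) = (1 - u - exp (- u)) - s\<^sup>2 * (V k x - real k * v) / 2"
        by (simp add: u_def field_simps)
      moreover have "\<bar>s\<^sup>2 * (V k x - real k * v) / 2\<bar> \<le> s\<^sup>2 * e / 2"
        using V[of x] by (auto simp: abs_mult intro!: divide_right_mono mult_left_mono)
      ultimately show "cmod (complex_of_real ((1 - s\<^sup>2 * V k x / 2) - exp (- u))) \<le> s\<^sup>2 * e / 2 + u\<^sup>2 / 2"
        using exp_minus_quadratic[OF u] unfolding norm_of_real by linarith
    qed
    finally show "cmod (past_exp 0 (\<lambda>x. ?a x * (?b x - ?w)) x)
       \<le> (\<bar>s\<bar> * (real k * C)) ^ 3 / 6 + s\<^sup>2 * e / 2 + u\<^sup>2 / 2" by simp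
  qed
  finally show ?thesis .
qed

lemma char_N_blocks:
  fixes s :: real
  assumes V: "\<And>x. \<bar>V k x - real k * v\<bar> \<le> e" and v: "v \<ge> 0"
  defines "u \<equiv> s\<^sup>2 * (real k * v) / 2"
  shows "cmod (char_N s (J * k) - complex_of_real (exp (- (real J * u))))
     \<le> real J * ((\<bar>s\<bar> * (real k * C)) ^ 3 / 6 + s\<^sup>2 * e / 2 + u\<^sup>2 / 2)"
proof (induction J)
  case 0
  show ?case using S.prob_space by (simp add: char_N_def N_def)
next
  case (Suc J)
  let ?\<eta> = "(\<bar>s\<bar> * (real k * C)) ^ 3 / 6 + s\<^sup>2 * e / 2 + u\<^sup>2 / 2"
  let ?w = "complex_of_real (exp (- u))"
  have w: "cmod ?w \<le> 1" using v by (simp add: u_def)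
  have e: "complex_of_real (exp (- (real (Suc J) * u))) = ?w * complex_of_real (exp (- (real J * u)))"
    by (simp add: exp_add[symmetric] algebra_simps flip: of_real_mult)
  have "char_N s (Suc J * k) - complex_of_real (exp (- (real (Suc J) * u)))
      = (char_N s (J * k + k) - ?w * char_N s (J * k)) + ?w * (char_N s (J * k) - complex_of_real (exp (- (real J * u))))"
    unfolding e by (simp add: algebra_simps)
  also have "cmod \<dots> \<le> ?\<eta> + real J * ?\<eta>"
  proof (rule norm_triangle_mono)
    show "cmod (char_N s (J * k + k) - ?w * char_N s (J * k)) \<le> ?\<eta>"
      unfolding u_def by (rule char_N_step[OF V v])
    show "cmod (?w * (char_N s (J * k) - complex_of_real (exp (- (real J * u))))) \<le> real J * ?\<eta>"
      using mult_mono[OF w Suc.IH] by (simp add: norm_mult)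
  qed
  also have "?\<eta> + real J * ?\<eta> = real (Suc J) * ?\<eta>"
    by (simp only: of_nat_Suc distrib_right mult_1)
  finally show ?case .
qed

lemma N_diff_le: "\<bar>N (n + r) x - N n x\<bar> \<le> real r * C"
proof (induction r)
  case (Suc r)
  have "N (n + Suc r) x - N n x = (N (n + r) x - N n x) + m ((skew_inv ^^ Suc (n + r)) x)"
    by (simp add: N_def)
  with Suc m_le[of "(skew_inv ^^ Suc (n + r)) x"] show ?case
    by (simp add: algebra_simps del: funpow.simps)
qed simp

lemma integral_iexp_diff_le:
  assumes [measurable]: "F \<in> borel_measurable borel" "G \<in> borel_measurable borel" and le: "\<And>x. \<bar>F x - G x\<bar> \<le> D"
  shows "cmod ((LINT x|\<nu>. iexp (s * F x)) - (LINT x|\<nu>. iexp (s * G x))) \<le> \<bar>s\<bar> * D"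
proof -
  have "(LINT x|\<nu>. iexp (s * F x)) - (LINT x|\<nu>. iexp (s * G x))
     = (LINT x|\<nu>. iexp (s * F x) - iexp (s * G x))"
    by (rule Bochner_Integration.integral_diff[symmetric]) (intro integrable_skew iexp_bb assms)+
  also have "cmod \<dots> \<le> \<bar>s\<bar> * D"
  proof (rule S.integral_norm_bound_const(2))
    fix x
    have "cmod (iexp (s * F x) - iexp (s * G x)) \<le> \<bar>s * F x - s * G x\<bar>" by (rule norm_iexp_diff_le)
    also have "\<dots> = \<bar>s\<bar> * \<bar>F x - G x\<bar>" by (simp add: abs_mult flip: right_diff_distrib)
    also have "\<dots> \<le> \<bar>s\<bar> * D" by (intro mult_left_mono le) auto
    finally show "cmod (iexp (s * F x) - iexp (s * G x)) \<le> \<bar>s\<bar> * D" .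
  qed measurable
  finally show ?thesis .
qed

text \<open>
  The \<open>n mod k\<close> terms outside the complete blocks change the sum by at most \<open>k * C\<close> and the Gaussian exponent by
  at most \<open>u\<close>.
\<close>

lemma char_birkhoff_bound:
  fixes s :: real
  assumes V: "\<And>x. \<bar>V k x - real k * v\<bar> \<le> e" and v: "v \<ge> 0" and k: "k > 0"
    and S[measurable]: "S \<in> borel_measurable borel" and SM: "\<And>x. \<bar>S x - M n x\<bar> \<le> D"
  defines "u \<equiv> s\<^sup>2 * (real k * v) / 2" and "J \<equiv> n div k"
  shows "cmod ((LINT x|\<nu>. iexp (s * S x)) - complex_of_real (exp (- (s\<^sup>2 * real n * v / 2))))
     \<le> \<bar>s\<bar> * (D + real k * C) + real J * ((\<bar>s\<bar> * (real k * C)) ^ 3 / 6 + s\<^sup>2 * e / 2 + u\<^sup>2 / 2) + u"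
proof -
  define r where "r = n mod k"
  have n: "n = J * k + r" "r < k" using k by (auto simp: J_def r_def)
  have 1: "cmod ((LINT x|\<nu>. iexp (s * S x)) - (LINT x|\<nu>. iexp (s * M n x))) \<le> \<bar>s\<bar> * D"
    by (rule integral_iexp_diff_le[OF S M_measurable SM])
  have "(LINT x|\<nu>. iexp (s * M n x)) = (LINT x|\<nu>. iexp (s * N n ((skew_product ^^ n) x)))"
    using N_shift[of 0 n] by (simp add: N_def)
  also have "\<dots> = char_N s n"
    unfolding char_N_def by (rule integral_comp_skew_pow[OF iexp_bb[OF N_measurable]])
  finally have 2: "(LINT x|\<nu>. iexp (s * M n x)) = char_N s n" .
  have 3: "cmod (char_N s n - char_N s (J * k)) \<le> \<bar>s\<bar> * (real k * C)"
    unfolding char_N_def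
  proof (rule integral_iexp_diff_le)
    fix x
    have "\<bar>N n x - N (J * k) x\<bar> \<le> real r * C" using N_diff_le[of "J * k" r x] by (simp add: n(1))
    also have "\<dots> \<le> real k * C" using n(2) C_nonneg by (intro mult_right_mono) auto
    finally show "\<bar>N n x - N (J * k) x\<bar> \<le> real k * C" .
  qed measurable
  have 4: "cmod (char_N s (J * k) - complex_of_real (exp (- (real J * u))))
     \<le> real J * ((\<bar>s\<bar> * (real k * C)) ^ 3 / 6 + s\<^sup>2 * e / 2 + u\<^sup>2 / 2)"
    unfolding u_def by (rule char_N_blocks[OF V v])
  have 5: "cmod (complex_of_real (exp (- (real J * u))) - complex_of_real (exp (- (s\<^sup>2 * real n * v / 2)))) \<le> u"
  proof -
    have eq: "s\<^sup>2 * real n * v / 2 = real J * u + s\<^sup>2 * real r * v / 2"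
      by (simp add: n(1) u_def algebra_simps add_divide_distrib)
    have ge: "0 \<le> s\<^sup>2 * real r * v / 2" "0 \<le> real J * u" using v by (auto simp: u_def)
    have "s\<^sup>2 * real r * v / 2 \<le> u" unfolding u_def using n(2) v
      by (simp add: mult.assoc) (intro mult_left_mono mult_right_mono, auto)
    moreover have "\<bar>exp (- (real J * u)) - exp (- (s\<^sup>2 * real n * v / 2))\<bar> \<le> s\<^sup>2 * real n * v / 2 - real J * u"
      using ge by (intro exp_minus_lipschitz) (auto simp: eq)
    ultimately show ?thesis unfolding of_real_diff[symmetric] norm_of_real using eq by linarith
  qed
  have "cmod ((LINT x|\<nu>. iexp (s * S x)) - complex_of_real (exp (- (s\<^sup>2 * real n * v / 2))))
    \<le> \<bar>s\<bar> * D + \<bar>s\<bar> * (real k * C) + real J * ((\<bar>s\<bar> * (real k * C)) ^ 3 / 6 + s\<^sup>2 * e / 2 + u\<^sup>2 / 2) + u"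
    using 1 3 4 5 unfolding 2 by (rule norm_diff_triangle_le[OF norm_diff_triangle_le[OF norm_diff_triangle_le]])
  then show ?thesis by (simp add: algebra_simps)
qed

text \<open>
  Only the first \<open>L\<close> summands of \<open>V k x - k * v\<close> can be large, and they are bounded independently of \<open>k\<close>.
\<close>

lemma V_cesaro:
  assumes mix: "\<And>e. e > 0 \<Longrightarrow> \<exists>L. \<forall>n\<ge>L. \<forall>x. \<bar>past_exp 0 (\<lambda>x. (m ((skew_product ^^ n) x))\<^sup>2) x - v\<bar> < e"
    and e: "e > 0"
  shows "\<exists>k>0. \<forall>x. \<bar>V k x - real k * v\<bar> \<le> real k * e"
proof -
  obtain L where L: "\<And>n x. n \<ge> L \<Longrightarrow> \<bar>past_exp 0 (\<lambda>x. (m ((skew_product ^^ n) x))\<^sup>2) x - v\<bar> < e / 2"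
    using mix[of "e / 2"] e by auto
  define K where "K = C\<^sup>2 + \<bar>v\<bar>"
  have K: "\<bar>past_exp 0 (\<lambda>x. (m ((skew_product ^^ n) x))\<^sup>2) x - v\<bar> \<le> K" for n x
  proof -
    from norm_past_exp_le[OF m_pow_square_bb[of n], of "C\<^sup>2" 0 x] show ?thesis
      by (simp add: power2_le_iff_abs_le C_nonneg m_le K_def)
  qed
  \<comment> \<open>large enough that the \<open>L\<close> exceptional summands contribute at most \<open>k * e / 2\<close>\<close>
  define k where "k = L + nat \<lceil>2 * real L * K / e\<rceil> + 1"
  have kK: "real L * K \<le> real k * e / 2"
  proof -
    have "2 * real L * K / e \<le> real (nat \<lceil>2 * real L * K / e\<rceil>)" by (rule real_nat_ceiling_ge)
    also have "\<dots> \<le> real k" by (simp add: k_def)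
    finally show ?thesis using e by (simp add: field_simps)
  qed
  show ?thesis
  proof (intro exI[of _ k] conjI allI)
    show "k > 0" by (simp add: k_def)
    fix x
    let ?d = "\<lambda>i. past_exp 0 (\<lambda>x. (m ((skew_product ^^ i) x))\<^sup>2) x - v"
    have "V k x - real k * v = (\<Sum>i<k. ?d i)" by (simp add: V_def sum_subtractf)
    also have "\<bar>\<dots>\<bar> \<le> (\<Sum>i<k. \<bar>?d i\<bar>)" by (rule sum_abs)
    also have "\<dots> \<le> (\<Sum>i<k. (if i < L then K else 0) + e / 2)"
    proof (rule sum_mono)
      fix i
      show "\<bar>?d i\<bar> \<le> (if i < L then K else 0) + e / 2"
        using K[of i x] L[of i x] e by (cases "i < L") auto
    qed
    also have "\<dots> = real L * K + real k * e / 2"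
    proof -
      have "{..<k} \<inter> {i. i < L} = {..<L}" by (auto simp: k_def)
      then show ?thesis by (simp add: sum.distrib sum.If_cases)
    qed
    also have "\<dots> \<le> real k * e" using kK by simp
    finally show "\<bar>V k x - real k * v\<bar> \<le> real k * e" .
  qed
qed

text \<open>
  For a fixed block length \<open>k\<close>, all error terms of \<open>char_birkhoff_bound\<close> at \<open>s = t / (\<sigma> * sqrt n)\<close> vanish as \<open>n\<close> grows,
  except the one from the conditional variance of the blocks. That one is at most \<open>t\<^sup>2 * d / (2 * \<sigma>\<^sup>2)\<close> and becomes
  small through the choice of \<open>k\<close>. The bounded difference between \<open>S n\<close> and \<open>M n\<close> accommodates a coboundary.
\<close>

lemma central_limit:
  assumes mix: "\<And>e. e > 0 \<Longrightarrow> \<exists>L. \<forall>n\<ge>L. \<forall>x. \<bar>past_exp 0 (\<lambda>x. (m ((skew_product ^^ n) x))\<^sup>2) x - \<sigma>\<^sup>2\<bar> < e"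
    and \<sigma>: "\<sigma> > 0"
    and S[measurable]: "\<And>n. S n \<in> borel_measurable borel" and SM: "\<And>n x. \<bar>S n x - M n x\<bar> \<le> D"
  shows "weak_conv_m (\<lambda>n. distr (\<nu>) borel (\<lambda>x. S n x / (\<sigma> * sqrt (real n)))) std_normal_distribution"
proof (rule levy_continuity)
  show "real_distribution (distr (\<nu>) borel (\<lambda>x. S n x / (\<sigma> * sqrt (real n))))" for n
    by (rule S.real_distribution_distr) measurable
  show "real_distribution std_normal_distribution" by (rule real_dist_normal_dist)
  fix t :: real
  show "(\<lambda>n. char (distr (\<nu>) borel (\<lambda>x. S n x / (\<sigma> * sqrt (real n)))) t) \<longlonglongrightarrow> char std_normal_distribution t"
  proof (rule LIMSEQ_I)
    fix e :: real assume e: "e > 0"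
    \<comment> \<open>the tolerance for the conditional variance per step; the summand \<open>1\<close> takes care of \<open>t = 0\<close>\<close>
    define d where "d = e * \<sigma>\<^sup>2 / (t\<^sup>2 + 1)"
    have d: "d > 0" using e \<sigma> by (auto simp: d_def intro!: divide_pos_pos add_nonneg_pos)
    obtain k where k: "k > 0" "\<And>x. \<bar>V k x - real k * \<sigma>\<^sup>2\<bar> \<le> real k * d"
      using V_cesaro[OF mix d] by blast
    have main: "t\<^sup>2 * d / (2 * \<sigma>\<^sup>2) \<le> e / 2"
    proof -
      have "t\<^sup>2 * d / (2 * \<sigma>\<^sup>2) = (t\<^sup>2 / (t\<^sup>2 + 1)) * (e / 2) * (\<sigma>\<^sup>2 / \<sigma>\<^sup>2)"
        by (simp add: d_def)
      also have "\<sigma>\<^sup>2 / \<sigma>\<^sup>2 = 1" using \<sigma> by simp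
      also have "(t\<^sup>2 / (t\<^sup>2 + 1)) * (e / 2) * 1 = (t\<^sup>2 / (t\<^sup>2 + 1)) * (e / 2)" by simp
      also have "\<dots> \<le> 1 * (e / 2)"
        using e by (intro mult_right_mono) (auto simp: divide_le_eq_1 add_nonneg_pos)
      finally show ?thesis by simp
    qed
    \<comment> \<open>the error terms that vanish for fixed \<open>k\<close>\<close>
    define rest where "rest n = \<bar>t\<bar> / (\<sigma> * sqrt (real n)) * (D + real k * C)
       + real n * ((\<bar>t\<bar> / (\<sigma> * sqrt (real n)) * (real k * C)) ^ 3 / 6 + (t\<^sup>2 * real k / (2 * real n))\<^sup>2 / 2)
       + t\<^sup>2 * real k / (2 * real n)" for n :: nat
    have "rest \<longlonglongrightarrow> 0"
    proof -
      define c1 where "c1 = (\<bar>t\<bar> / \<sigma> * (real k * C)) ^ 3 / 6 + \<bar>t\<bar> / \<sigma> * (D + real k * C)"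
      define c2 where "c2 = (t\<^sup>2 * real k / 2)\<^sup>2 / 2 + t\<^sup>2 * real k / 2"
      have "(\<lambda>n::nat. 1 / sqrt (real n)) \<longlonglongrightarrow> 0" "(\<lambda>n::nat. 1 / real n) \<longlonglongrightarrow> 0"
        by real_asymp+
      then have "(\<lambda>n::nat. c1 * (1 / sqrt (real n)) + c2 * (1 / real n)) \<longlonglongrightarrow> c1 * 0 + c2 * 0"
        by (intro tendsto_add tendsto_mult tendsto_const)
      then have "(\<lambda>n::nat. c1 * (1 / sqrt (real n)) + c2 * (1 / real n)) \<longlonglongrightarrow> 0" by simp
      then show ?thesis
      proof (rule Lim_transform_eventually)
        show "\<forall>\<^sub>F n in sequentially. c1 * (1 / sqrt (real n)) + c2 * (1 / real n) = rest n"
          using eventually_gt_at_top[of 0]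
        proof eventually_elim
          case (elim n)
          define q where "q = sqrt (real n)"
          have q: "q > 0" "real n = q\<^sup>2" using elim by (simp_all add: q_def)
          show ?case
            unfolding rest_def c1_def c2_def q_def[symmetric] q(2) using q(1) \<sigma>
            by (simp add: field_simps power2_eq_square power3_eq_cube)
        qed
      qed
    qed
    then have "\<forall>\<^sub>F n in sequentially. rest n < e / 2"
      by (rule order_tendstoD(2)) (use e in simp)
    then obtain n0 where n0: "\<And>n. n \<ge> n0 \<Longrightarrow> rest n < e / 2" by (auto simp: eventually_sequentially)
    show "\<exists>n0. \<forall>n\<ge>n0. norm (char (distr (\<nu>) borel (\<lambda>x. S n x / (\<sigma> * sqrt (real n)))) t
        - char std_normal_distribution t) < e"
    proof (intro exI[of _ "max 1 n0"] allI impI)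
      fix n assume n: "n \<ge> max 1 n0"
      then have n1: "real n > 0" by simp
      define s where "s = t / (\<sigma> * sqrt (real n))"
      define u where "u = s\<^sup>2 * (real k * \<sigma>\<^sup>2) / 2"
      have s2: "s\<^sup>2 = t\<^sup>2 / (\<sigma>\<^sup>2 * real n)" by (simp add: s_def power_divide power_mult_distrib)
      have abs_s: "\<bar>s\<bar> = \<bar>t\<bar> / (\<sigma> * sqrt (real n))" using \<sigma> by (simp add: s_def abs_divide abs_mult)
      have u: "u = t\<^sup>2 * real k / (2 * real n)" using \<sigma> n1 by (simp add: u_def s2 field_simps)
      have c1: "char (distr (\<nu>) borel (\<lambda>x. S n x / (\<sigma> * sqrt (real n)))) t
        = (LINT x|\<nu>. iexp (s * S n x))"
        unfolding char_def by (subst integral_distr) (auto simp: s_def)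
      have c2: "char std_normal_distribution t = complex_of_real (exp (- (s\<^sup>2 * real n * \<sigma>\<^sup>2 / 2)))"
        using \<sigma> n1 by (simp add: char_std_normal_distribution s2)
      have "norm (char (distr (\<nu>) borel (\<lambda>x. S n x / (\<sigma> * sqrt (real n)))) t
        - char std_normal_distribution t)
        \<le> \<bar>s\<bar> * (D + real k * C) + real (n div k) * ((\<bar>s\<bar> * (real k * C)) ^ 3 / 6 + s\<^sup>2 * (real k * d) / 2 + u\<^sup>2 / 2) + u"
        unfolding c1 c2 u_def by (rule char_birkhoff_bound[OF k(2) _ k(1) S SM]) simp
      also have "\<dots> \<le> rest n + e / 2"
      proof -
        have nk: "real (n div k) * real k \<le> real n"
          by (metis div_times_less_eq_dividend of_nat_le_iff of_nat_mult)
        have "real (n div k) * (s\<^sup>2 * (real k * d) / 2) = (real (n div k) * real k) * (s\<^sup>2 * d / 2)" by simp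
        also have "\<dots> \<le> real n * (s\<^sup>2 * d / 2)" using nk d by (intro mult_right_mono) auto
        also have "\<dots> = t\<^sup>2 * d / (2 * \<sigma>\<^sup>2)" using n1 \<sigma> by (simp add: s2 field_simps)
        finally have 1: "real (n div k) * (s\<^sup>2 * (real k * d) / 2) \<le> e / 2" using main by linarith
        have "real (n div k) * ((\<bar>s\<bar> * (real k * C)) ^ 3 / 6 + u\<^sup>2 / 2) \<le> real n * ((\<bar>s\<bar> * (real k * C)) ^ 3 / 6 + u\<^sup>2 / 2)"
          using C_nonneg by (intro mult_right_mono) (auto intro!: add_nonneg_nonneg)
        with 1 show ?thesis unfolding rest_def abs_s[symmetric] u[symmetric] by (simp add: distrib_left)
      qed
      also have "\<dots> < e" using n0[of n] n by simp
      finally show "norm (char (distr (\<nu>) borel (\<lambda>x. S n x / (\<sigma> * sqrt (real n)))) t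
        - char std_normal_distribution t) < e" .
    qed
  qed
qed

end

lemma mixing_diophantine_locale:
  fixes \<mu> :: "'d::finite torus measure"
  assumes "prob_space \<mu>" "sets \<mu> = sets borel"
    and "is_norm N" "\<gamma> > 0" "\<tau> > 0" "mixing_diophantine N \<gamma> \<tau> \<mu>"
  shows "\<exists>g. diophantine_prob \<mu> g \<tau>"
proof (rule mixing_diophantine_gap[OF assms(3-6)])
  fix g :: real
  assume g: "g > 0" "\<And>R k. k \<noteq> 0 \<Longrightarrow> (\<And>i. \<bar>k $ i\<bar> \<le> int R) \<Longrightarrow> cmod (fourier_coeff \<mu> k) \<le> 1 - g / real R powr \<tau>"
  have "diophantine_prob \<mu> g \<tau>"
  proof (intro diophantine_prob.intro torus_prob.intro diophantine_prob_axioms.intro)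
    show "cmod (fourier_coeff \<mu> k) \<le> 1 - g / real R powr \<tau>" if "k \<noteq> 0" "\<And>i. \<bar>k $ i\<bar> \<le> int R" for R k
      by (rule g(2)[OF that])
  qed (fact assms g(1))+
  then show ?thesis ..
qed

theorem theorem1p5:
  fixes \<mu> :: "'d::finite torus measure" and N :: "real^'d \<Rightarrow> real"
    and \<gamma> \<tau> \<alpha> :: real and \<phi> :: "(int \<Rightarrow> 'd torus) \<times> 'd torus \<Rightarrow> real"
  assumes "prob_space \<mu>" and "sets \<mu> = sets borel"
    and "is_norm N" and "\<gamma> > 0" and "\<tau> > 0" and "mixing_diophantine N \<gamma> \<tau> \<mu>"
    and "0 < \<alpha>" and "\<alpha> \<le> 1" and "\<alpha> > 2 * \<tau>"
    and "\<phi> \<in> holder_space \<alpha>"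
    and "(LINT x|skew_measure \<mu>. \<phi> x) = 0"
    and "\<not> is_coboundary \<mu> \<phi>"
  shows "\<exists>\<sigma>>0. weak_conv_m
    (\<lambda>n. distr (skew_measure \<mu>) borel
           (\<lambda>x. birkhoff_sum skew_product n \<phi> x / (\<sigma> * sqrt (real n))))
    std_normal_distribution"
proof -
  obtain g where "diophantine_prob \<mu> g \<tau>"
    using mixing_diophantine_locale[OF assms(1-6)] by blast
  then interpret diophantine_prob \<mu> g \<tau> .
  obtain v where hb: "holder_bound \<alpha> v \<phi>" using holder_space_bound[OF assms(10)] by blast
  have \<phi>: "ucb \<phi>" by (rule ucb_holder[OF hb assms(7)])
  obtain r where r: "summable r"
    "\<And>n x. \<bar>forecast n \<phi> x - (LINT x|skew_measure \<mu>. \<phi> x)\<bar> \<le> r n"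
    using holder_mixing_rate[OF hb assms(7-9)] by blast
  have r': "\<bar>forecast n \<phi> x\<bar> \<le> r n" for n x
    using r(2)[of n x] by (simp add: assms(11))
  have geo: "summable (\<lambda>n. v * ((1/2) powr \<alpha>) ^ n)"
    using powr_less_mono2[of \<alpha> "1/2" 1] assms(7) by (intro summable_mult summable_geometric) simp
  obtain h m where hm: "ucb h" "ucb m" "past 1 m" "past_exp 0 m = (\<lambda>x. 0)"
    "\<And>x. \<phi> x = m x + h x - h (skew_product x)"
    using martingale_coboundary_decomposition[OF \<phi> r(1) r' geo holder_past_approx[OF hb assms(7)]] by blast
  obtain C where "\<And>x. norm (m x) \<le> C" using bounded_borelE[OF ucb_bounded_borel[OF hm(2)]] by blast
  then have C: "\<And>x. \<bar>m x\<bar> \<le> C" by simp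
  obtain H where "\<And>x. norm (h x) \<le> H" using bounded_borelE[OF ucb_bounded_borel[OF hm(1)]] by blast
  then have H: "\<And>x. \<bar>h x\<bar> \<le> H" by simp
  interpret mart: stationary_martingale \<mu> m C
    by unfold_locales (use hm C ucb_bounded_borel in auto)
  note u2 = ucb_power2[OF hm(2)]
  define var where "var = (LINT x|skew_measure \<mu>. (m x)\<^sup>2)"
  have "var > 0"
  proof (rule ccontr)
    assume "\<not> var > 0"
    moreover have "var \<ge> 0" by (simp add: var_def)
    ultimately have "var = 0" by simp
    then have "AE x in skew_measure \<mu>. (m x)\<^sup>2 = 0"
      using integral_nonneg_eq_0_iff_AE[OF integrable_skew[OF ucb_bounded_borel[OF u2]]]
      by (simp add: var_def)
    then have "AE x in skew_measure \<mu>. \<phi> x = h x - h (skew_product x)"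
      by eventually_elim (simp add: hm(5))
    then have "is_coboundary \<mu> \<phi>"
      unfolding is_coboundary_def
      using ucb_continuous_map[OF hm(1)] bounded_borel_measurable[OF ucb_bounded_borel[OF hm(1)]] by blast
    with assms(12) show False by simp
  qed
  show ?thesis
  proof (intro exI conjI)
    show "sqrt var > 0" using \<open>var > 0\<close> by simp
    show "weak_conv_m (\<lambda>n. distr (skew_measure \<mu>) borel
           (\<lambda>x. birkhoff_sum skew_product n \<phi> x / (sqrt var * sqrt (real n)))) std_normal_distribution"
    proof (rule mart.central_limit)
      show "\<exists>L. \<forall>n\<ge>L. \<forall>x. \<bar>past_exp 0 (\<lambda>x. (m ((skew_product ^^ n) x))\<^sup>2) x - (sqrt var)\<^sup>2\<bar> < e" if "e > 0" for e
        using ucb_mixing[OF u2 that] \<open>var > 0\<close> by (simp add: var_def)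
      show "sqrt var > 0" using \<open>var > 0\<close> by simp
      show "birkhoff_sum skew_product n \<phi> \<in> borel_measurable borel" for n
      proof -
        note bounded_borel_measurable[OF bounded_borel_skew_pow[OF holder_boundD(2)[OF hb]], measurable]
        have "(\<lambda>x. birkhoff_sum skew_product n \<phi> x) \<in> borel_measurable borel"
          unfolding birkhoff_sum_def by measurable
        then show ?thesis .
      qed
      show "\<bar>birkhoff_sum skew_product n \<phi> x - birkhoff_sum skew_product n m x\<bar> \<le> 2 * H" for n x
        using birkhoff_sum_coboundary[of \<phi> m h skew_product n x, OF hm(5)] H[of x] H[of "(skew_product ^^ n) x"] by linarith
    qed
  qed
qed

end
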